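(* Let $C$ be a complete folding curve. If $E_\infty(C)$ is empty, or if the unique point of $E_\infty(C)$ is an endpoint of some segment of $C$, then there is exactly one covering of $\mathbb{R}^2$ by complete folding curves which contains $C$ and satisfies the local isomorphism property. Otherwise there are exactly two such coverings, and they consist of the same oriented segments and differ only in the way the four segments having the unique point of $E_\infty(C)$ as an endpoint are connected (i.e. in which of these segments are consecutive in a common curve).
   Context: All sequences take values in $\{+1,-1\}$. For a finite sequence $S=(a_1,\dots,a_n)$ write $\overline{S}=(-a_n,\dots,-a_1)$. The $n$-folding sequences are defined recursively: the only $0$-folding sequence is the empty sequence, and the $(n+1)$-folding sequences are exactly the sequences $(\overline{S},+1,S)$ and $(\overline{S},-1,S)$ with $S$ an $n$-folding sequence. A finite sequence $(u_1,\dots,u_m)$ is a subword of a sequence $(b_k)$ if there is $h$ with $u_k=b_{k+h}$ for $1\le k\le m$. A finite folding sequence is a subword of some $n$-folding sequence; a complete folding sequence is a sequence $(a_k)_{k\in\mathbb{Z}}$ all of whose finite subwords are finite folding sequences. For a complete folding sequence $S=(a_h)_{h\in\mathbb{Z}}$ and each $n\in\mathbb{N}$ there is $h_n\in\mathbb{Z}$ with $a_{h_n+k2^{n+1}}=(-1)^k a_{h_n}$ for all $k\in\mathbb{Z}$; the set $E_n(S)=h_n+2^n\mathbb{Z}$ does not depend on the choice of $h_n$. A segment is an oriented unit edge of the lattice $\mathbb{Z}^2$, i.e. an ordered pair $(X,Y)$ with $X,Y\in\mathbb{Z}^2$, $|X-Y|=1$; its support is the unoriented edge $[X,Y]$, $X$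 its initial and $Y$ its terminal point. A complete curve is a sequence $C=(C_i)_{i\in\mathbb{Z}}$ of segments such that the terminal point of $C_i$ is the initial point of $C_{i+1}$, the supports of $C_i,C_{i+1}$ are perpendicular, and all supports are pairwise distinct (curves differing only by a shift of indices are identified). Its associated sequence is $(\eta_i)_{i\in\mathbb{Z}}$, where $\eta_i=+1$ (resp. $-1$) if one turns left (resp. right) when passing from $C_i$ to $C_{i+1}$. A complete folding curve is a complete curve whose associated sequence $S$ is a complete folding sequence. Let $\Lambda_{2k}=2^k\mathbb{Z}^2$ and $\Lambda_{2k+1}=\mathbb{Z}(2^k,2^k)+\mathbb{Z}(2^k,-2^k)$. For $n\in\mathbb{N}$, $E_n(C)=X+\Lambda_n$ where $X$ is the terminal point of any $C_i$ with $i\in E_n(S)$ (this does not depend on $i$), and $E_\infty(C)=\bigcap_n E_n(C)$, which is empty or a single point. A covering of $\mathbb{R}^2$ by complete folding curves is a set $\mathcal{C}$ of complete folding curves such that every edge $[(x,y),(x+1,y)]$ or $[(x,y),(x,y+1)]$ with $x,y\in\mathbb{Z}$ is the support of exactly one segment of exactly one curve of $\mathcal{C}$. A decorated segment of $\mathcal{C}$ is a segment of a curve of $\mathcal{C}$ together with, at each of its endpoints, the support of the segment of the same curve which precedes/follows it there. $\mathcal{C}$ satisfies the local isomorphism property if for every finite set $F$ of decorated segments of $\mathcal{C}$ there is $r>0$ such that every disk of radius $r$ in $\mathbb{R}^2$ contains a translate $v+F$ ($v\in\mathbb{Z}^2$) which is a set of decorated segments of $\mathcal{C}$. *)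

theory Defs
  imports "HOL-Analysis.Analysis" "HOL-Library.Sublist"
begin

definition overline :: "int list \<Rightarrow> int list" where
  "overline S = map uminus (rev S)"

inductive n_folding :: "nat \<Rightarrow> int list \<Rightarrow> bool" where
  zero: "n_folding 0 []"
| plus: "n_folding n S \<Longrightarrow> n_folding (Suc n) (overline S @ [1] @ S)"
| minus: "n_folding n S \<Longrightarrow> n_folding (Suc n) (overline S @ [-1] @ S)"

definition finite_folding :: "int list \<Rightarrow> bool" where
  "finite_folding u \<longleftrightarrow> (\<exists>n S. n_folding n S \<and> sublist u S)"

definition complete_folding_seq :: "(int \<Rightarrow> int) \<Rightarrow> bool" where
  "complete_folding_seq a \<longleftrightarrow> (\<forall>h k. finite_folding (map a [h..k]))"

text \<open>For a complete folding sequence \<open>a\<close>, an admissible \<open>h\<close> exists for every \<open>n\<close> and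
  \<open>h + 2\<^sup>n\<int>\<close> is the same for all of them, so the union over all admissible \<open>h\<close> taken
  here is that common set.\<close>

definition E_seq :: "nat \<Rightarrow> (int \<Rightarrow> int) \<Rightarrow> int set" where
  "E_seq n a = {h + j * 2 ^ n | h j.
     \<forall>k. a (h + k * 2 ^ (n + 1)) = (-1) ^ nat \<bar>k\<bar> * a h}"

type_synonym point = "int \<times> int"
type_synonym segment = "point \<times> point"
type_synonym edge = "point set"

definition real_point :: "point \<Rightarrow> real \<times> real" where
  "real_point X = (real_of_int (fst X), real_of_int (snd X))"

definition is_segment :: "segment \<Rightarrow> bool" where
  "is_segment s \<longleftrightarrow> dist (real_point (fst s)) (real_point (snd s)) = 1"

text \<open>The unoriented edge \<open>[X, Y]\<close> is represented by the set \<open>{X, Y}\<close> of its endpoints.\<close>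

definition support :: "segment \<Rightarrow> edge" where
  "support s = {fst s, snd s}"

definition direction :: "segment \<Rightarrow> point" where
  "direction s = snd s - fst s"

definition perpendicular :: "segment \<Rightarrow> segment \<Rightarrow> bool" where
  "perpendicular s t \<longleftrightarrow>
     fst (direction s) * fst (direction t) + snd (direction s) * snd (direction t) = 0"

definition complete_curve :: "(int \<Rightarrow> segment) \<Rightarrow> bool" where
  "complete_curve C \<longleftrightarrow>
     (\<forall>i. is_segment (C i)) \<and>
     (\<forall>i. snd (C i) = fst (C (i + 1))) \<and>
     (\<forall>i. perpendicular (C i) (C (i + 1))) \<and>
     inj (\<lambda>i. support (C i))"

text \<open>The determinant of two perpendicular unit vectors of the lattice is \<open>1\<close> for a left turn
  and \<open>-1\<close> for a right turn.\<close>

definition turns :: "(int \<Rightarrow> segment) \<Rightarrow> int \<Rightarrow> int" where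
  "turns C i =
     fst (direction (C i)) * snd (direction (C (i + 1)))
     - snd (direction (C i)) * fst (direction (C (i + 1)))"

definition complete_folding_curve :: "(int \<Rightarrow> segment) \<Rightarrow> bool" where
  "complete_folding_curve C \<longleftrightarrow> complete_curve C \<and> complete_folding_seq (turns C)"

definition Lambda :: "nat \<Rightarrow> point set" where
  "Lambda n = (let q = 2 ^ (n div 2) in
     if even n then {(x * q, y * q) | x y. True}
     else {(x * q + y * q, x * q - y * q) | x y. True})"

definition E_curve :: "nat \<Rightarrow> (int \<Rightarrow> segment) \<Rightarrow> point set" where
  "E_curve n C = {snd (C i) + v | i v. i \<in> E_seq n (turns C) \<and> v \<in> Lambda n}"

definition E_inf :: "(int \<Rightarrow> segment) \<Rightarrow> point set" where
  "E_inf C = (\<Inter>n. E_curve n C)"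

text \<open>Curves that differ only by a shift of indices are identified: a curve proper is the class
  of all shifts of a parametrized one, and a covering is a set of such classes.\<close>

type_synonym curve = "(int \<Rightarrow> segment) set"

definition curve_class :: "(int \<Rightarrow> segment) \<Rightarrow> curve" where
  "curve_class C = {D. \<exists>k. \<forall>i. D i = C (i + k)}"

definition curve_segments :: "curve \<Rightarrow> segment set" where
  "curve_segments \<gamma> = {D i | D i. D \<in> \<gamma>}"

definition lattice_edges :: "edge set" where
  "lattice_edges = {{(x, y), (x + 1, y)} | x y. True} \<union> {{(x, y), (x, y + 1)} | x y. True}"

definition folding_covering :: "curve set \<Rightarrow> bool" where
  "folding_covering \<C> \<longleftrightarrow>
     (\<forall>\<gamma>\<in>\<C>. \<exists>C. complete_folding_curve C \<and> \<gamma> = curve_class C) \<and>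
     (\<forall>e\<in>lattice_edges. \<exists>!p. p \<in> (SIGMA \<gamma>:\<C>. curve_segments \<gamma>) \<and> support (snd p) = e)"

text \<open>A decorated segment \<open>(e, s, f)\<close> consists of a segment \<open>s\<close>, the support \<open>e\<close> of its
  predecessor and the support \<open>f\<close> of its successor.\<close>

type_synonym decorated = "edge \<times> segment \<times> edge"

definition decorated_segments :: "curve set \<Rightarrow> decorated set" where
  "decorated_segments \<C> =
     {(support (D (i - 1)), D i, support (D (i + 1))) | \<gamma> D i. \<gamma> \<in> \<C> \<and> D \<in> \<gamma>}"

fun translate :: "point \<Rightarrow> decorated \<Rightarrow> decorated" where
  "translate v (e, (X, Y), f) = ((+) v ` e, (v + X, v + Y), (+) v ` f)"

fun region :: "decorated \<Rightarrow> (real \<times> real) set" where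
  "region (e, s, f) =
     convex hull (real_point ` e) \<union> convex hull (real_point ` support s)
     \<union> convex hull (real_point ` f)"

definition local_isomorphism_property :: "curve set \<Rightarrow> bool" where
  "local_isomorphism_property \<C> \<longleftrightarrow>
     (\<forall>F. finite F \<and> F \<subseteq> decorated_segments \<C> \<longrightarrow>
       (\<exists>r>0. \<forall>c. \<exists>v. translate v ` F \<subseteq> decorated_segments \<C> \<and>
          (\<forall>d\<in>translate v ` F. region d \<subseteq> cball c r)))"

definition LI_coverings_containing :: "(int \<Rightarrow> segment) \<Rightarrow> curve set set" where
  "LI_coverings_containing C =
     {\<C>. folding_covering \<C> \<and> curve_class C \<in> \<C> \<and> local_isomorphism_property \<C>}"

definition covering_segments :: "curve set \<Rightarrow> segment set" where
  "covering_segments \<C> = (\<Union>\<gamma>\<in>\<C>. curve_segments \<gamma>)"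

definition connections :: "curve set \<Rightarrow> (segment \<times> segment) set" where
  "connections \<C> = {(D i, D (i + 1)) | \<gamma> D i. \<gamma> \<in> \<C> \<and> D \<in> \<gamma>}"

text \<open>Consecutive segments \<open>(s, t)\<close> are connected at the terminal point \<open>snd s = fst t\<close>.\<close>

definition differ_only_at :: "point \<Rightarrow> curve set \<Rightarrow> curve set \<Rightarrow> bool" where
  "differ_only_at P \<C> \<D> \<longleftrightarrow>
     covering_segments \<C> = covering_segments \<D> \<and>
     card {s \<in> covering_segments \<C>. P \<in> support s} = 4 \<and>
     {(s, t) \<in> connections \<C>. snd s \<noteq> P} = {(s, t) \<in> connections \<D>. snd s \<noteq> P} \<and>
     {(s, t) \<in> connections \<C>. snd s = P} \<noteq> {(s, t) \<in> connections \<D>. snd s = P}"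

end

theory Submission
  imports Defs
begin

text \<open>
  Identify the plane lattice with the Gaussian integers, so that \<open>Lambda n\<close> is generated by
  \<open>(1 + \<i>) ^ n\<close>. In a complete folding curve the turns at the points of \<open>E_n\<close> outside \<open>E_{n+1}\<close>
  alternate, and the vertices visited there change by elements of \<open>Lambda (n + 1)\<close> outside
  \<open>Lambda (n + 2)\<close>. The turn is therefore a function of the vertex, and it extends uniquely to a
  sign on all lattice points outside \<open>E_inf\<close>. Conversely, the orbits of the rule ``turn according to
  the sign of the vertex'' form a covering by complete folding curves with the local isomorphism
  property, whatever the sign at the point of \<open>E_inf\<close> is.

  For uniqueness the decisive fact is that every folding curve covers all edges of arbitrarily large
  squares. Then, by the local isomorphism property, every finite pattern of a covering containing
  \<open>C\<close> is a translate of a pattern of \<open>C\<close> alone. Applied to a single segment together with a long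
  piece of \<open>C\<close>, this forces the orientation of the segment and its turn. Squares grow under
  refinement: two unfolding steps turn a full block of \<open>k \<times> k\<close> squares into one of side \<open>2 k - 2\<close>, for
  any choice of the folds, and a full block of side 3 appears after at most nine unfoldings of a
  single edge.
\<close>

section \<open>The lattices of the derived curves\<close>

text \<open>An arbitrary covering has to be compared with \<open>C\<close>, although an occurrence
  of a pattern matches only a finite piece of \<open>C\<close>. This suffices because a finite piece
  fixes its position two-adically: a folding sequence that agrees with its shift by \<open>k\<close>
  on a window of length comparable to \<open>2 ^ n\<close> has \<open>2 ^ n\<close> dividing
  \<open>k\<close>. Along the path this divisibility puts the translation into
  \<open>Lambda n\<close>, and such a translation preserves the sign at all points of sufficiently
  low level. The point of \<open>E_inf\<close> has no level, so no translation of this kind controls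
  its sign; it is free unless \<open>C\<close> passes through the point. For the local isomorphism
  property the same point is the obstacle: it is imitated by points of a high exact level, where
  both signs occur. The growth of squares cannot start from one square, since
  \<open>2 * k - 2\<close> exceeds \<open>k\<close> only from \<open>k = 3\<close> on; hence the
  finite search for a block of side 3.\<close>

definition turn :: "int \<Rightarrow> point \<Rightarrow> point" where
  "turn s z = (- s * snd z, s * fst z)"

text \<open>In Gaussian integers this is multiplication by \<open>1 + i\<close>, as
  \<open>turn s\<close> is multiplication by \<open>s * i\<close>. These maps commute, and
  \<open>turn (- s)\<close> inverts \<open>turn s\<close> when \<open>s\<close> is a sign.\<close>

definition dil :: "point \<Rightarrow> point" where
  "dil z = (fst z - snd z, fst z + snd z)"

lemma dil_add: "dil (x + y) = dil x + dil y"
  and dil_diff: "dil (x - y) = dil x - dil y"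
  and dil_uminus: "dil (- x) = - dil x"
  and dil_turn: "dil (turn s x) = turn s (dil x)"
  by (auto simp: dil_def turn_def prod_eq_iff algebra_simps)

lemma turn_add: "turn s (x + y) = turn s x + turn s y"
  and turn_uminus: "turn s (- x) = - turn s x"
  and turn_uminus_sign: "turn (- s) x = - turn s x"
  by (auto simp: turn_def prod_eq_iff algebra_simps)

lemma dil_inject: "dil x = dil y \<longleftrightarrow> x = y"
  by (auto simp: dil_def prod_eq_iff)

lemma turn_turn: "s \<in> {1, -1} \<Longrightarrow> turn s (turn (- s) x) = x"
  "s \<in> {1, -1} \<Longrightarrow> turn (- s) (turn s x) = x"
  by (auto simp: turn_def prod_eq_iff)

lemma Lambda_0: "Lambda 0 = UNIV"
  by (auto simp: Lambda_def)

text \<open>The odd lattices of the definition are \<open>1 + i\<close> times the even ones, up to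
  the sign of the second coefficient. This identity replaces the parity split: the closure and index
  facts below follow by induction on the level.\<close>

lemma Lambda_Suc: "Lambda (Suc n) = dil ` Lambda n"
proof (cases "even n")
  case True
  have 1: "Suc n div 2 = n div 2" using True by simp
  show ?thesis
  proof (intro set_eqI iffI)
    fix z assume "z \<in> Lambda (Suc n)"
    then obtain x y where z: "z = (x * 2 ^ (n div 2) + y * 2 ^ (n div 2), x * 2 ^ (n div 2) - y * 2 ^ (n div 2))"
      using True by (auto simp: Lambda_def Let_def)
    have "z = dil (x * 2 ^ (n div 2), (-y) * 2 ^ (n div 2))" unfolding z dil_def by simp
    moreover have "(x * 2 ^ (n div 2), (-y) * 2 ^ (n div 2)) \<in> Lambda n"
      using True unfolding Lambda_def Let_def by (auto simp del: mult_minus_left)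
    ultimately show "z \<in> dil ` Lambda n" by blast
  next
    fix z assume "z \<in> dil ` Lambda n"
    then obtain x y where z: "z = dil (x * 2 ^ (n div 2), y * 2 ^ (n div 2))"
      using True by (auto simp: Lambda_def Let_def)
    have "z = (x * 2 ^ (n div 2) + (-y) * 2 ^ (n div 2), x * 2 ^ (n div 2) - (-y) * 2 ^ (n div 2))"
      unfolding z dil_def by simp
    then show "z \<in> Lambda (Suc n)" using True 1 unfolding Lambda_def Let_def
      by (auto simp del: mult_minus_left)
  qed
next
  case False
  then have 1: "Suc n div 2 = Suc (n div 2)" by simp
  show ?thesis
  proof (intro set_eqI iffI)
    fix z assume "z \<in> Lambda (Suc n)"
    then obtain x y where z: "z = (x * 2 ^ Suc (n div 2), y * 2 ^ Suc (n div 2))"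
      using False by (auto simp: Lambda_def Let_def)
    have "z = dil (y * 2 ^ (n div 2) + x * 2 ^ (n div 2), y * 2 ^ (n div 2) - x * 2 ^ (n div 2))"
      unfolding z dil_def by simp
    moreover have "(y * 2 ^ (n div 2) + x * 2 ^ (n div 2), y * 2 ^ (n div 2) - x * 2 ^ (n div 2)) \<in> Lambda n"
      using False unfolding Lambda_def Let_def by auto
    ultimately show "z \<in> dil ` Lambda n" by blast
  next
    fix z assume "z \<in> dil ` Lambda n"
    then obtain x y where z: "z = dil (x * 2 ^ (n div 2) + y * 2 ^ (n div 2), x * 2 ^ (n div 2) - y * 2 ^ (n div 2))"
      using False by (auto simp: Lambda_def Let_def)
    have "z = (y * 2 ^ Suc (n div 2), x * 2 ^ Suc (n div 2))"
      unfolding z dil_def by simp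
    then show "z \<in> Lambda (Suc n)" using False by (auto simp: Lambda_def Let_def)
  qed
qed

lemma dil_in_Lambda_Suc [simp]: "dil z \<in> Lambda (Suc n) \<longleftrightarrow> z \<in> Lambda n"
  by (auto simp: Lambda_Suc dil_inject)

lemma Lambda_SucE:
  assumes "z \<in> Lambda (Suc n)" obtains z' where "z = dil z'" "z' \<in> Lambda n"
  using assms by (auto simp: Lambda_Suc)

lemma Lambda_1: "z \<in> Lambda (Suc 0) \<longleftrightarrow> even (fst z + snd z)"
proof
  assume "even (fst z + snd z)"
  then have "z = dil ((fst z + snd z) div 2, (snd z - fst z) div 2)"
    unfolding dil_def prod_eq_iff fst_conv snd_conv by presburger
  then show "z \<in> Lambda (Suc 0)" by (metis Lambda_0 UNIV_I dil_in_Lambda_Suc)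
qed (auto simp: Lambda_Suc Lambda_0 dil_def)

lemma Lambda_add: "x \<in> Lambda n \<Longrightarrow> y \<in> Lambda n \<Longrightarrow> x + y \<in> Lambda n"
proof (induction n arbitrary: x y)
  case (Suc n)
  then show ?case by (metis Lambda_SucE dil_add dil_in_Lambda_Suc)
qed (simp add: Lambda_0)

lemma Lambda_uminus: "x \<in> Lambda n \<Longrightarrow> - x \<in> Lambda n"
proof (induction n arbitrary: x)
  case (Suc n)
  then show ?case by (metis Lambda_SucE dil_uminus dil_in_Lambda_Suc)
qed (simp add: Lambda_0)

lemma Lambda_diff: "x \<in> Lambda n \<Longrightarrow> y \<in> Lambda n \<Longrightarrow> x - y \<in> Lambda n"
  using Lambda_add[OF _ Lambda_uminus] by fastforce

lemma Lambda_zero: "0 \<in> Lambda n"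
proof (induction n)
  case (Suc n)
  have "dil 0 = 0" by (simp add: dil_def prod_eq_iff)
  then show ?case using Suc by (metis dil_in_Lambda_Suc)
qed (simp add: Lambda_0)

lemma Lambda_turn: "x \<in> Lambda n \<Longrightarrow> turn s x \<in> Lambda n"
proof (induction n arbitrary: x)
  case (Suc n)
  then show ?case by (metis Lambda_SucE dil_turn dil_in_Lambda_Suc)
qed (simp add: Lambda_0)

lemma Lambda_turn_iff: "s \<in> {1, -1} \<Longrightarrow> turn s x \<in> Lambda n \<longleftrightarrow> x \<in> Lambda n"
  by (metis Lambda_turn turn_turn(2))

lemma Lambda_Suc_subset: "Lambda (Suc n) \<subseteq> Lambda n"
proof
  fix z assume "z \<in> Lambda (Suc n)"
  then obtain z' where z': "z = dil z'" "z' \<in> Lambda n" by (rule Lambda_SucE)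
  have "z = z' + turn 1 z'" by (simp add: z' dil_def turn_def prod_eq_iff)
  then show "z \<in> Lambda n" using z' Lambda_add Lambda_turn by metis
qed

lemma Lambda_mono: "m \<le> n \<Longrightarrow> Lambda n \<subseteq> Lambda m"
  by (rule lift_Suc_antimono_le[of Lambda]) (rule Lambda_Suc_subset)

text \<open>The norm of \<open>1 + i\<close> is 2, so each lattice has index 2 in the previous one.
  At the bottom this is the parity of the coordinate sum, and \<open>dil\<close> carries it to every
  level.\<close>

lemma Lambda_index_two:
  "x \<in> Lambda n \<Longrightarrow> y \<in> Lambda n \<Longrightarrow> x \<notin> Lambda (Suc n) \<Longrightarrow> y \<notin> Lambda (Suc n) \<Longrightarrow>
    x + y \<in> Lambda (Suc n)"
proof (induction n arbitrary: x y)
  case 0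
  then show ?case by (auto simp: Lambda_1)
next
  case (Suc n)
  obtain x' where x': "x = dil x'" "x' \<in> Lambda n" using Suc.prems(1) by (rule Lambda_SucE)
  obtain y' where y': "y = dil y'" "y' \<in> Lambda n" using Suc.prems(2) by (rule Lambda_SucE)
  show ?case using Suc x' y' by (metis dil_add dil_in_Lambda_Suc)
qed

lemma Lambda_Suc_add_iff:
  assumes "x \<in> Lambda n" "y \<in> Lambda n"
  shows "x + y \<in> Lambda (Suc n) \<longleftrightarrow> (x \<in> Lambda (Suc n) \<longleftrightarrow> y \<in> Lambda (Suc n))"
proof -
  have "x + y - x = y" "x + y - y = x" by simp_all
  then show ?thesis using Lambda_index_two[OF assms] Lambda_add[of x "Suc n" y]
    Lambda_diff[of "x + y" "Suc n" x] Lambda_diff[of "x + y" "Suc n" y] by metis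
qed

lemma Lambda_diff_commute: "x - y \<in> Lambda n \<longleftrightarrow> y - x \<in> Lambda n"
  using Lambda_uminus[of "x - y" n] Lambda_uminus[of "y - x" n] by auto

lemma Lambda_Inter:
  assumes "\<And>n. z \<in> Lambda n" shows "z = 0"
proof -
  have dvd: "2 ^ k dvd fst z \<and> 2 ^ k dvd snd z" for k
    using assms[of "2 * k"] by (auto simp: Lambda_def Let_def)
  have "w = 0" if "\<And>k. 2 ^ k dvd w" for w :: int
  proof (rule ccontr)
    assume "w \<noteq> 0"
    then have "2 ^ nat \<bar>w\<bar> \<le> \<bar>w\<bar>" using that zdvd_imp_le[of "2 ^ nat \<bar>w\<bar>" "\<bar>w\<bar>"] by simp
    moreover have "\<bar>w\<bar> < 2 ^ nat \<bar>w\<bar>"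
      using of_nat_less_two_power[of "nat \<bar>w\<bar>", where 'a=int] by simp
    ultimately show False by simp
  qed
  then show ?thesis using dvd by (simp add: prod_eq_iff)
qed

text \<open>The points of exact level \<open>n\<close>, the counterpart of exact divisibility by
  \<open>2 ^ n\<close> for indices.\<close>

definition shell :: "nat \<Rightarrow> point set" where
  "shell n = Lambda n - Lambda (Suc n)"

lemma shell_turn: "d \<in> shell n \<Longrightarrow> s \<in> {1, -1} \<Longrightarrow> turn s d \<in> shell n"
  by (simp add: shell_def Lambda_turn_iff del: insert_iff)

text \<open>Since \<open>1 - i\<close> is \<open>1 + i\<close> times \<open>- i\<close>, both
  numbers \<open>1 + s * i\<close> are \<open>1 + i\<close> times a unit, so the level rises by
  exactly one.\<close>

lemma shell_add_turn:
  assumes "d \<in> shell n" "s \<in> {1, -1}"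
  shows "d + turn s d \<in> shell (Suc n)"
proof -
  have "d + turn s d = dil d \<or> d + turn s d = dil (turn s d)"
    using assms(2) by (auto simp: dil_def turn_def prod_eq_iff)
  then show ?thesis using assms shell_turn[OF assms] by (auto simp: shell_def)
qed

lemma shell_steps:
  fixes f :: "int \<Rightarrow> point"
  assumes "\<And>k. f (k + 1) - f k \<in> shell n"
  shows "f k - f 0 \<in> Lambda n \<and> (f k - f 0 \<in> Lambda (Suc n) \<longleftrightarrow> even k)"
proof (induction k rule: int_induct[where k = 0])
  case base
  then show ?case by (simp add: Lambda_zero)
next
  case (step1 i)
  have *: "f (i + 1) - f 0 = (f (i + 1) - f i) + (f i - f 0)" by simp
  have "f (i + 1) - f i \<in> Lambda n" "f i - f 0 \<in> Lambda n" "f (i + 1) - f i \<notin> Lambda (Suc n)"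
    using step1 assms[of i] by (auto simp: shell_def)
  note this(3) Lambda_add[OF this(1,2)] Lambda_Suc_add_iff[OF this(1,2)]
  then show ?case unfolding *[symmetric] using step1 by simp
next
  case (step2 i)
  have *: "f (i - 1) - f 0 = - (f (i - 1 + 1) - f (i - 1)) + (f i - f 0)" by simp
  have "- (f (i - 1 + 1) - f (i - 1)) \<in> shell n"
    using assms[of "i - 1"] Lambda_uminus unfolding shell_def
    by (metis DiffD1 DiffD2 DiffI minus_minus)
  then have "- (f (i - 1 + 1) - f (i - 1)) \<in> Lambda n" "f i - f 0 \<in> Lambda n"
    "- (f (i - 1 + 1) - f (i - 1)) \<notin> Lambda (Suc n)"
    using step2 by (auto simp: shell_def)
  note this(3) Lambda_add[OF this(1,2)] Lambda_Suc_add_iff[OF this(1,2)]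
  then show ?case unfolding *[symmetric] using step2 by simp
qed

section \<open>Folding sequences\<close>

text \<open>\<open>e\<close> represents the class of indices of level at least \<open>n\<close>; an
  index has level \<open>m < n\<close> when \<open>2 ^ m\<close> divides its distance from
  \<open>e\<close> exactly. The base point may depend on \<open>n\<close>: a common one for all
  \<open>n\<close> would be a two-adic integer and need not be an ordinary integer.\<close>

definition folds :: "(int \<Rightarrow> int) \<Rightarrow> nat \<Rightarrow> int \<Rightarrow> bool" where
  "folds a n e \<longleftrightarrow>
     (\<forall>m<n. \<forall>i. 2 ^ m dvd i - e \<and> \<not> 2 ^ Suc m dvd i - e \<longrightarrow> a (i + 2 ^ Suc m) = - a i)"

definition fold_seq :: "(int \<Rightarrow> int) \<Rightarrow> bool" where
  "fold_seq a \<longleftrightarrow> (\<forall>i. a i \<in> {1, -1}) \<and> (\<forall>n. \<exists>e. folds a n e)"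

lemma folds_mono: "folds a n e \<Longrightarrow> m \<le> n \<Longrightarrow> folds a m e"
  by (auto simp: folds_def)

lemma folds_cong:
  assumes "folds a n e" "2 ^ n dvd e' - e"
  shows "folds a n e'"
  unfolding folds_def
proof (intro allI impI)
  fix m i assume m: "m < n" and i: "2 ^ m dvd i - e' \<and> \<not> 2 ^ Suc m dvd i - e'"
  have *: "2 ^ l dvd i - e \<longleftrightarrow> 2 ^ l dvd i - e'" if "l \<le> n" for l
  proof -
    have "2 ^ l dvd e' - e" using assms(2) that by (meson dvd_trans le_imp_power_dvd)
    then show ?thesis using dvd_add_right_iff[of "2 ^ l" "e' - e" "i - e'"] by simp
  qed
  show "a (i + 2 ^ Suc m) = - a i"
    using assms(1) m i *[of m] *[of "Suc m"] unfolding folds_def by auto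
qed

lemma folds_multiple:
  assumes "folds a n e" "m < n" "2 ^ m dvd i - e" "\<not> 2 ^ Suc m dvd i - e"
  shows "a (i + k * 2 ^ Suc m) = (if even k then a i else - a i)"
proof (induction k rule: int_induct[where k = 0])
  case base
  then show ?case by simp
next
  have ex: "2 ^ m dvd i + j * 2 ^ Suc m - e \<and> \<not> 2 ^ Suc m dvd i + j * 2 ^ Suc m - e" for j
  proof -
    have "i + j * 2 ^ Suc m - e = (i - e) + j * 2 ^ Suc m" by simp
    moreover have "(2::int) ^ m dvd j * 2 ^ Suc m" "(2::int) ^ Suc m dvd j * 2 ^ Suc m" by auto
    ultimately show ?thesis using assms(3,4) by (metis dvd_add_left_iff)
  qed
  have st: "a (i + j * 2 ^ Suc m + 2 ^ Suc m) = - a (i + j * 2 ^ Suc m)" for j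
    using assms(1,2) ex[of j] unfolding folds_def by blast
  { case (step1 j)
    then show ?case using st[of j] by (simp add: algebra_simps)
  next
    case (step2 j)
    have "i + (j - 1) * 2 ^ Suc m + 2 ^ Suc m = i + j * 2 ^ Suc m" by (simp add: algebra_simps)
    then show ?case using st[of "j - 1"] step2 by (simp add: algebra_simps split: if_splits) }
qed

lemma exact_power_two:
  fixes k :: int
  assumes "\<not> 2 ^ n dvd k"
  shows "\<exists>m<n. 2 ^ m dvd k \<and> \<not> 2 ^ Suc m dvd k"
  using assms
proof (induction n)
  case (Suc n)
  then show ?case by (cases "2 ^ n dvd k") (auto intro: less_SucI)
qed simp

text \<open>If \<open>2 ^ m\<close> exactly divides the period \<open>k\<close>, compare an index \<open>i\<close> of level \<open>m\<close> with the index
  \<open>i + k\<close> of level \<open>m + 1\<close>: a shift by \<open>2 ^ (m + 2)\<close> preserves the former entry and negates the latter.\<close>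

lemma folds_period_exact:
  assumes pm: "\<And>i. a i \<in> {1, -1}" and fo: "folds a (m + 2) e"
    and k: "2 ^ m dvd k" "\<not> 2 ^ Suc m dvd k"
    and per: "\<And>i. L \<le> i \<Longrightarrow> i \<le> L + 2 ^ (m + 3) \<Longrightarrow> a (i + k) = a i"
  shows False
proof -
  \<comment> \<open>\<open>i\<close> is the first index from \<open>L\<close> on with
    \<open>i + k\<close> congruent to \<open>e + 2 ^ Suc m\<close> modulo
    \<open>2 ^ (m + 2)\<close>. Then \<open>i + k\<close> has level \<open>m + 1\<close>,
    \<open>i\<close> has level \<open>m\<close>, and both \<open>i\<close> and
    \<open>i + 2 ^ (m + 2)\<close> lie in the window.\<close>
  define r where "r = (e + 2 ^ Suc m - k - L) mod 2 ^ (m + 2)"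
  define i where "i = L + r"
  have r: "0 \<le> r" "r < 2 ^ (m + 2)" by (auto simp: r_def)
  have d: "2 ^ (m + 2) dvd i + k - e - 2 ^ Suc m"
  proof -
    have "2 ^ (m + 2) dvd r - (e + 2 ^ Suc m - k - L)"
      unfolding r_def by (simp add: mod_eq_dvd_iff[symmetric])
    then show ?thesis by (simp add: i_def algebra_simps)
  qed
  have d1: "2 ^ Suc m dvd i + k - e - 2 ^ Suc m" "2 ^ m dvd i + k - e - 2 ^ Suc m"
    by (rule dvd_trans[OF le_imp_power_dvd d], simp)+
  have i: "2 ^ m dvd i - e" "\<not> 2 ^ Suc m dvd i - e"
  proof -
    have eq: "i - e = (i + k - e - 2 ^ Suc m) + 2 ^ Suc m - k" by simp
    have "2 ^ Suc m dvd (i + k - e - 2 ^ Suc m) + 2 ^ Suc m" using d1 by (simp only: dvd_add dvd_refl)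
    then show "\<not> 2 ^ Suc m dvd i - e" using k(2) unfolding eq
      by (metis dvd_diff_right_iff)
    have "2 ^ m dvd (i + k - e - 2 ^ Suc m) + 2 ^ Suc m"
      using d1 by (intro dvd_add) (auto intro: le_imp_power_dvd simp del: power_Suc)
    then show "2 ^ m dvd i - e" using k(1) unfolding eq by (metis dvd_diff)
  qed
  have j: "2 ^ Suc m dvd i + k - e" "\<not> 2 ^ Suc (Suc m) dvd i + k - e"
  proof -
    have "2 ^ Suc m dvd (i + k - e - 2 ^ Suc m) + 2 ^ Suc m" using d1 by (simp only: dvd_add dvd_refl)
    then show "2 ^ Suc m dvd i + k - e" by simp
    show "\<not> 2 ^ Suc (Suc m) dvd i + k - e"
    proof
      assume "2 ^ Suc (Suc m) dvd i + k - e"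
      then have "2 ^ Suc (Suc m) dvd (2::int) ^ Suc m"
        using d dvd_diff[of "2 ^ Suc (Suc m)" "i + k - e" "i + k - e - 2 ^ Suc m"] by simp
      then show False by (simp add: power_dvd_imp_le)
    qed
  qed
  have "a (i + 2 * 2 ^ Suc m) = a i" using folds_multiple[OF fo _ i, of 2] by simp
  moreover have "a (i + k + 1 * 2 ^ Suc (Suc m)) = - a (i + k)"
    using folds_multiple[OF fo _ j, of 1] by simp
  moreover have "a (i + k) = a i" using per[of i] r by (simp add: i_def power_add)
  moreover have "a (i + 2 * 2 ^ Suc m + k) = a (i + 2 * 2 ^ Suc m)"
    using per[of "i + 2 * 2 ^ Suc m"] r by (simp add: i_def power_add)
  ultimately show False using pm[of i] by (auto simp: algebra_simps)
qed

text \<open>Only a window is assumed to repeat, because an occurrence of a pattern reproduces only a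
  finite piece of a sequence. The window is long enough for the argument at each level
  \<open>m < n\<close>.\<close>

lemma fold_seq_period:
  assumes "fold_seq a"
    and per: "\<And>i. L \<le> i \<Longrightarrow> i \<le> L + 2 ^ (n + 3) \<Longrightarrow> a (i + k) = a i"
  shows "2 ^ n dvd k"
proof (rule ccontr)
  assume "\<not> 2 ^ n dvd k"
  then obtain m where m: "m < n" "2 ^ m dvd k" "\<not> 2 ^ Suc m dvd k" using exact_power_two by blast
  obtain e where "folds a (m + 2) e" using assms(1) unfolding fold_seq_def by blast
  moreover have "a (i + k) = a i" if "L \<le> i" "i \<le> L + 2 ^ (m + 3)" for i
  proof (rule per)
    have "(2::int) ^ (m + 3) \<le> 2 ^ (n + 3)" using m by (intro power_increasing) auto
    then show "i \<le> L + 2 ^ (n + 3)" using that by linarith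
  qed (use that in auto)
  ultimately show False using folds_period_exact[of a m e k L] m assms(1) unfolding fold_seq_def by blast
qed

lemma fold_seq_aperiodic:
  assumes "fold_seq a" "\<And>i. a (i + k) = a i" shows "k = 0"
proof -
  \<comment> \<open>\<open>(k, k)\<close> lies in \<open>Lambda (2 * n)\<close> exactly when
    \<open>2 ^ n\<close> divides \<open>k\<close>, so \<open>Lambda_Inter\<close> also serves for
    integers.\<close>
  have "(k, k) \<in> Lambda (2 * n)" for n
    using fold_seq_period[OF assms(1), of 0 n k] assms(2)
    by (auto simp: Lambda_def Let_def dvd_def mult.commute)
  then have "(k, k) \<in> Lambda n" for n using Lambda_mono[of n "2 * n"] by fastforce
  then show ?thesis using Lambda_Inter[of "(k, k)"] by (simp add: prod_eq_iff)
qed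

text \<open>A shift by \<open>2 ^ (n + 1)\<close> is an even number of periods for each level below
  \<open>n\<close>, so the alternation in \<open>E_seq\<close> excludes these levels.
  \<open>Suc n\<close> levels are assumed because level \<open>n\<close> itself must be known to
  alternate.\<close>

lemma E_seq_folds:
  assumes pm: "\<And>i. a i \<in> {1, -1}" and fo: "folds a (Suc n) e"
  shows "E_seq n a = {i. 2 ^ n dvd i - e}"
proof (intro set_eqI iffI)
  have sg: "(-1) ^ nat \<bar>k\<bar> * x = (if even k then x else - x)" for k x :: int
    by (simp add: even_nat_iff)
  fix i
  { assume "i \<in> E_seq n a"
    then obtain h j where i: "i = h + j * 2 ^ n"
      and h: "\<And>k. a (h + k * 2 ^ (n + 1)) = (-1) ^ nat \<bar>k\<bar> * a h" by (auto simp: E_seq_def)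
    have "2 ^ n dvd h - e"
    proof (rule ccontr)
      assume "\<not> 2 ^ n dvd h - e"
      then obtain m where m: "m < n" "2 ^ m dvd h - e" "\<not> 2 ^ Suc m dvd h - e"
        using exact_power_two by blast
      have "a (h + 2 ^ (n - m) * 2 ^ Suc m) = a h"
        using folds_multiple[OF fo _ m(2,3), of "2 ^ (n - m)"] m(1) by simp
      also have "(2::int) ^ (n - m) * 2 ^ Suc m = 1 * 2 ^ (n + 1)"
        using m(1) by (simp add: power_add[symmetric])
      finally show False using h[of 1] pm[of h] by auto
    qed
    then show "i \<in> {i. 2 ^ n dvd i - e}" using dvd_add[of "2 ^ n" "h - e" "j * 2 ^ n"] by (simp add: i algebra_simps) }
  { assume "i \<in> {i. 2 ^ n dvd i - e}"
    then obtain q where q: "i - e = 2 ^ n * q" by auto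
    \<comment> \<open>\<open>e\<close> may have a level above \<open>n\<close>, where the required
      alternation can fail; \<open>e + 2 ^ n\<close> has level exactly \<open>n\<close>.\<close>
    define h where "h = e + 2 ^ n"
    have "h - e = 2 ^ n" by (simp add: h_def)
    then have "2 ^ n dvd h - e" "\<not> 2 ^ Suc n dvd h - e" by (auto simp: power_dvd_imp_le)
    from folds_multiple[OF fo _ this] have "\<forall>k. a (h + k * 2 ^ (n + 1)) = (-1) ^ nat \<bar>k\<bar> * a h"
      by (auto simp: sg)
    moreover have "i = h + (q - 1) * 2 ^ n" using q by (simp add: h_def algebra_simps)
    ultimately show "i \<in> E_seq n a" by (auto simp: E_seq_def) }
qed

section \<open>Finite folding sequences and the two-adic alternation rule\<close>

definition entry :: "int list \<Rightarrow> int \<Rightarrow> int" where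
  "entry S i = S ! nat (i - 1)"

text \<open>Positions count from 1: the new fold sits at \<open>2 ^ n\<close>, and the two-adic
  valuation of any other position is unchanged by the passage to its half.\<close>

lemma entry_unfold:
  assumes "length S = 2 ^ n - 1" "0 < i" "i < 2 ^ Suc n"
  shows "entry (overline S @ [c] @ S) i =
    (if i < 2 ^ n then - entry S (2 ^ n - i) else if i = 2 ^ n then c else entry S (i - 2 ^ n))"
proof -
  have len: "length (overline S) = 2 ^ n - 1" using assms(1) by (simp add: overline_def)
  have p: "nat (2 ^ n) = (2::nat) ^ n" by (simp add: nat_power_eq)
  consider "i < 2 ^ n" | "i = 2 ^ n" | "2 ^ n < i" by linarith
  then show ?thesis
  proof cases
    case 1
    then have b: "nat (i - 1) < length S" using assms by (simp add: nat_less_iff of_nat_diff)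
    have "entry (overline S @ [c] @ S) i = overline S ! nat (i - 1)"
      using b assms(1) len by (simp add: entry_def nth_append)
    also have "\<dots> = - S ! (length S - Suc (nat (i - 1)))"
      using b by (simp add: overline_def rev_nth)
    also have "length S - Suc (nat (i - 1)) = nat (2 ^ n - i - 1)"
      unfolding assms(1) using 1 assms(2) p by linarith
    finally show ?thesis using 1 by (simp add: entry_def)
  next
    case 2
    then have "nat (i - 1) = length (overline S)" unfolding len using p by linarith
    then show ?thesis using 2 by (simp add: entry_def nth_append)
  next
    case 3
    moreover have "(1::nat) \<le> 2 ^ n" by simp
    ultimately have "nat (i - 1) = length (overline S) + Suc (nat (i - 2 ^ n - 1))"
      unfolding len using p by linarith
    then show ?thesis using 3 by (simp add: entry_def nth_append)
  qed
qed

text \<open>Both halves are copies of \<open>S\<close>, the left one reversed and negated. Reversal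
  exchanges the members of an alternating pair, so only a pair that straddles the centre is
  new.\<close>

lemma n_folding_entry:
  assumes "n_folding n S"
  shows "length S = 2 ^ n - 1 \<and> set S \<subseteq> {1, -1} \<and>
    (\<forall>m i. 0 < i \<and> i + 2 ^ Suc m < 2 ^ n \<and> 2 ^ m dvd i \<and> \<not> 2 ^ Suc m dvd i \<longrightarrow>
       entry S (i + 2 ^ Suc m) = - entry S i)"
  using assms
proof (induction rule: n_folding.induct)
  case zero
  have False if "0 < i" "i + 2 ^ Suc m < 1" for i :: int and m
    using that zero_less_power[of "2::int" "Suc m"] by linarith
  then show ?case by auto
next
  have step: "length T = 2 ^ Suc n - 1 \<and> set T \<subseteq> {1, -1} \<and>
    (\<forall>m i. 0 < i \<and> i + 2 ^ Suc m < 2 ^ Suc n \<and> 2 ^ m dvd i \<and> \<not> 2 ^ Suc m dvd i \<longrightarrow>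
       entry T (i + 2 ^ Suc m) = - entry T i)"
    if S: "length S = 2 ^ n - 1 \<and> set S \<subseteq> {1, -1} \<and>
    (\<forall>m i. 0 < i \<and> i + 2 ^ Suc m < 2 ^ n \<and> 2 ^ m dvd i \<and> \<not> 2 ^ Suc m dvd i \<longrightarrow>
       entry S (i + 2 ^ Suc m) = - entry S i)"
     and T: "T = overline S @ [c] @ S" and c: "c \<in> {1, -1}" for n S T c
  proof (intro conjI allI impI)
    have len: "length S = 2 ^ n - 1" using S by blast
    show "length T = 2 ^ Suc n - 1" using len by (simp add: T overline_def)
    show "set T \<subseteq> {1, -1}" using S c by (auto simp: T overline_def)
    fix m and i :: int
    assume A: "0 < i \<and> i + 2 ^ Suc m < 2 ^ Suc n \<and> 2 ^ m dvd i \<and> \<not> 2 ^ Suc m dvd i"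
    have "(2::int) ^ Suc m < 2 ^ Suc n" using A by linarith
    then have mn: "m < n" by (metis Suc_less_eq power_less_imp_less_exp one_less_numeral_iff semiring_norm(76))
    then have d: "(2::int) ^ Suc m dvd 2 ^ n" "(2::int) ^ m dvd 2 ^ n" by (auto intro: le_imp_power_dvd simp del: power_Suc)
    have ne: "j \<noteq> 2 ^ n" if "\<not> 2 ^ Suc m dvd j" for j :: int using that d by auto
    have nd: "\<not> 2 ^ Suc m dvd i + 2 ^ Suc m" using A by (metis dvd_add_left_iff dvd_refl)
    have po: "(0::int) < 2 ^ Suc m" by simp
    have "0 < i" "i < 2 ^ Suc n" "0 < i + 2 ^ Suc m" "i + 2 ^ Suc m < 2 ^ Suc n" using A po by linarith+
    note bd = this
    have Tb: "entry T j = (if j < 2 ^ n then - entry S (2 ^ n - j) else if j = 2 ^ n then c else entry S (j - 2 ^ n))"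
      if "0 < j" "j < 2 ^ Suc n" for j unfolding T by (rule entry_unfold[OF len that])
    have Ti: "entry T i = (if i < 2 ^ n then - entry S (2 ^ n - i) else entry S (i - 2 ^ n))"
      using Tb[OF bd(1,2)] A ne[of i] by auto
    have Tj: "entry T (i + 2 ^ Suc m) = (if i + 2 ^ Suc m < 2 ^ n then - entry S (2 ^ n - (i + 2 ^ Suc m)) else entry S (i + 2 ^ Suc m - 2 ^ n))"
      using Tb[OF bd(3,4)] ne[OF nd] by auto
    consider "i + 2 ^ Suc m < 2 ^ n" | "2 ^ n < i" | "i < 2 ^ n" "2 ^ n < i + 2 ^ Suc m"
      using ne[of i] ne[OF nd] A by linarith
    then show "entry T (i + 2 ^ Suc m) = - entry T i"
    proof cases
      case 1
      define j where "j = 2 ^ n - (i + 2 ^ Suc m)"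
      have "2 ^ m dvd j" "\<not> 2 ^ Suc m dvd j"
        using A d nd unfolding j_def by (auto simp: dvd_diff_right_iff)
      moreover have "0 < j" "j + 2 ^ Suc m < 2 ^ n" using 1 A by (auto simp: j_def)
      ultimately have "entry S (j + 2 ^ Suc m) = - entry S j" using S by blast
      moreover have "i < 2 ^ n" using 1 po by linarith
      ultimately show ?thesis using 1 Ti Tj by (simp add: j_def del: power_Suc)
    next
      case 2
      have "2 ^ m dvd i - 2 ^ n" "\<not> 2 ^ Suc m dvd i - 2 ^ n"
        using A d by (auto simp del: power_Suc simp: dvd_diff_left_iff)
      then have "entry S (i - 2 ^ n + 2 ^ Suc m) = - entry S (i - 2 ^ n)"
        using S 2 A by auto
      moreover have "\<not> i + 2 ^ Suc m < 2 ^ n" using 2 zero_less_power[of "2::int" "Suc m"] by linarith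
      ultimately show ?thesis using 2 Ti Tj by (simp add: algebra_simps)
    next
      case 3
      \<comment> \<open>The pair straddles the centre. Writing \<open>i = 2 ^ m * p\<close> with
        \<open>p\<close> odd leaves only \<open>i + 2 ^ m = 2 ^ n\<close>, so the two positions are
        mirror images.\<close>
      obtain q where q: "2 ^ n = (2::int) ^ Suc m * q" using d by blast
      obtain p where p: "i = 2 ^ m * p" using A by blast
      have "odd p" using A p by (auto simp: mult.commute)
      have "2 ^ m * p < 2 ^ m * (2 * q)" "2 ^ m * (2 * q) < 2 ^ m * (p + 2)"
        using 3 unfolding p q by (auto simp: algebra_simps)
      then have "p < 2 * q" "2 * q < p + 2" by (simp_all only: mult_less_cancel_left_pos zero_less_power zero_less_numeral)
      then have "2 * q = p + 1" using \<open>odd p\<close> by presburger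
      have "(2::int) ^ n = 2 ^ m * (2 * q)" using q by simp
      also have "\<dots> = i + 2 ^ m" unfolding \<open>2 * q = p + 1\<close> p by (simp add: algebra_simps)
      finally have "(2::int) ^ n = i + 2 ^ m" .
      then show ?thesis using 3 Ti Tj by simp
    qed
  qed
  { case (plus n S) then show ?case using step[OF plus(2) refl, of 1] by simp
  next
    case (minus n S) then show ?case using step[OF minus(2) refl, of "-1"] by simp }
qed

lemma complete_folding_seq_entry:
  assumes "complete_folding_seq a"
  shows "\<exists>n S c. n_folding n S \<and>
    (\<forall>i. \<bar>i\<bar> \<le> int L \<longrightarrow> 0 < i + c \<and> i + c < 2 ^ n \<and> a i = entry S (i + c))"
proof -
  obtain n S xs ys where S: "n_folding n S" "S = xs @ map a [- int L..int L] @ ys"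
    using assms unfolding complete_folding_seq_def finite_folding_def sublist_def by meson
  define c where "c = int (length xs) + int L + 1"
  have len: "length S = 2 ^ n - 1" using n_folding_entry[OF S(1)] by blast
  have "0 < i + c \<and> i + c < 2 ^ n \<and> a i = entry S (i + c)" if i: "\<bar>i\<bar> \<le> int L" for i
  proof -
    have n1: "nat (i + c - 1) = length xs + nat (i + int L)" using i by (simp add: c_def nat_add_distrib nat_diff_distrib)
    have l2: "nat (i + int L) < length (map a [- int L..int L])" using i by auto
    have "nat (i + c - 1) < length S" unfolding n1 S(2) length_append using l2 by linarith
    moreover have "int (2 ^ n - 1) = 2 ^ n - 1" by (simp add: of_nat_diff)
    ultimately have "i + c - 1 < 2 ^ n - 1" unfolding len by linarith
    moreover have "entry S (i + c) = a i"
      unfolding entry_def n1 S(2) using l2 i by (auto simp add: nth_append)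
    ultimately show ?thesis using i by (auto simp: c_def)
  qed
  then show ?thesis using S(1) by blast
qed

text \<open>Every window yields a base point of its own. A common one comes from compactness: there
  are finitely many residues modulo \<open>2 ^ N\<close>, so one of them occurs for arbitrarily
  large windows.\<close>

lemma complete_folding_seq_imp_fold_seq:
  assumes "complete_folding_seq a"
  shows "fold_seq a"
  unfolding fold_seq_def
proof (intro conjI allI)
  fix i
  obtain n S c where S: "n_folding n S"
    and a: "\<forall>j. \<bar>j\<bar> \<le> int (nat \<bar>i\<bar>) \<longrightarrow> 0 < j + c \<and> j + c < 2 ^ n \<and> a j = entry S (j + c)"
    using complete_folding_seq_entry[OF assms] by blast
  have "0 < i + c" "i + c < 2 ^ n" "a i = entry S (i + c)" using a by auto
  moreover have "length S = 2 ^ n - 1" "set S \<subseteq> {1, -1}" using n_folding_entry[OF S] by auto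
  ultimately show "a i \<in> {1, -1}"
    by (auto simp: entry_def subset_iff nat_less_iff of_nat_diff)
next
  fix N
  have "\<forall>L. \<exists>c. \<forall>m i. \<bar>i\<bar> \<le> int L \<and> \<bar>i + 2 ^ Suc m\<bar> \<le> int L \<and> 2 ^ m dvd i + c \<and> \<not> 2 ^ Suc m dvd i + c
     \<longrightarrow> a (i + 2 ^ Suc m) = - a i"
  proof
    fix L
    obtain n S c where S: "n_folding n S"
      and a: "\<forall>j. \<bar>j\<bar> \<le> int L \<longrightarrow> 0 < j + c \<and> j + c < 2 ^ n \<and> a j = entry S (j + c)"
      using complete_folding_seq_entry[OF assms] by blast
    have "a (i + 2 ^ Suc m) = - a i"
      if i: "\<bar>i\<bar> \<le> int L" "\<bar>i + 2 ^ Suc m\<bar> \<le> int L" "2 ^ m dvd i + c" "\<not> 2 ^ Suc m dvd i + c" for m i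
    proof -
      have "0 < i + c" "i + 2 ^ Suc m + c < 2 ^ n" "a i = entry S (i + c)"
        "a (i + 2 ^ Suc m) = entry S (i + 2 ^ Suc m + c)" using a i by blast+
      moreover have "i + 2 ^ Suc m + c = i + c + 2 ^ Suc m" by simp
      ultimately show ?thesis using n_folding_entry[OF S] i by metis
    qed
    then show "\<exists>c. \<forall>m i. \<bar>i\<bar> \<le> int L \<and> \<bar>i + 2 ^ Suc m\<bar> \<le> int L \<and> 2 ^ m dvd i + c \<and> \<not> 2 ^ Suc m dvd i + c
     \<longrightarrow> a (i + 2 ^ Suc m) = - a i" by blast
  qed
  then obtain c where c: "\<And>L m i. \<bar>i\<bar> \<le> int L \<Longrightarrow> \<bar>i + 2 ^ Suc m\<bar> \<le> int L \<Longrightarrow> 2 ^ m dvd i + c L \<Longrightarrow>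
     \<not> 2 ^ Suc m dvd i + c L \<Longrightarrow> a (i + 2 ^ Suc m) = - a i" by metis
  have "finite ((\<lambda>L. (- c L) mod 2 ^ N) ` UNIV)"
    by (rule finite_subset[of _ "{0..<2 ^ N}"]) auto
  from pigeonhole_infinite[OF infinite_UNIV_nat this] obtain L0
    where inf: "infinite {L. (- c L) mod 2 ^ N = (- c L0) mod 2 ^ N}" by auto
  have "folds a N (- c L0)" unfolding folds_def
  proof (intro allI impI)
    fix m i assume m: "m < N" and i: "2 ^ m dvd i - - c L0 \<and> \<not> 2 ^ Suc m dvd i - - c L0"
    obtain L where L: "nat (\<bar>i\<bar> + 2 ^ Suc m) < L" "(- c L) mod 2 ^ N = (- c L0) mod 2 ^ N"
      using inf unfolding infinite_nat_iff_unbounded by blast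
    have "2 ^ N dvd - c L - - c L0" using L(2) by (simp only: mod_eq_dvd_iff)
    then have "2 ^ l dvd - c L - - c L0" if "l \<le> N" for l
      using that by (blast intro: dvd_trans[OF le_imp_power_dvd])
    then have *: "2 ^ l dvd i + c L \<longleftrightarrow> 2 ^ l dvd i - - c L0" if "l \<le> N" for l
      using that dvd_diff_left_iff[of "2 ^ l" "- c L - - c L0" "i - - c L0"] by auto
    have "\<bar>i\<bar> + 2 ^ Suc m \<le> int L" using L(1) by linarith
    moreover have "(0::int) < 2 ^ Suc m" by simp
    ultimately have "\<bar>i\<bar> \<le> int L" "\<bar>i + 2 ^ Suc m\<bar> \<le> int L" by linarith+
    then show "a (i + 2 ^ Suc m) = - a i" using i m *[of m] *[of "Suc m"] by (intro c[of _ L]) auto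
  qed
  then show "\<exists>e. folds a N e" by blast
qed

text \<open>With \<open>i = 2 ^ m * p\<close> and \<open>p\<close> odd, the way from
  \<open>q - i\<close> to \<open>q + i\<close> consists of \<open>p\<close> periods of level
  \<open>m\<close>, an odd number of sign changes.\<close>

lemma folds_reflect:
  assumes "folds a n q" "0 < i" "i < 2 ^ n"
  shows "a (q - i) = - a (q + i)"
proof -
  have "\<not> 2 ^ n dvd i" using assms(2,3) zdvd_not_zless by blast
  then obtain m where m: "m < n" "2 ^ m dvd i" "\<not> 2 ^ Suc m dvd i" using exact_power_two by blast
  then obtain p where p: "i = 2 ^ m * p" by blast
  have "odd p" using m p by (auto simp: mult.commute)
  have "2 ^ m dvd q - i - q" "\<not> 2 ^ Suc m dvd q - i - q" using m by auto
  from folds_multiple[OF assms(1) m(1) this, of p] show ?thesis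
    using \<open>odd p\<close> by (simp add: p algebra_simps)
qed

lemma upto_append: "i \<le> j + 1 \<Longrightarrow> j \<le> k \<Longrightarrow> [i..k] = [i..j] @ [j + 1..k]" for i :: int
proof (induction "nat (j + 1 - i)" arbitrary: i)
  case 0
  then show ?case by (simp add: upto.simps)
next
  case (Suc m)
  then have "[i + 1..k] = [i + 1..j] @ [j + 1..k]" by (intro Suc.hyps) auto
  moreover have "i \<le> j" "i \<le> k" using Suc by auto
  ultimately show ?case by (simp add: upto_rec1)
qed

lemma map_reflect:
  assumes "folds a n q"
  shows "map a [q - 2 ^ n + 1..q + 2 ^ n - 1] =
    overline (map a [q + 1..q + 2 ^ n - 1]) @ [a q] @ map a [q + 1..q + 2 ^ n - 1]"
proof -
  have p: "(0::int) < 2 ^ n" by simp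
  have "[q - 2 ^ n + 1..q + 2 ^ n - 1] = [q - 2 ^ n + 1..q - 1] @ [q - 1 + 1..q + 2 ^ n - 1]"
    using p by (intro upto_append) linarith+
  also have "[q - 1 + 1..q + 2 ^ n - 1] = [q] @ [q + 1..q + 2 ^ n - 1]"
    using p by (simp add: upto_rec1)
  finally have sp: "[q - 2 ^ n + 1..q + 2 ^ n - 1] = [q - 2 ^ n + 1..q - 1] @ [q] @ [q + 1..q + 2 ^ n - 1]" .
  have "map a [q - 2 ^ n + 1..q - 1] = overline (map a [q + 1..q + 2 ^ n - 1])"
  proof (rule nth_equalityI)
    fix i assume "i < length (map a [q - 2 ^ n + 1..q - 1])"
    then have i: "int i < 2 ^ n - 1" by auto
    have "map a [q - 2 ^ n + 1..q - 1] ! i = a (q - (2 ^ n - 1 - int i))" using i by (simp add: algebra_simps)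
    also have "\<dots> = - a (q + (2 ^ n - 1 - int i))" using i by (intro folds_reflect[OF assms]) auto
    also have "\<dots> = overline (map a [q + 1..q + 2 ^ n - 1]) ! i"
    proof -
      have "i < nat (2 ^ n - 1)" using i by linarith
      then show ?thesis by (simp add: overline_def rev_nth of_nat_diff algebra_simps)
    qed
    finally show "map a [q - 2 ^ n + 1..q - 1] ! i = overline (map a [q + 1..q + 2 ^ n - 1]) ! i" .
  qed (simp add: overline_def)
  then show ?thesis by (simp add: sp)
qed

lemma n_folding_unfold: "n_folding n S \<Longrightarrow> c \<in> {1, -1} \<Longrightarrow> n_folding (Suc n) (overline S @ [c] @ S)"
  using n_folding.plus n_folding.minus by auto

text \<open>The centre \<open>q + 2 ^ n\<close> of a window between \<open>q\<close> and
  \<open>q + 2 ^ (n + 1)\<close> is again a base point for \<open>n\<close> levels, so the window is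
  the unfolding of its right half.\<close>

lemma folds_imp_n_folding:
  assumes pm: "\<And>i. a i \<in> {1, -1}" and "folds a n q"
  shows "n_folding n (map a [q + 1..q + 2 ^ n - 1])"
  using assms(2)
proof (induction n arbitrary: q)
  case 0
  then show ?case by (simp add: n_folding.zero)
next
  case (Suc n)
  have "folds a n (q + 2 ^ n)" using folds_cong[OF folds_mono[OF Suc.prems, of n]] by simp
  from n_folding_unfold[OF Suc.IH[OF this] pm[of "q + 2 ^ n"], folded map_reflect[OF this]]
  show ?case by (simp add: algebra_simps)
qed

lemma fold_seq_imp_complete_folding_seq:
  assumes "fold_seq a"
  shows "complete_folding_seq a"
  unfolding complete_folding_seq_def
proof (intro allI)
  fix h k
  define n where "n = nat (k - h)"
  obtain e where e: "folds a n e" using assms unfolding fold_seq_def by blast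
  \<comment> \<open>\<open>p\<close> is the first index from \<open>h\<close> on in the class of
    \<open>e\<close>. As \<open>k - h < 2 ^ n\<close>, the folding window centred at
    \<open>p\<close> contains all of \<open>[h..k]\<close>.\<close>
  define p where "p = h + (e - h) mod 2 ^ n"
  have "2 ^ n dvd p - e"
  proof -
    have "2 ^ n dvd (e - h) mod 2 ^ n - (e - h)" by (simp add: mod_eq_dvd_iff[symmetric])
    then show ?thesis by (simp add: p_def algebra_simps)
  qed
  then have fp: "folds a n p" using folds_cong[OF e] by blast
  have p: "h \<le> p" "p < h + 2 ^ n" by (auto simp: p_def)
  have "k - h < 2 ^ n" using of_nat_less_two_power[of n, where 'a=int] unfolding n_def by linarith
  then have k: "k \<le> p + 2 ^ n - 1" using p by linarith
  have "sublist (map a [h..k]) (map a [p - 2 ^ n + 1..p + 2 ^ n - 1])"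
  proof (cases "h \<le> k")
    case True
    have "[p - 2 ^ n + 1..p + 2 ^ n - 1] = [p - 2 ^ n + 1..h - 1] @ [h - 1 + 1..p + 2 ^ n - 1]"
      using p k True by (intro upto_append) auto
    also have "[h - 1 + 1..p + 2 ^ n - 1] = [h..k] @ [k + 1..p + 2 ^ n - 1]"
      using p k True by (subst upto_append[of _ k]) auto
    finally show ?thesis by (auto simp: sublist_def)
  qed simp
  moreover have "n_folding (Suc n) (map a [p - 2 ^ n + 1..p + 2 ^ n - 1])"
    unfolding map_reflect[OF fp] using assms fp unfolding fold_seq_def
    by (intro n_folding_unfold folds_imp_n_folding) auto
  ultimately show "finite_folding (map a [h..k])" unfolding finite_folding_def by blast
qed

lemma complete_folding_seq_iff: "complete_folding_seq a \<longleftrightarrow> fold_seq a"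
  using complete_folding_seq_imp_fold_seq fold_seq_imp_complete_folding_seq by blast

section \<open>Paths and sign fields\<close>

definition unit_vec :: "point \<Rightarrow> bool" where
  "unit_vec d \<longleftrightarrow> d \<in> {(1, 0), (-1, 0), (0, 1), (0, -1)}"

text \<open>\<open>y i\<close> plays the role of the terminal point of the \<open>i\<close>-th
  segment, so that the turn \<open>a i\<close> takes place at \<open>y i\<close>. This is the
  indexing under which turns become functions of vertices.\<close>

definition lattice_path :: "(int \<Rightarrow> point) \<Rightarrow> (int \<Rightarrow> int) \<Rightarrow> bool" where
  "lattice_path y a \<longleftrightarrow> (\<forall>i. a i \<in> {1, -1}) \<and> (\<forall>i. unit_vec (y (i + 1) - y i)) \<and>
     (\<forall>i. y (i + 1) - y i = turn (a i) (y i - y (i - 1)))"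

lemma unit_vec_shell: "unit_vec d \<Longrightarrow> d \<in> shell 0"
  by (auto simp: unit_vec_def shell_def Lambda_0 Lambda_1)

lemma unit_vec_turn: "unit_vec d \<Longrightarrow> s \<in> {1, -1} \<Longrightarrow> unit_vec (turn s d)"
  by (auto simp: unit_vec_def turn_def)

text \<open>The vertices whose index lies in the class of \<open>e\<close> modulo
  \<open>2 ^ n\<close> form the \<open>n\<close>-th derived path, which turns by the entries of
  \<open>a\<close> at these indices. The induction joins two of its steps into one.\<close>

lemma path_jump:
  assumes "lattice_path y a" "folds a n e" "2 ^ n dvd i - e"
  shows "y (i + 2 ^ n) - y i \<in> shell n \<and>
    y (i + 2 * 2 ^ n) - y (i + 2 ^ n) = turn (a (i + 2 ^ n)) (y (i + 2 ^ n) - y i)"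
  using assms(2,3)
proof (induction n arbitrary: i)
  case 0
  have "y (i + 1 + 1) - y (i + 1) = turn (a (i + 1)) (y (i + 1) - y (i + 1 - 1))"
    using assms(1) unfolding lattice_path_def by blast
  moreover have "y (i + 1) - y i \<in> shell 0" using assms(1) unit_vec_shell unfolding lattice_path_def by blast
  ultimately show ?case by (simp add: algebra_simps)
next
  case (Suc n)
  have fo: "folds a n e" using Suc.prems(1) by (rule folds_mono) simp
  let ?N = "2 ^ n :: int"
  obtain q where q: "i - e = 2 ^ Suc n * q" using Suc.prems(2) by blast
  have dv: "?N dvd i + k * ?N - e" for k
  proof
    show "i + k * ?N - e = ?N * (2 * q + k)" using q by (simp add: algebra_simps)
  qed
  define D where "D = y (i + ?N) - y i"
  define b where "b = a (i + ?N)"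
  define c where "c = a (i + 2 * ?N)"
  note IH = Suc.IH[OF fo]
  have pm: "b \<in> {1, -1}" "c \<in> {1, -1}" using assms(1) by (auto simp: lattice_path_def b_def c_def)
  have D: "D \<in> shell n" using IH[OF dv[of 0]] by (simp add: D_def)
  have 1: "y (i + 2 * ?N) - y (i + ?N) = turn b D" using IH[OF dv[of 0]] by (simp add: D_def b_def)
  have 2: "y (i + 3 * ?N) - y (i + 2 * ?N) = turn c (turn b D)"
    using IH[OF dv[of 1]] 1 by (simp add: c_def algebra_simps)
  have "y (i + 4 * ?N) - y (i + 3 * ?N) = turn (a (i + 3 * ?N)) (turn c (turn b D))"
    using IH[OF dv[of 2]] 2 by (simp add: algebra_simps)
  also have "a (i + 3 * ?N) = - b"
  proof -
    have eq: "i + ?N - e = ?N * (2 * q + 1)" using q by (simp add: algebra_simps)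
    have "\<not> 2 ^ Suc n dvd i + ?N - e" unfolding eq by (simp add: mult.commute)
    moreover have "2 ^ n dvd i + ?N - e" using dv[of 1] by simp
    ultimately have "a (i + ?N + 2 ^ Suc n) = - a (i + ?N)"
      using Suc.prems(1) unfolding folds_def by blast
    moreover have "i + ?N + 2 ^ Suc n = i + 3 * ?N" by simp
    ultimately show ?thesis by (simp only: b_def)
  qed
  \<comment> \<open>The two midpoint folds cancel, as
    \<open>(- b * i) * (c * i) * (b * i) = c * i\<close>; hence the second pair of steps is the
    first pair turned by \<open>c\<close>.\<close>
  also have "turn (- b) (turn c (turn b D)) = turn c D"
    using pm by (auto simp: turn_def prod_eq_iff)
  finally have 3: "y (i + 4 * ?N) - y (i + 3 * ?N) = turn c D" .
  have s: "y (i + 2 * ?N) - y i = D + turn b D" using 1 by (simp add: D_def algebra_simps)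
  have "y (i + 4 * ?N) - y (i + 2 * ?N) = turn c (D + turn b D)"
    using 2 3 by (simp add: turn_add algebra_simps)
  moreover have "D + turn b D \<in> shell (Suc n)" using shell_add_turn[OF D] pm by simp
  ultimately show ?case using s by (simp add: c_def)
qed

lemma path_jump_multiple:
  assumes "lattice_path y a" "folds a n e" "2 ^ n dvd i - e"
  shows "y (i + k * 2 ^ n) - y i \<in> Lambda n \<and> (y (i + k * 2 ^ n) - y i \<in> Lambda (Suc n) \<longleftrightarrow> even k)"
proof -
  have "y (i + (k + 1) * 2 ^ n) - y (i + k * 2 ^ n) \<in> shell n" for k
  proof -
    have "2 ^ n dvd i + k * 2 ^ n - e" using dvd_add[OF assms(3), of "k * 2 ^ n"] by (simp add: algebra_simps)
    from path_jump[OF assms(1,2) this] show ?thesis by (simp add: algebra_simps)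
  qed
  from shell_steps[of "\<lambda>k. y (i + k * 2 ^ n)", OF this] show ?thesis by simp
qed

text \<open>\<open>i\<close> may have exact level \<open>n\<close>. The indices
  \<open>i + k * 2 ^ Suc n\<close> then carry alternating turns when level \<open>n\<close>
  alternates, and the displacement reveals the parity of \<open>k\<close>; this is what makes the
  turn a function of the vertex.\<close>

lemma path_double_jump_multiple:
  assumes "lattice_path y a" "folds a n e" "2 ^ n dvd i - e"
  shows "y (i + k * 2 ^ Suc n) - y i \<in> Lambda (Suc n) \<and>
    (y (i + k * 2 ^ Suc n) - y i \<in> Lambda (Suc (Suc n)) \<longleftrightarrow> even k)"
proof -
  have "y (i + (k + 1) * 2 ^ Suc n) - y (i + k * 2 ^ Suc n) \<in> shell (Suc n)" for k
  proof -
    define j where "j = i + k * 2 ^ Suc n"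
    have "2 ^ n dvd j - e" using dvd_add[OF assms(3), of "k * 2 ^ Suc n"] by (simp add: algebra_simps j_def)
    note pj = path_jump[OF assms(1,2) this]
    have "y (j + 2 * 2 ^ n) - y j = (y (j + 2 ^ n) - y j) + turn (a (j + 2 ^ n)) (y (j + 2 ^ n) - y j)"
      using pj by (simp add: algebra_simps)
    also have "\<dots> \<in> shell (Suc n)" using pj assms(1) unfolding lattice_path_def by (blast intro: shell_add_turn)
    finally show ?thesis by (simp add: j_def algebra_simps)
  qed
  from shell_steps[of "\<lambda>k. y (i + k * 2 ^ Suc n)", OF this] show ?thesis by simp
qed

text \<open>An index difference of exact level \<open>m < n\<close> is an odd number of jumps of
  level \<open>m\<close>, whose sum is outside \<open>Lambda (Suc m)\<close>. So the position
  determines the index modulo \<open>2 ^ n\<close>, although a path may revisit vertices.\<close>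

lemma path_Lambda_iff:
  assumes "lattice_path y a" "folds a n e" "2 ^ n dvd j - e"
  shows "y i - y j \<in> Lambda n \<longleftrightarrow> 2 ^ n dvd i - j"
proof
  assume "2 ^ n dvd i - j"
  then obtain k where "i - j = 2 ^ n * k" by blast
  then have "i = j + k * 2 ^ n" by (simp add: algebra_simps)
  then show "y i - y j \<in> Lambda n" using path_jump_multiple[OF assms] by blast
next
  assume L: "y i - y j \<in> Lambda n"
  show "2 ^ n dvd i - j"
  proof (rule ccontr)
    assume "\<not> 2 ^ n dvd i - j"
    then obtain m where m: "m < n" "2 ^ m dvd i - j" "\<not> 2 ^ Suc m dvd i - j" using exact_power_two by blast
    then obtain k where k: "i - j = 2 ^ m * k" by blast
    have "odd k" using m k by (auto simp: mult.commute)
    have "2 ^ m dvd j - e" using assms(3) m(1) by (meson dvd_trans le_imp_power_dvd less_imp_le)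
    moreover have "i = j + k * 2 ^ m" using k by (simp add: algebra_simps)
    ultimately have "y i - y j \<notin> Lambda (Suc m)"
      using path_jump_multiple[OF assms(1) folds_mono[OF assms(2)], of m j k] m(1) \<open>odd k\<close> by auto
    then show False using L Lambda_mono[of "Suc m" n] m(1) by auto
  qed
qed

text \<open>The point \<open>c n\<close> represents the coset \<open>E_n\<close>.\<close>

definition sign_field :: "(point \<Rightarrow> int) \<Rightarrow> (nat \<Rightarrow> point) \<Rightarrow> bool" where
  "sign_field \<sigma> c \<longleftrightarrow> (\<forall>x. \<sigma> x \<in> {1, -1}) \<and> (\<forall>n. c (Suc n) - c n \<in> Lambda n) \<and>
     (\<forall>n x u. x - c n \<in> Lambda n \<and> x - c (Suc n) \<notin> Lambda (Suc n) \<and> u \<in> Lambda (Suc n) \<longrightarrow>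
        \<sigma> (x + u) = (if u \<in> Lambda (Suc (Suc n)) then \<sigma> x else - \<sigma> x))"

lemma field_flip:
  assumes "sign_field \<sigma> c" "x - c n \<in> Lambda n" "x - c (Suc n) \<notin> Lambda (Suc n)" "u \<in> Lambda (Suc n)"
  shows "\<sigma> (x + u) = (if u \<in> Lambda (Suc (Suc n)) then \<sigma> x else - \<sigma> x)"
  using assms unfolding sign_field_def by blast

lemma field_nested: "sign_field \<sigma> c \<Longrightarrow> c (Suc n) - c n \<in> Lambda n"
  and field_sign: "sign_field \<sigma> c \<Longrightarrow> \<sigma> x \<in> {1, -1}"
  unfolding sign_field_def by blast+

text \<open>A path that obeys the field is specified only locally. Its base points are built level
  by level, together with the fact that they describe the visits to the coset of \<open>c n\<close>;
  the flip rule then gives the alternation.\<close>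

lemma field_path_folds:
  assumes f: "sign_field \<sigma> c" and p: "lattice_path y (\<lambda>i. \<sigma> (y i))"
  shows "\<exists>e. folds (\<lambda>i. \<sigma> (y i)) n e \<and> (\<forall>i. y i - c n \<in> Lambda n \<longleftrightarrow> 2 ^ n dvd i - e)"
proof (induction n)
  case 0
  then show ?case by (simp add: folds_def Lambda_0)
next
  case (Suc n)
  then obtain e where e: "folds (\<lambda>i. \<sigma> (y i)) n e" "\<And>i. y i - c n \<in> Lambda n \<longleftrightarrow> 2 ^ n dvd i - e" by blast
  have cc: "c (Suc n) - c n \<in> Lambda n" by (rule field_nested[OF f])
  have yc: "y i - c (Suc n) \<in> Lambda n \<longleftrightarrow> 2 ^ n dvd i - e" for i
  proof -
    have "y i - c n = (y i - c (Suc n)) + (c (Suc n) - c n)" by simp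
    then show ?thesis using e(2)[of i] Lambda_add[OF _ cc, of "y i - c (Suc n)"] Lambda_diff[OF _ cc, of "y i - c n"]
      by auto
  qed
  have par: "y (e + k * 2 ^ n) - c (Suc n) \<in> Lambda (Suc n) \<longleftrightarrow> (y e - c (Suc n) \<in> Lambda (Suc n) \<longleftrightarrow> even k)" for k
  proof -
    have *: "y (e + k * 2 ^ n) - c (Suc n) = (y (e + k * 2 ^ n) - y e) + (y e - c (Suc n))" by simp
    show ?thesis unfolding * using path_jump_multiple[OF p e(1), of e k] yc[of e]
      by (subst Lambda_Suc_add_iff) auto
  qed
  \<comment> \<open>The coset of \<open>c n\<close> splits into two cosets of
    \<open>Lambda (Suc n)\<close>, visited alternately along the class of \<open>e\<close>;
    \<open>e'\<close> selects the class that meets the coset of \<open>c (Suc n)\<close>.\<close>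
  define e' where "e' = (if y e - c (Suc n) \<in> Lambda (Suc n) then e else e + 2 ^ n)"
  have e'd: "2 ^ n dvd e' - e" by (simp add: e'_def)
  have iff: "y i - c (Suc n) \<in> Lambda (Suc n) \<longleftrightarrow> 2 ^ Suc n dvd i - e'" for i
  proof (cases "2 ^ n dvd i - e")
    case True
    then obtain k where k: "i - e = 2 ^ n * k" by blast
    then have i: "i = e + k * 2 ^ n" by (simp add: algebra_simps)
    have "2 ^ Suc n dvd 2 ^ n * l \<longleftrightarrow> even l" for l :: int by (simp add: mult.commute)
    moreover have "i - e' = 2 ^ n * (if y e - c (Suc n) \<in> Lambda (Suc n) then k else k - 1)"
      using k by (simp add: e'_def algebra_simps)
    ultimately show ?thesis using par[of k] unfolding i by simp
  next
    case False
    then have "\<not> 2 ^ n dvd i - e'" using dvd_add[OF _ e'd, of "i - e'"] by auto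
    then have "\<not> 2 ^ Suc n dvd i - e'" by (meson dvd_trans le_imp_power_dvd le_SucI order_refl)
    moreover have "y i - c (Suc n) \<notin> Lambda (Suc n)" using False yc Lambda_Suc_subset by blast
    ultimately show ?thesis by blast
  qed
  have "folds (\<lambda>i. \<sigma> (y i)) (Suc n) e'" unfolding folds_def
  proof (intro allI impI)
    fix m i assume m: "m < Suc n" and i: "2 ^ m dvd i - e' \<and> \<not> 2 ^ Suc m dvd i - e'"
    show "\<sigma> (y (i + 2 ^ Suc m)) = - \<sigma> (y i)"
    proof (cases "m = n")
      case False
      then show ?thesis using folds_cong[OF e(1) e'd] m i unfolding folds_def by auto
    next
      case True
      have ie: "2 ^ n dvd i - e" using dvd_add[OF _ e'd, of "i - e'"] i True by auto
      have "y i - c n \<in> Lambda n" "y i - c (Suc n) \<notin> Lambda (Suc n)" using ie e(2) iff i True by auto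
      moreover have "y (i + 2 ^ Suc n) - y i \<in> Lambda (Suc n)" "y (i + 2 ^ Suc n) - y i \<notin> Lambda (Suc (Suc n))"
        using path_double_jump_multiple[OF p e(1) ie, of 1] by auto
      ultimately have "\<sigma> (y i + (y (i + 2 ^ Suc n) - y i)) = - \<sigma> (y i)" using field_flip[OF f] by metis
      then show ?thesis using True by simp
    qed
  qed
  then show ?case using iff by blast
qed

lemma field_path_fold_seq:
  assumes "sign_field \<sigma> c" "lattice_path y (\<lambda>i. \<sigma> (y i))"
  shows "fold_seq (\<lambda>i. \<sigma> (y i))"
  unfolding fold_seq_def using field_path_folds[OF assms] field_sign[OF assms(1)] by meson

section \<open>The sign field of a given path\<close>

lemma nested_Lambda:
  assumes "\<And>n. c (Suc n) - c n \<in> Lambda n" "m \<le> n" "x - c n \<in> Lambda n"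
  shows "x - c m \<in> Lambda m"
  using assms(2,3)
proof (induction n rule: dec_induct)
  case (step n)
  have "x - c n = (x - c (Suc n)) + (c (Suc n) - c n)" by simp
  then have "x - c n \<in> Lambda n" using assms(1) step(4) Lambda_add Lambda_Suc_subset by (metis subsetD)
  then show ?case by (rule step(3))
qed

lemma level_exists:
  fixes c :: "nat \<Rightarrow> point"
  assumes "x - c N \<notin> Lambda N"
  shows "\<exists>n<N. x - c n \<in> Lambda n \<and> x - c (Suc n) \<notin> Lambda (Suc n)"
  using assms
proof (induction N)
  case 0
  then show ?case by (simp add: Lambda_0)
next
  case (Suc N)
  then show ?case by (cases "x - c N \<in> Lambda N") (auto intro: less_SucI)
qed

text \<open>Points of a common level \<open>n\<close> differ by an element of
  \<open>Lambda (Suc n)\<close>, so one reference vertex determines the sign at all of them. A point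
  without a level receives the turn of the path if it is visited, and an arbitrary sign otherwise.
  The indices behind \<open>c n\<close> come with \<open>Suc n\<close> levels so that they also
  identify \<open>E_n\<close>.\<close>

lemma canonical_field:
  assumes p: "lattice_path y a" and fs: "fold_seq a"
  shows "\<exists>\<sigma> c. sign_field \<sigma> c \<and> (\<forall>i. a i = \<sigma> (y i)) \<and> (\<forall>n. \<exists>e. c n = y e \<and> folds a (Suc n) e)"
proof -
  have pm: "\<And>i. a i \<in> {1, -1}" using p by (auto simp: lattice_path_def)
  have "\<forall>n. \<exists>e. folds a (Suc n) e" using fs by (auto simp: fold_seq_def)
  then obtain e where e: "\<And>n. folds a (Suc n) (e n)" by metis
  have e': "folds a n (e n)" for n using folds_mono[OF e] by simp
  have ee: "2 ^ n dvd e (Suc n) - e n" for n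
    using E_seq_folds[OF pm e[of n]] E_seq_folds[OF pm folds_mono[OF e[of "Suc n"], of "Suc n"]] by auto
  define c where "c n = y (e n)" for n
  have yc: "y i - c n \<in> Lambda n \<longleftrightarrow> 2 ^ n dvd i - e n" for i n
    unfolding c_def by (rule path_Lambda_iff[OF p e']) simp
  have cc: "c (Suc n) - c n \<in> Lambda n" for n using yc[of "e (Suc n)" n] ee unfolding c_def by simp
  define lv where "lv x n \<longleftrightarrow> x - c n \<in> Lambda n \<and> x - c (Suc n) \<notin> Lambda (Suc n)" for x n
  have lv_unique: "m = n" if "lv x m" "lv x n" for x m n
  proof (rule ccontr)
    assume "m \<noteq> n"
    then have "Suc m \<le> n \<or> Suc n \<le> m" by linarith
    then show False
      using that nested_Lambda[OF cc, of "Suc m" n x] nested_Lambda[OF cc, of "Suc n" m x] unfolding lv_def by blast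
  qed
  \<comment> \<open>A reference index of exact level \<open>n\<close>; in particular the path visits
    points of every level.\<close>
  define r where "r n = e (Suc n) + 2 ^ n" for n
  have r: "lv (y (r n)) n" for n
  proof -
    have "2 ^ n dvd r n - e n" using dvd_add[OF ee[of n], of "2 ^ n"] by (simp add: r_def algebra_simps)
    moreover have "\<not> 2 ^ Suc n dvd r n - e (Suc n)" by (simp add: r_def)
    ultimately show ?thesis unfolding lv_def yc by simp
  qed
  have lvd: "x - x' \<in> Lambda (Suc n)" if "lv x n" "lv x' n" for x x' n
  proof -
    have "x - c (Suc n) \<in> Lambda n" if "lv x n" for x
      using that cc[of n] Lambda_diff[of "x - c n" n "c (Suc n) - c n"] unfolding lv_def by simp
    then have "x - c (Suc n) \<in> Lambda n" "x' - c (Suc n) \<in> Lambda n" using that by blast+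
    moreover have "x - c (Suc n) \<notin> Lambda (Suc n)" "x' - c (Suc n) \<notin> Lambda (Suc n)" using that by (auto simp: lv_def)
    ultimately have "(x - c (Suc n)) + (c (Suc n) - x') \<in> Lambda (Suc n)"
      using Lambda_diff_commute by (intro Lambda_index_two) blast+
    then show ?thesis by simp
  qed
  define g where "g n x = (if x - y (r n) \<in> Lambda (Suc (Suc n)) then a (r n) else - a (r n))" for n x
  have gy: "a i = g n (y i)" if l: "lv (y i) n" for i n
  proof -
    have fo: "folds a (Suc n) (e (Suc n))" using e[of "Suc n"] by (rule folds_mono) simp
    have rd: "2 ^ n dvd r n - e (Suc n)" "\<not> 2 ^ Suc n dvd r n - e (Suc n)" by (auto simp: r_def)
    have "2 ^ Suc n dvd i - r n"
    proof -
      have "2 ^ n dvd i - e (Suc n)" "\<not> 2 ^ Suc n dvd i - e (Suc n)"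
        using l dvd_diff[OF _ ee[of n], of "i - e n"] unfolding lv_def yc by auto
      then obtain k where k: "i - e (Suc n) = 2 ^ n * k" by blast
      with \<open>\<not> 2 ^ Suc n dvd i - e (Suc n)\<close> have "odd k" by (auto simp: mult.commute)
      have "i - r n = 2 ^ n * (k - 1)" using k by (simp add: r_def algebra_simps)
      then show ?thesis using \<open>odd k\<close> by (simp add: mult.commute)
    qed
    then obtain k where "i - r n = 2 ^ Suc n * k" by blast
    then have i: "i = r n + k * 2 ^ Suc n" by (simp add: algebra_simps)
    have "y i - y (r n) \<in> Lambda (Suc (Suc n)) \<longleftrightarrow> even k"
      unfolding i using path_double_jump_multiple[OF p folds_mono[OF fo] rd(1), of k] by simp
    moreover have "a i = (if even k then a (r n) else - a (r n))"
      unfolding i by (rule folds_multiple[OF fo _ rd]) simp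
    ultimately show ?thesis by (simp add: g_def)
  qed
  \<comment> \<open>The visits to a vertex without a level have indices that agree modulo every
    power of two, so there is at most one visit and the turn is unambiguous.\<close>
  have uniq: "i = j" if "\<And>n. \<not> lv (y i) n" "y i = y j" for i j
  proof -
    have "y i - c n \<in> Lambda n" for n using level_exists[of "y i" c n] that(1) unfolding lv_def by blast
    then have "2 ^ n dvd i - e n" "2 ^ n dvd j - e n" for n using yc that(2) by metis+
    then have d: "2 ^ n dvd i - j" for n
      using dvd_diff[of "2 ^ n" "i - e n" "j - e n"] by fastforce
    have "(i - j, i - j) \<in> Lambda (2 * n)" for n
      using d[of n] by (auto simp: Lambda_def Let_def dvd_def mult.commute)
    then have "(i - j, i - j) \<in> Lambda n" for n using Lambda_mono[of n "2 * n"] by fastforce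
    then show ?thesis using Lambda_Inter[of "(i - j, i - j)"] by (simp add: prod_eq_iff)
  qed
  have "\<forall>x. \<exists>s. s \<in> {1, -1} \<and> (\<forall>n. lv x n \<longrightarrow> s = g n x) \<and> (\<forall>i. y i = x \<longrightarrow> s = a i)"
  proof
    fix x
    show "\<exists>s. s \<in> {1, -1} \<and> (\<forall>n. lv x n \<longrightarrow> s = g n x) \<and> (\<forall>i. y i = x \<longrightarrow> s = a i)"
    proof (cases "\<exists>n. lv x n")
      case True
      then obtain n where n: "lv x n" by blast
      have "g n x \<in> {1, -1}" using pm[of "r n"] by (auto simp: g_def)
      moreover have "g n x = a i" if "y i = x" for i using gy[of i n] n that by simp
      moreover have "g n x = g m x" if "lv x m" for m using lv_unique[OF n that] by simp
      ultimately show ?thesis by blast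
    next
      case no: False
      show ?thesis
      proof (cases "\<exists>i. y i = x")
        case True
        then obtain i where i: "y i = x" by blast
        have "a i = a j" if "y j = x" for j using uniq[of i j] no i that by simp
        then show ?thesis using no pm[of i] by blast
      qed (use no in auto)
    qed
  qed
  from choice[OF this] obtain \<sigma> where
    "\<forall>x. \<sigma> x \<in> {1, -1} \<and> (\<forall>n. lv x n \<longrightarrow> \<sigma> x = g n x) \<and> (\<forall>i. y i = x \<longrightarrow> \<sigma> x = a i)" by blast
  then have \<sigma>: "\<And>x. \<sigma> x \<in> {1, -1}" "\<And>x n. lv x n \<Longrightarrow> \<sigma> x = g n x" "\<And>i. \<sigma> (y i) = a i" by blast+
  have "sign_field \<sigma> c" unfolding sign_field_def
  proof (intro conjI allI impI)
    fix n x u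
    assume A: "x - c n \<in> Lambda n \<and> x - c (Suc n) \<notin> Lambda (Suc n) \<and> u \<in> Lambda (Suc n)"
    then have l: "lv x n" by (simp add: lv_def)
    have eqs: "(x - c n) + u = x + u - c n" "(x + u - c (Suc n)) - u = x - c (Suc n)" by simp_all
    have "u \<in> Lambda n" using A Lambda_Suc_subset by blast
    then have l': "lv (x + u) n" using A Lambda_add[of "x - c n" n u, unfolded eqs]
      Lambda_diff[of "x + u - c (Suc n)" "Suc n" u, unfolded eqs] unfolding lv_def by blast
    have eq: "x + u - y (r n) = (x - y (r n)) + u" by simp
    have "x + u - y (r n) \<in> Lambda (Suc (Suc n)) \<longleftrightarrow> (x - y (r n) \<in> Lambda (Suc (Suc n)) \<longleftrightarrow> u \<in> Lambda (Suc (Suc n)))"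
      unfolding eq using A lvd[OF l r] by (intro Lambda_Suc_add_iff) auto
    then show "\<sigma> (x + u) = (if u \<in> Lambda (Suc (Suc n)) then \<sigma> x else - \<sigma> x)"
      using \<sigma>(2)[OF l] \<sigma>(2)[OF l'] by (simp add: g_def)
  qed (use \<sigma>(1) cc in blast)+
  moreover have "\<forall>n. \<exists>e. c n = y e \<and> folds a (Suc n) e" using e c_def by blast
  moreover have "\<forall>i. a i = \<sigma> (y i)" using \<sigma>(3) by simp
  ultimately show ?thesis by blast
qed

section \<open>Folding paths cover arbitrarily large squares\<close>

lemma snd_turn_unit: "unit_vec d \<Longrightarrow> s \<in> {1, -1} \<Longrightarrow> snd (turn s d) = 0 \<longleftrightarrow> snd d \<noteq> 0"
  by (auto simp: unit_vec_def turn_def)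

text \<open>Along a path horizontal and vertical steps alternate, as do even and odd vertices; hence either all
  horizontal segments start at even vertices or all of them start at odd ones.\<close>

definition seg_type :: "segment \<Rightarrow> bool" where
  "seg_type s \<longleftrightarrow> (even (fst (fst s) + snd (fst s)) \<longleftrightarrow> snd (fst s) = snd (snd s))"

lemma path_seg_type_Suc:
  assumes "lattice_path y a"
  shows "seg_type (y (i + 1), y (i + 2)) \<longleftrightarrow> seg_type (y i, y (i + 1))"
proof -
  have "y (i + 1 + 1) - y (i + 1) = turn (a (i + 1)) (y (i + 1) - y (i + 1 - 1))"
    and u: "unit_vec (y (i + 1) - y i)" and s: "a (i + 1) \<in> {1, -1}"
    using assms unfolding lattice_path_def by blast+
  then have 1: "y (i + 2) = y (i + 1) + turn (a (i + 1)) (y (i + 1) - y i)" by (simp add: algebra_simps)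
  obtain d where d: "y (i + 1) = y i + d" "unit_vec d" using u by (metis add_diff_cancel_left' diff_add_cancel add.commute)
  show ?thesis using s d(2) unfolding 1 d(1) by (auto simp: seg_type_def unit_vec_def turn_def)
qed

lemma path_seg_type:
  assumes "lattice_path y a"
  shows "seg_type (y i, y (i + 1)) \<longleftrightarrow> seg_type (y 0, y 1)"
proof (induction i rule: int_induct[where k = 0])
  case (step1 i)
  then show ?case using path_seg_type_Suc[OF assms, of i] by (simp add: algebra_simps)
next
  case (step2 i)
  then show ?case using path_seg_type_Suc[OF assms, of "i - 1"] by (simp add: algebra_simps)
qed simp

definition traverses :: "(int \<Rightarrow> point) \<Rightarrow> point \<Rightarrow> point \<Rightarrow> bool" where
  "traverses y A d \<longleftrightarrow> (\<exists>i. y i = A \<and> y (i + 1) = A + d)"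

definition covers :: "(int \<Rightarrow> point) \<Rightarrow> point \<Rightarrow> point \<Rightarrow> bool" where
  "covers y A B \<longleftrightarrow> (\<exists>i. {y i, y (i + 1)} = {A, B})"

lemma covers_commute: "covers y A B \<longleftrightarrow> covers y B A"
  by (simp add: covers_def insert_commute)

lemma covers_iff: "covers y A B \<longleftrightarrow> traverses y A (B - A) \<or> traverses y B (A - B)"
  by (auto simp: covers_def traverses_def doubleton_eq_iff)

lemma traverses_covers: "traverses y A d \<Longrightarrow> covers y A (A + d)"
  by (auto simp: covers_def traverses_def)

text \<open>A step \<open>d\<close> of the derived path is dilated by \<open>1 + \<i>\<close> and replaced by two steps, the first of which is
  \<open>d\<close> or \<open>\<i> d\<close>. As the fold alternates, the choice depends only on whether \<open>d\<close> is horizontal.\<close>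

definition bend :: "bool \<Rightarrow> point \<Rightarrow> point" where
  "bend \<beta> d = (if \<beta> = (snd d = 0) then d else turn 1 d)"

definition refines :: "point \<Rightarrow> bool \<Rightarrow> (int \<Rightarrow> point) \<Rightarrow> (int \<Rightarrow> point) \<Rightarrow> bool" where
  "refines t \<beta> w y \<longleftrightarrow> (\<forall>j. \<exists>i. y i = t + dil (w j) \<and>
     y (i + 1) = t + dil (w j) + bend \<beta> (w (j + 1) - w j) \<and> y (i + 2) = t + dil (w (j + 1)))"

lemma refines_traverses:
  assumes "refines t \<beta> w y" "traverses w A d"
  shows "traverses y (t + dil A) (bend \<beta> d)" "traverses y (t + dil A + bend \<beta> d) (dil d - bend \<beta> d)"
proof -
  obtain j where j: "w j = A" "w (j + 1) = A + d" using assms(2) by (auto simp: traverses_def)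
  obtain i where "y i = t + dil (w j)" "y (i + 1) = t + dil (w j) + bend \<beta> (w (j + 1) - w j)"
    "y (i + 2) = t + dil (w (j + 1))" using assms(1) unfolding refines_def by blast
  then have i: "y i = t + dil A" "y (i + 1) = t + dil A + bend \<beta> d" "y (i + 2) = t + dil (A + d)"
    unfolding j by simp_all
  have i2: "i + 1 + 1 = i + 2" by simp
  show "traverses y (t + dil A) (bend \<beta> d)" using i by (auto simp: traverses_def)
  show "traverses y (t + dil A + bend \<beta> d) (dil d - bend \<beta> d)"
    unfolding traverses_def by (rule exI[of _ "i + 1"], unfold i2 i dil_add) simp
qed

text \<open>The vertices of even index relative to \<open>e\<close>, translated and divided by
  \<open>1 + i\<close>, form the derived path. The folds at the skipped vertices alternate, and so
  does the horizontality of the derived steps; their constant relation is recorded by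
  \<open>\<beta>\<close>.\<close>

lemma derived_path:
  assumes p: "lattice_path y a" and fs: "fold_seq a"
  shows "\<exists>w a' t \<beta>. lattice_path w a' \<and> fold_seq a' \<and> refines t \<beta> w y"
proof -
  have pm: "\<And>i. a i \<in> {1, -1}" using p by (auto simp: lattice_path_def)
  \<comment> \<open>Two levels are taken because the second one pins down the parity of
    \<open>e\<close>.\<close>
  obtain e where e: "folds a 2 e" using fs by (auto simp: fold_seq_def)
  have e1: "folds a (Suc 0) e" using e by (rule folds_mono) simp
  have "\<exists>z. dil z = y (e + 2 * j) - y e" for j
  proof -
    have "y (e + j * 2 ^ Suc 0) - y e \<in> Lambda (Suc 0)" using path_jump_multiple[OF p e1, of e j] by simp
    then obtain z where "y (e + j * 2 ^ Suc 0) - y e = dil z" by (rule Lambda_SucE)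
    then show ?thesis by (intro exI[of _ z]) (simp add: mult.commute)
  qed
  then obtain w where w: "\<And>j. dil (w j) = y (e + 2 * j) - y e" by metis
  define b where "b j = a (e + 2 * j + 1)" for j
  have b: "b j = (if even j then b 0 else - b 0)" for j
    using folds_multiple[OF e1, of 0 "e + 1" j] by (simp add: b_def algebra_simps)
  define D where "D j = y (e + 2 * j + 1) - y (e + 2 * j)" for j
  have D: "unit_vec (D j)" for j using p unfolding lattice_path_def D_def by blast
  have D2: "y (e + 2 * j + 2) - y (e + 2 * j + 1) = turn (b j) (D j)" for j
  proof -
    have "y (e + 2 * j + 1 + 1) - y (e + 2 * j + 1) = turn (a (e + 2 * j + 1)) (y (e + 2 * j + 1) - y (e + 2 * j + 1 - 1))"
      using p unfolding lattice_path_def by blast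
    then show ?thesis by (simp add: b_def D_def algebra_simps)
  qed
  \<comment> \<open>\<open>(1 + b * i) * D\<close> equals \<open>(1 + i) * D\<close> for
    \<open>b = 1\<close> and \<open>(1 + i) * (- i * D)\<close> for \<open>b = -1\<close>.\<close>
  have dw: "w (j + 1) - w j = (if b j = 1 then D j else turn (-1) (D j))" for j
  proof -
    have "dil (w (j + 1) - w j) = D j + turn (b j) (D j)"
      using D2[of j] by (simp add: dil_diff w D_def algebra_simps)
    also have "\<dots> = dil (if b j = 1 then D j else turn (-1) (D j))"
      using pm[of "e + 2 * j + 1"] by (auto simp: b_def dil_def turn_def prod_eq_iff)
    finally show ?thesis by (simp only: dil_inject)
  qed
  define a' where "a' j = a (e + 2 * j)" for j
  have uw: "unit_vec (w (j + 1) - w j)" for j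
    using D[of j] unit_vec_turn[OF D[of j], of "-1"] by (simp add: dw)
  have tw: "w (j + 1) - w j = turn (a' j) (w j - w (j - 1))" for j
  proof -
    have "2 ^ Suc 0 dvd e + 2 * (j - 1) - e" by simp
    from path_jump[OF p e1 this] have "y (e + 2 * (j + 1)) - y (e + 2 * j) = turn (a' j) (y (e + 2 * j) - y (e + 2 * (j - 1)))"
      by (simp add: a'_def algebra_simps)
    then have "dil (w (j + 1) - w j) = dil (turn (a' j) (w j - w (j - 1)))"
      by (simp add: dil_diff dil_turn w)
    then show ?thesis by (simp only: dil_inject)
  qed
  have pw: "lattice_path w a'" unfolding lattice_path_def using uw tw pm by (auto simp: a'_def)
  have "\<exists>e'. folds a' n e'" for n
  proof -
    \<comment> \<open>Halving the indices uses up one level. With two extra levels the parities of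
      \<open>f\<close> and \<open>e\<close> can be compared through \<open>E_seq 1\<close> even for
      \<open>n = 0\<close>.\<close>
    obtain f where f: "folds a (Suc (Suc n)) f" using fs by (auto simp: fold_seq_def)
    have "E_seq 1 a = {i. 2 ^ 1 dvd i - e}" using e by (intro E_seq_folds pm) (simp add: numeral_2_eq_2)
    moreover have "E_seq 1 a = {i. 2 ^ 1 dvd i - f}" using folds_mono[OF f, of "Suc 1"] by (intro E_seq_folds pm) simp
    ultimately have "even (f - e)" by auto
    then obtain q where "f - e = 2 * q" by (rule evenE)
    then have q: "f = e + 2 * q" by simp
    have "folds a' n q" unfolding folds_def
    proof (intro allI impI)
      fix m i assume m: "m < n" and i: "2 ^ m dvd i - q \<and> \<not> 2 ^ Suc m dvd i - q"
      have eq: "e + 2 * i - f = 2 * (i - q)" by (simp add: q)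
      have "2 ^ Suc m dvd e + 2 * i - f" "\<not> 2 ^ Suc (Suc m) dvd e + 2 * i - f"
        using i unfolding eq power_Suc[of 2 "Suc m"] power_Suc[of 2 m] dvd_mult_cancel_left by simp_all
      moreover have "Suc m < Suc (Suc n)" using m by simp
      ultimately have "a (e + 2 * i + 2 ^ Suc (Suc m)) = - a (e + 2 * i)" using f unfolding folds_def by blast
      moreover have "e + 2 * i + 2 ^ Suc (Suc m) = e + 2 * (i + 2 ^ Suc m)" by simp
      ultimately show "a' (i + 2 ^ Suc m) = - a' i" unfolding a'_def by (simp only:)
    qed
    then show ?thesis by blast
  qed
  then have fw: "fold_seq a'" using pm by (auto simp: fold_seq_def a'_def)
  define \<beta> where "\<beta> \<longleftrightarrow> (b 0 = 1 \<longleftrightarrow> snd (w 1 - w 0) = 0)"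
  have hor: "snd (w (j + 1) - w j) = 0 \<longleftrightarrow> (even j \<longleftrightarrow> snd (w 1 - w 0) = 0)" for j
  proof (induction j rule: int_induct[where k = 0])
    have h: "snd (w (j + 1 + 1) - w (j + 1)) = 0 \<longleftrightarrow> snd (w (j + 1) - w j) \<noteq> 0" for j
    proof -
      have "w (j + 1 + 1) - w (j + 1) = turn (a' (j + 1)) (w (j + 1) - w j)" using tw[of "j + 1"] by simp
      then show ?thesis using snd_turn_unit[OF uw[of j], of "a' (j + 1)"] pm unfolding a'_def by (simp only:)
    qed
    { case (step1 i) then show ?case using h[of i] by auto
    next
      case (step2 i) then show ?case using h[of "i - 1"] by auto }
  qed simp
  have bb: "(b j = 1) = (\<beta> = (snd (w (j + 1) - w j) = 0))" for j
    using b[of j] hor[of j] pm[of "e + 1"] by (auto simp: \<beta>_def b_def)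
  have "refines (y e) \<beta> w y" unfolding refines_def
  proof
    fix j
    have "bend \<beta> (w (j + 1) - w j) = (if b j = 1 then w (j + 1) - w j else turn 1 (w (j + 1) - w j))"
      unfolding bend_def by (simp only: bb[of j])
    also have "\<dots> = D j" unfolding dw using turn_turn(1)[of 1 "D j"] by auto
    finally show "\<exists>i. y i = y e + dil (w j) \<and> y (i + 1) = y e + dil (w j) + bend \<beta> (w (j + 1) - w j) \<and>
         y (i + 2) = y e + dil (w (j + 1))"
      by (intro exI[of _ "e + 2 * j"]) (simp add: w D_def algebra_simps)
  qed
  then show ?thesis using pw fw by blast
qed

section \<open>Full squares under refinement\<close>

definition square :: "(int \<Rightarrow> point) \<Rightarrow> int \<Rightarrow> int \<Rightarrow> bool" where
  "square y p q \<longleftrightarrow> covers y (p, q) (p + 1, q) \<and> covers y (p, q) (p, q + 1) \<and>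
     covers y (p + 1, q) (p + 1, q + 1) \<and> covers y (p, q + 1) (p + 1, q + 1)"

definition star :: "(int \<Rightarrow> point) \<Rightarrow> int \<Rightarrow> int \<Rightarrow> bool" where
  "star y p q \<longleftrightarrow> covers y (p, q) (p + 1, q) \<and> covers y (p, q) (p - 1, q) \<and>
     covers y (p, q) (p, q + 1) \<and> covers y (p, q) (p, q - 1)"

lemma path_traverses_type:
  assumes "lattice_path w a" "traverses w A d"
  shows "(even (fst A + snd A) \<longleftrightarrow> snd d = 0) \<longleftrightarrow> seg_type (w 0, w 1)"
proof -
  obtain i where i: "w i = A" "w (i + 1) = A + d" using assms(2) unfolding traverses_def by blast
  show ?thesis using path_seg_type[OF assms(1), of i] unfolding i by (simp add: seg_type_def)
qed

text \<open>Horizontal steps all start at vertices of one parity and vertical steps at those of the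
  other, so the boundary of a square is oriented cyclically.\<close>

lemma square_oriented:
  assumes "lattice_path w a" "square w p q"
  shows "traverses w (p, q) (1, 0) \<and> traverses w (p + 1, q) (0, 1) \<and>
      traverses w (p + 1, q + 1) (-1, 0) \<and> traverses w (p, q + 1) (0, -1)
    \<or> traverses w (p, q) (0, 1) \<and> traverses w (p, q + 1) (1, 0) \<and>
      traverses w (p + 1, q + 1) (0, -1) \<and> traverses w (p + 1, q) (-1, 0)"
proof -
  note T = path_traverses_type[OF assms(1)]
  show ?thesis using assms(2)
    T[of "(p, q)" "(1, 0)"] T[of "(p + 1, q)" "(0, 1)"] T[of "(p + 1, q + 1)" "(-1, 0)"] T[of "(p, q + 1)" "(0, -1)"]
    T[of "(p, q)" "(0, 1)"] T[of "(p, q + 1)" "(1, 0)"] T[of "(p + 1, q + 1)" "(0, -1)"] T[of "(p + 1, q)" "(-1, 0)"]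
    unfolding square_def covers_iff by (simp; argo)
qed

text \<open>The star sits at the image of the centre of the square. As the boundary is oriented
  cyclically, either both horizontal or both vertical sides are folded inwards, and each of them
  contributes two edges at the centre.\<close>

lemma star_of_square:
  assumes p: "lattice_path w a" and r: "refines (u, v) \<beta> w y" and s: "square w p q"
  shows "star y (u + p - q) (v + p + q + 1)"
proof -
  have two: "covers y (m, n) (u + x - z, v + x + z) \<and> covers y (m, n) (u + x - z + dx - dz, v + x + z + dx + dz)"
    if t: "traverses w (x, z) (dx, dz)" and m: "(m, n) = (u + x - z, v + x + z) + bend \<beta> (dx, dz)"
    for x z dx dz m n
  proof -
    have e: "(u, v) + dil (x, z) = (u + x - z, v + x + z)" by (simp add: dil_def)
    have e2: "(m, n) + (dil (dx, dz) - bend \<beta> (dx, dz)) = (u + x - z + dx - dz, v + x + z + dx + dz)"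
      unfolding m by (simp add: dil_def prod_eq_iff)
    note R = refines_traverses[OF r t, THEN traverses_covers, unfolded e, folded m, unfolded e2]
    show ?thesis using R covers_commute[of y "(m, n)"] by blast
  qed
  show ?thesis using square_oriented[OF p s]
  proof
    assume "traverses w (p, q) (1, 0) \<and> traverses w (p + 1, q) (0, 1) \<and>
      traverses w (p + 1, q + 1) (-1, 0) \<and> traverses w (p, q + 1) (0, -1)"
    then have A: "traverses w (p, q) (1, 0)" "traverses w (p + 1, q) (0, 1)"
      "traverses w (p + 1, q + 1) (-1, 0)" "traverses w (p, q + 1) (0, -1)" by auto
    show ?thesis
    proof (cases \<beta>)
      case True
      show ?thesis
        using two[OF A(2), of "u + p - q" "v + p + q + 1"] two[OF A(4), of "u + p - q" "v + p + q + 1"] True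
        unfolding star_def by (simp add: bend_def turn_def algebra_simps)
    next
      case False
      show ?thesis
        using two[OF A(1), of "u + p - q" "v + p + q + 1"] two[OF A(3), of "u + p - q" "v + p + q + 1"] False
        unfolding star_def by (simp add: bend_def turn_def algebra_simps)
    qed
  next
    assume "traverses w (p, q) (0, 1) \<and> traverses w (p, q + 1) (1, 0) \<and>
      traverses w (p + 1, q + 1) (0, -1) \<and> traverses w (p + 1, q) (-1, 0)"
    then have A: "traverses w (p, q) (0, 1)" "traverses w (p, q + 1) (1, 0)"
      "traverses w (p + 1, q + 1) (0, -1)" "traverses w (p + 1, q) (-1, 0)" by auto
    show ?thesis
    proof (cases \<beta>)
      case True
      show ?thesis
        using two[OF A(2), of "u + p - q" "v + p + q + 1"] two[OF A(4), of "u + p - q" "v + p + q + 1"] True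
        unfolding star_def by (simp add: bend_def turn_def algebra_simps)
    next
      case False
      show ?thesis
        using two[OF A(1), of "u + p - q" "v + p + q + 1"] two[OF A(3), of "u + p - q" "v + p + q + 1"] False
        unfolding star_def by (simp add: bend_def turn_def algebra_simps)
    qed
  qed
qed

text \<open>Two opposite corners of the new square are the images of the centres of two adjacent
  squares, the other two are the images of the endpoints of their common side. Each side of it
  belongs to one of the two stars.\<close>

lemma square_of_squares:
  assumes p: "lattice_path w a" and r: "refines (u, v) \<beta> w y" and s: "square w p q"
  shows "square w p (q - 1) \<Longrightarrow> square y (u + p - q) (v + p + q)"
    and "square w (p - 1) q \<Longrightarrow> square y (u + p - q - 1) (v + p + q)"
proof -
  assume "square w p (q - 1)"
  from star_of_square[OF p r this] star_of_square[OF p r s]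
  show "square y (u + p - q) (v + p + q)"
    unfolding star_def square_def by (simp add: algebra_simps covers_commute)
next
  assume "square w (p - 1) q"
  from star_of_square[OF p r this] star_of_square[OF p r s]
  show "square y (u + p - q - 1) (v + p + q)"
    unfolding star_def square_def by (simp add: algebra_simps covers_commute)
qed

definition block :: "(int \<Rightarrow> point) \<Rightarrow> int \<Rightarrow> bool" where
  "block y k \<longleftrightarrow> (\<exists>x z. \<forall>p q. 0 \<le> p \<and> p < k \<and> 0 \<le> q \<and> q < k \<longrightarrow> square y (x + p) (z + q))"

lemma block_mono: "block y k \<Longrightarrow> l \<le> k \<Longrightarrow> block y l"
  unfolding block_def by (meson less_le_trans)

text \<open>After two refinements every square is cut into four quarters. The quarter at a corner of a full
  square is full as soon as the two neighbouring squares at that corner are full, so only the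
  outermost quarters of a block can fail.\<close>

lemma block_grows:
  assumes p: "lattice_path w a" "lattice_path w' a'" and r: "refines t \<beta> w w'" "refines t' \<beta>' w' y"
    and b: "block w k"
  shows "block y (2 * k - 2)"
proof -
  obtain u v u' v' where t: "t = (u, v)" "t' = (u', v')" by fastforce
  obtain X Z where XZ: "\<And>p q. 0 \<le> p \<Longrightarrow> p < k \<Longrightarrow> 0 \<le> q \<Longrightarrow> q < k \<Longrightarrow> square w (X + p) (Z + q)"
    using b unfolding block_def by blast
  note s1 = square_of_squares[OF p(1) r(1)[unfolded t]]
  note s2 = square_of_squares[OF p(2) r(2)[unfolded t]]
  \<comment> \<open>Two refinements multiply by \<open>(1 + i)^2 = 2 * i\<close>, so the point
    \<open>(p, q)\<close> goes to \<open>(f - 2 * q, g + 2 * p)\<close>: rows and columns are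
    exchanged.\<close>
  define f where "f = u' + u - v"
  define g where "g = v' + u + v"
  \<comment> \<open>The square with the full quarter is \<open>(p, q - 1)\<close> in
    \<open>sa\<close>, \<open>(p - 1, q)\<close> in \<open>sb\<close> and \<open>sd\<close>, and
    \<open>(p, q)\<close> in \<open>sc\<close>; the other two are its neighbours at the corner
    concerned.\<close>
  have sa: "square y (f - 2 * q) (g + 2 * p)"
    if "square w p q" "square w p (q - 1)" "square w (p - 1) (q - 1)" for p q
    using s2(1)[of "u + p - q" "v + p + q"] s1(1)[OF that(1,2)] s1(2)[OF that(2,3)]
    by (simp add: f_def g_def algebra_simps)
  have sb: "square y (f - 2 * q - 1) (g + 2 * p - 1)"
    if "square w p q" "square w (p - 1) q" "square w (p - 1) (q - 1)" for p q
    using s2(1)[of "u + p - q - 1" "v + p + q"] s1(2)[OF that(1,2)] s1(1)[OF that(2,3)]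
    by (simp add: f_def g_def algebra_simps)
  have sc: "square y (f - 2 * q - 1) (g + 2 * p)"
    if "square w p q" "square w p (q - 1)" "square w (p - 1) q" for p q
    using s2(2)[of "u + p - q" "v + p + q"] s1(1)[OF that(1,2)] s1(2)[OF that(1,3)]
    by (simp add: f_def g_def algebra_simps)
  have sd: "square y (f - 2 * q - 2) (g + 2 * p - 1)"
    if "square w p q" "square w (p - 1) q" "square w (p - 1) (q + 1)" for p q
    using s2(2)[of "u + p - q - 1" "v + p + q"] s1(2)[OF that(1,2)] s1(1)[of "p - 1" "q + 1"] that
    by (simp add: f_def g_def algebra_simps)
  \<comment> \<open>The quarters of the whole block start at
    \<open>(f - 2 * Z - 2 * k, g + 2 * X)\<close>; the offset 1 and the side
    \<open>2 * k - 2\<close> drop the outer ring.\<close>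
  have "square y (f - 2 * Z - 2 * k + 1 + i) (g + 2 * X + 1 + j)"
    if ij: "0 \<le> i" "i < 2 * k - 2" "0 \<le> j" "j < 2 * k - 2" for i j
  proof -
    define P where "P = (j + 2) div 2"
    have P: "1 \<le> P" "P < k" using ij by (auto simp: P_def)
    show ?thesis
    proof (cases "odd j")
      case True
      then have j: "j = 2 * P - 1" unfolding P_def by presburger
      define Q where "Q = k - 1 - i div 2"
      have Q: "1 \<le> Q" "Q < k" using ij by (auto simp: Q_def)
      have sq: "square w (X + P) (Z + Q)" "square w (X + P) (Z + Q - 1)" "square w (X + P - 1) (Z + Q)" "square w (X + P - 1) (Z + Q - 1)"
        using XZ[of P Q] XZ[of P "Q - 1"] XZ[of "P - 1" Q] XZ[of "P - 1" "Q - 1"] P Q by (simp_all add: algebra_simps)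
      show ?thesis
      proof (cases "odd i")
        case True
        then have i: "i = 2 * (k - 1 - Q) + 1" unfolding Q_def by presburger
        show ?thesis using sa[OF sq(1,2,4)] by (simp add: i j algebra_simps)
      next
        case False
        then have i: "i = 2 * (k - 1 - Q)" unfolding Q_def by presburger
        show ?thesis using sc[OF sq(1,2,3)] by (simp add: i j algebra_simps)
      qed
    next
      case False
      then have j: "j = 2 * P - 2" unfolding P_def by presburger
      show ?thesis
      proof (cases "odd i")
        case True
        define Q where "Q = k - 2 - i div 2"
        have Q: "0 \<le> Q" "Q < k - 1" using ij True unfolding Q_def by presburger+
        have i: "i = 2 * (k - 2 - Q) + 1" using True unfolding Q_def by presburger
        have sq: "square w (X + P) (Z + Q)" "square w (X + P - 1) (Z + Q)" "square w (X + P - 1) (Z + Q + 1)"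
          using XZ[of P Q] XZ[of "P - 1" Q] XZ[of "P - 1" "Q + 1"] P Q by (simp_all add: algebra_simps)
        show ?thesis using sd[OF sq] by (simp add: i j algebra_simps)
      next
        case False
        define Q where "Q = k - 1 - i div 2"
        have Q: "1 \<le> Q" "Q < k" using ij by (auto simp: Q_def)
        have i: "i = 2 * (k - 1 - Q)" using False unfolding Q_def by presburger
        have sq: "square w (X + P) (Z + Q)" "square w (X + P - 1) (Z + Q)" "square w (X + P - 1) (Z + Q - 1)"
          using XZ[of P Q] XZ[of "P - 1" Q] XZ[of "P - 1" "Q - 1"] P Q by (simp_all add: algebra_simps)
        show ?thesis using sb[OF sq] by (simp add: i j algebra_simps)
      qed
    qed
  qed
  then show ?thesis unfolding block_def by blast
qed

section \<open>The certified block of side 3\<close>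

definition undil :: "point \<Rightarrow> point" where
  "undil z = ((fst z + snd z) div 2, (snd z - fst z) div 2)"

text \<open>Membership of the oriented edge from \<open>A\<close> in direction \<open>d\<close> in the unfolding of the edge from 0 to 1,
  decided by passing to the parent edge; the folds are listed from the finest to the coarsest.
  The start of an edge of the unfolding determines its direction up to sign through \<open>seg_type\<close>,
  which at the level of the parent is the next fold \<open>\<theta>\<close> of the list.\<close>

primrec in_tile :: "bool list \<Rightarrow> point \<Rightarrow> point \<Rightarrow> bool" where
  "in_tile [] A d \<longleftrightarrow> A = (0, 0) \<and> d = (1, 0)"
| "in_tile (\<beta> # \<beta>s) A d \<longleftrightarrow>
     (let \<theta> = (case \<beta>s of [] \<Rightarrow> True | b # _ \<Rightarrow> b); h = (snd d = 0) in
      if even (fst A + snd A) then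
        \<beta> = h \<and>
        (let Z = undil A in
          in_tile \<beta>s Z (if h = (even (fst Z + snd Z) = \<theta>) then d else turn (-1) d))
      else
        \<beta> \<noteq> h \<and>
        (let W = undil (A + d);
             \<delta> = (if h = (odd (fst W + snd W) = \<theta>) then d else turn (-1) d)
         in in_tile \<beta>s (W - \<delta>) \<delta>))"

text \<open>Only one orientation of an edge has the \<open>seg_type\<close> of the finest level,
  which the first fold records. For the empty list the base edge is horizontal and starts at an even
  point, hence the default \<open>True\<close>.\<close>

definition edge_in_tile :: "bool list \<Rightarrow> point \<Rightarrow> point \<Rightarrow> bool" where
  "edge_in_tile \<beta>s A d \<longleftrightarrow>
     (if (even (fst A + snd A) = (snd d = 0)) = (case \<beta>s of [] \<Rightarrow> True | b # _ \<Rightarrow> b)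
      then in_tile \<beta>s A d else in_tile \<beta>s (A + d) (- d))"

definition block_in_tile :: "bool list \<Rightarrow> int \<Rightarrow> int \<Rightarrow> bool" where
  "block_in_tile \<beta>s x y \<longleftrightarrow>
     list_all (\<lambda>p. list_all (\<lambda>q. edge_in_tile \<beta>s (x + p, y + q) (0, 1) \<and>
        edge_in_tile \<beta>s (x + q, y + p) (1, 0)) [0, 1, 2]) [0, 1, 2, 3]"

text \<open>A certificate, found by computer search, that for all folds some unfolding contains a block of side 3:
  a node branches on the next coarser fold, a leaf gives the lower left corner of the block.\<close>

datatype block_tree = Lf int int | Nd block_tree block_tree

primrec valid_tree :: "block_tree \<Rightarrow> bool list \<Rightarrow> bool" where
  "valid_tree (Lf x y) \<beta>s \<longleftrightarrow> block_in_tile \<beta>s x y"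
| "valid_tree (Nd l r) \<beta>s \<longleftrightarrow> valid_tree l (\<beta>s @ [True]) \<and> valid_tree r (\<beta>s @ [False])"


definition blocks_tree :: block_tree where
  "blocks_tree =
   Nd (Nd (Nd (Nd (Nd (Nd (Nd (Nd (Lf 7 (-5)) (Lf 1 4)) (Nd (Nd (Lf 3 (-1)) (Lf 1 9)) (Lf 8
   2))) (Nd (Nd (Lf 2 (-5)) (Lf 6 3)) (Lf 6 (-5)))) (Nd (Nd (Lf (-2) (-6)) (Nd (Lf 6 (-5))
   (Lf 11 4))) (Nd (Lf 2 (-9)) (Nd (Lf 10 (-5)) (Lf 5 4))))) (Nd (Nd (Nd (Nd (Lf 5 (-7)) (Lf
   1 1)) (Lf 4 (-1))) (Nd (Nd (Lf 1 (-7)) (Lf 8 1)) (Nd (Lf 8 (-5)) (Nd (Lf 9 5) (Lf 2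
   11))))) (Nd (Nd (Lf 0 (-7)) (Nd (Lf 5 (-7)) (Lf 9 1))) (Nd (Lf 2 (-10)) (Nd (Lf 10 (-10))
   (Lf 5 1)))))) (Nd (Nd (Nd (Nd (Nd (Lf 6 (-5)) (Lf 1 6)) (Lf 3 0)) (Nd (Nd (Lf 1 (-5)) (Lf
   6 2)) (Lf 5 (-5)))) (Nd (Nd (Nd (Nd (Lf 11 0) (Lf (-1) 3)) (Lf 2 2)) (Nd (Lf 5 (-5)) (Lf
   10 2))) (Nd (Lf 1 (-9)) (Nd (Lf 9 (-5)) (Lf 7 3))))) (Nd (Nd (Lf (-4) (-4)) (Nd (Lf 0
   (-8)) (Lf 6 (-5)))) (Nd (Nd (Lf 0 (-7)) (Nd (Lf 7 (-7)) (Lf 8 1))) (Nd (Nd (Lf 2 (-5))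
   (Lf 4 5)) (Lf 4 (-3))))))) (Nd (Nd (Nd (Nd (Nd (Nd (Lf 8 (-4)) (Lf 1 4)) (Nd (Nd (Lf 4 0)
   (Lf 1 9)) (Lf 8 2))) (Nd (Nd (Lf 1 (-4)) (Lf 5 4)) (Lf 5 (-4)))) (Nd (Nd (Lf (-2) (-6))
   (Nd (Lf 5 (-4)) (Lf 9 8))) (Nd (Lf 1 (-8)) (Nd (Lf 9 (-4)) (Lf 5 4))))) (Nd (Nd (Nd (Nd
   (Lf 6 (-6)) (Lf 2 2)) (Lf 3 (-2))) (Nd (Nd (Lf 1 (-7)) (Lf 7 2)) (Nd (Lf 7 (-6)) (Nd (Lf
   10 6) (Lf 0 11))))) (Nd (Nd (Lf (-1) (-6)) (Nd (Lf 5 (-7)) (Lf 10 2))) (Nd (Lf 2 (-10))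
   (Nd (Lf 11 (-7)) (Lf 6 2)))))) (Nd (Nd (Nd (Nd (Lf 0 (-8)) (Lf 3 0)) (Lf 1 (-4))) (Nd (Nd
   (Nd (Lf 4 (-8)) (Lf 4 0)) (Lf 5 (-4))) (Nd (Lf 1 (-8)) (Nd (Lf 8 (-4)) (Lf 7 4))))) (Nd
   (Nd (Nd (Nd (Lf 6 (-5)) (Lf 1 2)) (Lf 3 0)) (Nd (Nd (Lf 2 (-8)) (Lf 6 2)) (Lf 6 (-5))))
   (Nd (Nd (Lf (-1) (-6)) (Nd (Lf 7 (-6)) (Lf 9 2))) (Nd (Nd (Lf 2 (-5)) (Nd (Lf 10 2) (Lf 5
   10))) (Nd (Lf 10 (-5)) (Lf 5 2)))))))) (Nd (Nd (Nd (Nd (Nd (Nd (Nd (Lf 7 (-5)) (Lf 2 2))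
   (Nd (Nd (Lf 3 (-1)) (Lf 1 10)) (Lf 7 3))) (Nd (Nd (Lf 2 (-4)) (Lf 6 3)) (Lf 6 (-4)))) (Nd
   (Nd (Lf (-1) (-5)) (Nd (Lf 6 (-4)) (Lf 10 6))) (Nd (Lf 2 (-8)) (Nd (Lf 10 (-4)) (Lf 6
   2))))) (Nd (Nd (Nd (Nd (Lf 5 (-7)) (Lf 1 1)) (Lf 4 (-2))) (Nd (Lf 0 (-7)) (Nd (Lf 9 (-3))
   (Lf 9 5)))) (Nd (Lf (-4) (-7)) (Nd (Lf 0 (-11)) (Lf 5 (-3)))))) (Nd (Nd (Nd (Nd (Nd (Lf 7
   (-5)) (Lf 2 4)) (Lf 4 0)) (Nd (Nd (Lf 2 (-5)) (Lf 6 3)) (Lf 6 (-5)))) (Nd (Nd (Nd (Nd (Lf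
   9 1) (Lf (-1) 3)) (Lf 3 2)) (Nd (Lf 6 (-5)) (Lf 11 3))) (Nd (Lf 2 (-9)) (Nd (Lf 10 (-5))
   (Lf 7 3))))) (Nd (Nd (Nd (Nd (Lf 5 (-7)) (Lf 1 1)) (Lf 4 0)) (Nd (Nd (Lf 1 (-8)) (Lf 7
   2)) (Lf 7 (-5)))) (Nd (Nd (Lf 0 (-7)) (Nd (Lf 6 (-7)) (Lf 9 1))) (Nd (Nd (Lf 3 (-5)) (Nd
   (Lf 12 1) (Lf 5 9))) (Nd (Lf 11 (-6)) (Lf 5 1))))))) (Nd (Nd (Nd (Nd (Nd (Lf 1 (-8)) (Nd
   (Lf 9 (-8)) (Lf 9 0))) (Nd (Nd (Lf 1 (-4)) (Lf 5 4)) (Lf 5 (-4)))) (Nd (Nd (Lf (-1) (-5))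
   (Lf 5 (-3))) (Lf 1 (-7)))) (Nd (Nd (Nd (Nd (Lf 6 (-6)) (Lf 2 1)) (Lf 3 (-2))) (Nd (Nd (Lf
   1 (-6)) (Lf 7 2)) (Nd (Lf 7 (-6)) (Nd (Lf 10 5) (Lf 2 10))))) (Nd (Nd (Lf (-1) (-5)) (Nd
   (Lf 6 (-5)) (Lf 10 1))) (Nd (Lf 1 (-10)) (Nd (Lf 9 (-10)) (Lf 6 1)))))) (Nd (Nd (Nd (Nd
   (Nd (Lf 7 (-5)) (Lf 1 5)) (Lf 4 0)) (Nd (Nd (Lf 1 (-4)) (Lf 5 4)) (Lf 5 (-4)))) (Nd (Nd
   (Nd (Nd (Lf 9 1) (Lf 0 4)) (Lf 3 2)) (Nd (Lf 5 (-4)) (Lf 11 3))) (Nd (Lf 1 (-8)) (Nd (Lf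
   9 (-4)) (Lf 6 4))))) (Nd (Nd (Nd (Nd (Lf 6 (-6)) (Lf 2 2)) (Lf 4 0)) (Nd (Nd (Lf 2 (-7))
   (Lf 7 2)) (Lf 7 (-5)))) (Nd (Nd (Lf (-1) (-6)) (Nd (Lf 7 (-6)) (Lf 10 2))) (Nd (Nd (Lf 3
   (-5)) (Nd (Lf 11 0) (Lf 6 10))) (Nd (Lf 11 (-6)) (Lf 6 2))))))))"

lemma valid_blocks_tree: "valid_tree blocks_tree []"
  by code_simp

lemma dil_undil: "even (fst z + snd z) \<Longrightarrow> dil (undil z) = z"
  unfolding dil_def undil_def prod_eq_iff fst_conv snd_conv by presburger

text \<open>The certificate is anchored at a step to the right. If there were none, all horizontal
  steps would point left, so the turns before and after each vertical step would be opposite. With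
  the alternation at level 0 this gives \<open>a (i + 2) = - a i\<close> everywhere, hence the
  period 4.\<close>

lemma path_direction:
  assumes p: "lattice_path w a" and fs: "fold_seq a"
  shows "\<exists>R. traverses w R (1, 0)"
proof (rule ccontr)
  assume "\<nexists>R. traverses w R (1, 0)"
  then have no: "w (j + 1) - w j \<noteq> (1, 0)" for j
    unfolding traverses_def by (metis add.commute diff_add_cancel)
  define d where "d j = w (j + 1) - w j" for j
  have pm: "\<And>i. a i \<in> {1, -1}" using p by (auto simp: lattice_path_def)
  have d: "d (j + 1) = turn (a (j + 1)) (d j)" for j
  proof -
    have "w (j + 1 + 1) - w (j + 1) = turn (a (j + 1)) (w (j + 1) - w (j + 1 - 1))"
      using p unfolding lattice_path_def by blast
    then show ?thesis by (simp add: d_def)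
  qed
  have u: "unit_vec (d j)" for j using p unfolding lattice_path_def d_def by blast
  have dn: "d j \<noteq> (1, 0)" for j using no by (simp add: d_def)
  have hv: "snd (d (j + 1)) = 0 \<longleftrightarrow> snd (d j) \<noteq> 0" for j
    unfolding d using snd_turn_unit[OF u pm] by blast
  have hp: "snd (d j) = 0 \<Longrightarrow> a (j + 2) = - a (j + 1)" for j
  proof -
    assume h: "snd (d j) = 0"
    then have 1: "d j = (-1, 0)" using u[of j] dn[of j] by (auto simp: unit_vec_def)
    have "snd (d (j + 1 + 1)) = 0" using h hv by blast
    then have 2: "d (j + 1 + 1) = (-1, 0)" using u[of "j + 1 + 1"] dn[of "j + 1 + 1"] by (auto simp: unit_vec_def)
    have "d (j + 1 + 1) = turn (a (j + 1 + 1)) (turn (a (j + 1)) (d j))" using d by metis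
    then have "a (j + 1 + 1) * a (j + 1) = -1" unfolding 1 2 by (simp add: turn_def)
    moreover have "j + 1 + 1 = j + 2" by simp
    ultimately show ?thesis using pm[of "j + 1"] pm[of "j + 2"] by auto
  qed
  obtain e where e: "folds a (Suc 0) e" using fs by (auto simp: fold_seq_def)
  have alt: "a (i + 2) = - a i" if "odd (i - e)" for i
    using e that unfolding folds_def by auto
  have all: "a (i + 2) = - a i" for i
  proof (cases "odd (i - e)")
    case False
    show ?thesis
    proof (cases "snd (d i) = 0")
      case True
      have "snd (d (i - 2)) = 0" using True hv[of "i - 1"] hv[of "i - 2"] by simp
      then have 1: "a i = - a (i - 1)" using hp[of "i - 2"] by simp
      have 2: "a (i + 2) = - a (i + 1)" using hp True by blast
      have "i - 1 + 2 = i + 1" by simp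
      moreover have "odd (i - 1 - e)" using False by simp
      ultimately have "a (i + 1) = - a (i - 1)" using alt[of "i - 1"] by metis
      then show ?thesis using 1 2 by simp
    next
      case v: False
      have "snd (d (i - 1)) = 0" "snd (d (i + 1)) = 0" using v hv[of "i - 1"] hv[of i] by auto
      moreover have "i - 1 + 2 = i + 1" "i - 1 + 1 = i" "i + 1 + 2 = i + 3" "i + 1 + 1 = i + 2" by simp_all
      ultimately have "a (i + 1) = - a i" "a (i + 3) = - a (i + 2)" using hp[of "i - 1"] hp[of "i + 1"] by metis+
      moreover have "a (i + 1 + 2) = - a (i + 1)" by (rule alt) (use False in simp)
      then have "a (i + 3) = - a (i + 1)" using \<open>i + 1 + 2 = i + 3\<close> by (simp only:)
      ultimately show ?thesis by simp
    qed
  qed (rule alt)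
  have "i + 2 + 2 = i + 4" for i :: int by simp
  then have "a (i + 4) = a i" for i using all[of i] all[of "i + 2"] by (metis minus_minus)
  then show False using fold_seq_aperiodic[OF fs, of 4] by simp
qed

inductive chain :: "bool list \<Rightarrow> (int \<Rightarrow> point) \<Rightarrow> (int \<Rightarrow> point) \<Rightarrow> bool" where
  "chain [] y y"
| "refines t \<beta> v y \<Longrightarrow> chain \<beta>s v w \<Longrightarrow> chain (\<beta> # \<beta>s) y w"

text \<open>The certificate tree branches on ever coarser folds, whereas \<open>chain\<close> is
  built up at the finest one.\<close>

lemma chain_snoc: "chain \<beta>s y w \<Longrightarrow> refines t \<beta> w' w \<Longrightarrow> chain (\<beta>s @ [\<beta>]) y w'"
  by (induction rule: chain.induct) (auto intro: chain.intros)

lemma unit_vec_minus_turn: "unit_vec (if c then d else turn (-1) d) \<longleftrightarrow> unit_vec d"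
  by (cases d) (auto simp: unit_vec_def turn_def)

lemma in_tile_unit: "in_tile \<beta>s A d \<Longrightarrow> unit_vec d"
proof (induction \<beta>s arbitrary: A d)
  case Nil
  then show ?case by (simp add: unit_vec_def)
next
  case (Cons \<beta> \<beta>s)
  then show ?case unfolding in_tile.simps Let_def by (metis unit_vec_minus_turn)
qed

text \<open>The halves of an unfolded step \<open>\<delta>\<close> are \<open>\<delta>\<close> and
  \<open>i * \<delta>\<close> in one of the two orders, so a half in direction \<open>d\<close>
  comes from \<open>d\<close> or \<open>- i * d\<close>. The first conclusion treats the first half,
  located by its start, and the second conclusion the second half, located by its end.\<close>

lemma refines_in_tile_step:
  assumes r: "refines t \<beta> v y" and d: "unit_vec d"
    and v: "traverses v (T + Z) \<delta>" and \<delta>: "\<delta> = d \<or> \<delta> = turn (-1) d"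
  shows "\<beta> = (snd d = 0) \<Longrightarrow> dil Z = A \<Longrightarrow> traverses y (t + dil T + A) d"
    and "\<beta> \<noteq> (snd d = 0) \<Longrightarrow> dil (Z + \<delta>) = A + d \<Longrightarrow> traverses y (t + dil T + A) d"
proof -
  note R = refines_traverses[OF r v, unfolded dil_add]
  note sd = snd_turn_unit[OF d, of "-1"]
  assume b: "\<beta> = (snd d = 0)" and Z: "dil Z = A"
  have "bend \<beta> \<delta> = d" using \<delta> b sd turn_turn(1)[of 1 d] by (auto simp: bend_def)
  then show "traverses y (t + dil T + A) d" using R(1) Z by (simp add: add.assoc)
next
  note R = refines_traverses[OF r v, unfolded dil_add]
  note sd = snd_turn_unit[OF d, of "-1"]
  assume b: "\<beta> \<noteq> (snd d = 0)" and Z: "dil (Z + \<delta>) = A + d"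
  have 1: "dil \<delta> - bend \<beta> \<delta> = d"
    using \<delta>
  proof
    assume "\<delta> = d"
    then show ?thesis using b by (auto simp: bend_def dil_def turn_def prod_eq_iff)
  next
    assume *: "\<delta> = turn (-1) d"
    then have "bend \<beta> \<delta> = \<delta>" using b sd by (auto simp: bend_def)
    then show ?thesis unfolding * by (auto simp: dil_def turn_def prod_eq_iff)
  qed
  then have "dil Z + bend \<beta> \<delta> = A" using Z by (simp add: dil_add algebra_simps)
  then show "traverses y (t + dil T + A) d" using R(2) unfolding 1 by (simp add: add.assoc)
qed

lemma in_tile_traverses:
  assumes "chain \<beta>s y w" "traverses w R (1, 0)"
  shows "\<exists>T. \<forall>A d. in_tile \<beta>s A d \<longrightarrow> traverses y (T + A) d"
  using assms
proof (induction rule: chain.induct)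
  case (1 y)
  then show ?case by (intro exI[of _ R]) (auto simp: zero_prod_def[symmetric])
next
  case (2 t \<beta> v y \<beta>s w)
  then obtain T where T: "\<And>A d. in_tile \<beta>s A d \<Longrightarrow> traverses v (T + A) d" by blast
  have "traverses y (t + dil T + A) d" if m: "in_tile (\<beta> # \<beta>s) A d" for A d
  proof -
    have u: "unit_vec d" using m by (rule in_tile_unit)
    show ?thesis
    proof (cases "even (fst A + snd A)")
      case True
      define \<delta> where "\<delta> = (if (snd d = 0) = (even (fst (undil A) + snd (undil A)) =
        (case \<beta>s of [] \<Rightarrow> True | b # _ \<Rightarrow> b)) then d else turn (-1) d)"
      have \<delta>: "\<delta> = d \<or> \<delta> = turn (-1) d" "in_tile \<beta>s (undil A) \<delta>" and b: "\<beta> = (snd d = 0)"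
        using m True unfolding in_tile.simps Let_def \<delta>_def by simp_all
      show ?thesis
        by (rule refines_in_tile_step(1)[OF 2(1) u T[OF \<delta>(2)] \<delta>(1) b]) (rule dil_undil[OF True])
    next
      case False
      define \<delta> where "\<delta> = (if (snd d = 0) = (odd (fst (undil (A + d)) + snd (undil (A + d))) =
        (case \<beta>s of [] \<Rightarrow> True | b # _ \<Rightarrow> b)) then d else turn (-1) d)"
      have \<delta>: "\<delta> = d \<or> \<delta> = turn (-1) d" "in_tile \<beta>s (undil (A + d) - \<delta>) \<delta>" and b: "\<beta> \<noteq> (snd d = 0)"
        using m False unfolding in_tile.simps Let_def \<delta>_def by simp_all
      have "even (fst (A + d) + snd (A + d))" using False u by (auto simp: unit_vec_def)
      then have "dil (undil (A + d) - \<delta> + \<delta>) = A + d" by (simp add: dil_undil)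
      then show ?thesis by (rule refines_in_tile_step(2)[OF 2(1) u T[OF \<delta>(2)] \<delta>(1) b])
    qed
  qed
  then show ?case by blast
qed

lemma block_in_tile_block:
  assumes "chain \<beta>s y w" "traverses w R (1, 0)" "block_in_tile \<beta>s p q"
  shows "block y 3"
proof -
  obtain T where T: "\<And>A d. in_tile \<beta>s A d \<Longrightarrow> traverses y (T + A) d"
    using in_tile_traverses[OF assms(1,2)] by blast
  obtain x z where xz: "T = (x, z)" by fastforce
  have E: "covers y (x + fst A, z + snd A) (x + fst A + fst d, z + snd A + snd d)" if "edge_in_tile \<beta>s A d" for A d
  proof (cases "in_tile \<beta>s A d")
    case True
    from traverses_covers[OF T[OF this]] show ?thesis by (cases A; cases d) (simp add: xz add.assoc)
  next
    case False
    then have "in_tile \<beta>s (A + d) (- d)" using that by (auto simp: edge_in_tile_def split: if_splits)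
    from traverses_covers[OF T[OF this]] show ?thesis
      by (subst covers_commute, cases A; cases d) (simp add: xz add.assoc)
  qed
  have H: "covers y (x + p + j, z + q + i) (x + p + j + 1, z + q + i)" and V: "covers y (x + p + i, z + q + j) (x + p + i, z + q + j + 1)"
    if "i \<in> {0, 1, 2, 3}" "j \<in> {0, 1, 2}" for i j
  proof -
    have "edge_in_tile \<beta>s (p + i, q + j) (0, 1)" "edge_in_tile \<beta>s (p + j, q + i) (1, 0)"
      using assms(3) that unfolding block_in_tile_def list_all_iff list.set by blast+
    from this[THEN E] show "covers y (x + p + j, z + q + i) (x + p + j + 1, z + q + i)" "covers y (x + p + i, z + q + j) (x + p + i, z + q + j + 1)"
      by (simp_all add: add.assoc)
  qed
  have "square y (x + p + i) (z + q + j)" if "0 \<le> i" "i < 3" "0 \<le> j" "j < 3" for i j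
  proof -
    have "i \<in> {0, 1, 2}" "j \<in> {0, 1, 2}" using that by auto
    moreover from this have "i \<in> {0, 1, 2, 3}" "j \<in> {0, 1, 2, 3}" "i + 1 \<in> {0, 1, 2, 3}" "j + 1 \<in> {0, 1, 2, 3}" by auto
    ultimately show ?thesis unfolding square_def using H[of j i] H[of "j + 1" i] V[of i j] V[of "i + 1" j]
      by (simp add: add.assoc)
  qed
  then show ?thesis unfolding block_def by blast
qed

text \<open>The folds of the successive derived paths of \<open>y\<close> select the branch;
  \<open>w\<close> is the derived path at the current node.\<close>

lemma valid_tree_block:
  assumes "valid_tree tr \<beta>s" "chain \<beta>s y w" "lattice_path w a" "fold_seq a"
  shows "block y 3"
  using assms
proof (induction tr arbitrary: \<beta>s w a)
  case (Lf p q)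
  then show ?case using path_direction[of w a] block_in_tile_block by auto
next
  case (Nd l r)
  obtain w' a' t \<beta> where w': "lattice_path w' a'" "fold_seq a'" "refines t \<beta> w' w" using derived_path[OF Nd.prems(3,4)] by blast
  have "chain (\<beta>s @ [\<beta>]) y w'" by (rule chain_snoc[OF Nd.prems(2) w'(3)])
  then show ?case using Nd.IH Nd.prems(1) w'(1,2) by (cases \<beta>) auto
qed

text \<open>The induction ranges over all folding paths because the block to be enlarged lies in the
  second derived path. From side 3 on every round gains at least 1.\<close>

lemma path_covers_block:
  assumes "lattice_path y a" "fold_seq a"
  shows "block y k"
proof -
  have "\<forall>y a. lattice_path y a \<and> fold_seq a \<longrightarrow> block y (3 + int n)" for n
  proof (induction n)
    case 0
    then show ?case using valid_tree_block[OF valid_blocks_tree chain.intros(1)] by auto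
  next
    case (Suc n)
    show ?case
    proof (intro allI impI)
      fix y a assume y: "lattice_path y a \<and> fold_seq a"
      obtain w a1 t \<beta> where w: "lattice_path w a1" "fold_seq a1" "refines t \<beta> w y" using derived_path y by blast
      obtain w' a2 t' \<beta>' where w': "lattice_path w' a2" "fold_seq a2" "refines t' \<beta>' w' w" using derived_path w by blast
      have "block w' (3 + int n)" using Suc w' by blast
      from block_grows[OF w'(1) w(1) w'(3) w(3) this] show "block y (3 + int (Suc n))"
        by (rule block_mono) simp
    qed
  qed
  then have "block y (3 + int (nat k))" using assms by blast
  then show ?thesis by (rule block_mono) simp
qed

section \<open>The covering of a sign field\<close>

lemma is_segment_iff: "is_segment s \<longleftrightarrow> unit_vec (snd s - fst s)"
proof -
  obtain a b c d where s: "s = ((a, b), (c, d))" by (metis prod.collapse)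
  define p q where "p = c - a" and "q = d - b"
  have "is_segment s \<longleftrightarrow> sqrt ((real_of_int (a - c))\<^sup>2 + (real_of_int (b - d))\<^sup>2) = 1"
    by (simp add: is_segment_def real_point_def s dist_Pair_Pair dist_real_def)
  also have "\<dots> \<longleftrightarrow> (real_of_int (a - c))\<^sup>2 + (real_of_int (b - d))\<^sup>2 = 1" by simp
  also have "\<dots> \<longleftrightarrow> real_of_int ((a - c)\<^sup>2 + (b - d)\<^sup>2) = real_of_int 1" by (simp only: of_int_add of_int_power of_int_1)
  also have "\<dots> \<longleftrightarrow> p\<^sup>2 + q\<^sup>2 = 1" by (simp only: of_int_eq_iff p_def q_def power2_commute)
  also have "\<dots> \<longleftrightarrow> unit_vec (p, q)"
  proof
    assume 1: "p\<^sup>2 + q\<^sup>2 = 1"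
    have small: "x \<in> {-1, 0, 1}" if "x\<^sup>2 \<le> 1" for x :: int
      using abs_le_square_iff[of x 1] that by auto
    have "p\<^sup>2 \<le> 1" "q\<^sup>2 \<le> 1" using 1 zero_le_power2[of p] zero_le_power2[of q] by linarith+
    then have "p \<in> {-1, 0, 1}" "q \<in> {-1, 0, 1}" using small by blast+
    then show "unit_vec (p, q)" using 1 by (auto simp: unit_vec_def)
  qed (auto simp: unit_vec_def)
  finally show ?thesis by (simp add: s p_def q_def)
qed

lemma unit_vec_perpendicular:
  assumes "unit_vec d" "unit_vec d'"
  shows "fst d * fst d' + snd d * snd d' = 0 \<longleftrightarrow> d' = turn 1 d \<or> d' = turn (-1) d"
    and "d' = turn s d \<Longrightarrow> fst d * snd d' - snd d * fst d' = s"
proof -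
  show "fst d * fst d' + snd d * snd d' = 0 \<longleftrightarrow> d' = turn 1 d \<or> d' = turn (-1) d"
    using assms unfolding unit_vec_def insert_iff empty_iff by (elim disjE FalseE) (simp_all add: turn_def)
  assume "d' = turn s d"
  then show "fst d * snd d' - snd d * fst d' = s"
    using assms(1) unfolding unit_vec_def insert_iff empty_iff by (elim disjE FalseE) (simp_all add: turn_def)
qed

lemma complete_folding_curve_path:
  assumes "complete_folding_curve C"
  shows "lattice_path (\<lambda>i. snd (C i)) (turns C)" and "fold_seq (turns C)"
    and "C i = (snd (C (i - 1)), snd (C i))"
proof -
  have C: "\<And>i. unit_vec (snd (C i) - fst (C i))" "\<And>i. snd (C i) = fst (C (i + 1))" "\<And>i. perpendicular (C i) (C (i + 1))"
    using assms unfolding complete_folding_curve_def complete_curve_def is_segment_iff by blast+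
  show fs: "fold_seq (turns C)" using assms by (simp add: complete_folding_curve_def complete_folding_seq_iff)
  have f: "fst (C i) = snd (C (i - 1))" for i using C(2)[of "i - 1"] by simp
  show "C i = (snd (C (i - 1)), snd (C i))" using f by (metis prod.collapse)
  have 1: "direction (C i) = snd (C i) - snd (C (i - 1))" for i by (simp add: direction_def f)
  have u: "unit_vec (direction (C i))" for i using C(1) by (simp add: direction_def)
  have "direction (C (i + 1)) = turn (turns C i) (direction (C i))" for i
  proof -
    obtain s where s: "s \<in> {1, -1}" "direction (C (i + 1)) = turn s (direction (C i))"
      using unit_vec_perpendicular(1)[OF u[of i] u[of "i + 1"]] C(3)[of i] unfolding perpendicular_def by blast
    moreover have "turns C i = s" using unit_vec_perpendicular(2)[OF u[of i] u[of "i + 1"] s(2)] by (simp add: turns_def)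
    ultimately show ?thesis by simp
  qed
  then have "snd (C (i + 1)) - snd (C i) = turn (turns C i) (snd (C i) - snd (C (i - 1)))" for i
    unfolding 1 by simp
  moreover have "unit_vec (snd (C (i + 1)) - snd (C i))" for i using u[of "i + 1"] unfolding 1 by simp
  ultimately show "lattice_path (\<lambda>i. snd (C i)) (turns C)" using fs unfolding lattice_path_def fold_seq_def by blast
qed

definition signs :: "(point \<Rightarrow> int) \<Rightarrow> bool" where
  "signs \<sigma> \<longleftrightarrow> (\<forall>x. \<sigma> x \<in> {1, -1})"

lemma signsD: "signs \<sigma> \<Longrightarrow> \<sigma> x \<in> {1, -1}"
  unfolding signs_def by blast

lemma field_signs: "sign_field \<sigma> c \<Longrightarrow> signs \<sigma>"
  by (simp add: signs_def sign_field_def)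

section \<open>Orbits of the turning rule\<close>

definition nxt :: "(point \<Rightarrow> int) \<Rightarrow> segment \<Rightarrow> segment" where
  "nxt \<sigma> s = (snd s, snd s + turn (\<sigma> (snd s)) (snd s - fst s))"

definition prv :: "(point \<Rightarrow> int) \<Rightarrow> segment \<Rightarrow> segment" where
  "prv \<sigma> s = (fst s - turn (- \<sigma> (fst s)) (snd s - fst s), fst s)"

text \<open>Every edge has exactly one orientation of type \<open>t\<close>, so a sign and a type
  together determine a covering.\<close>

definition typed_segment :: "bool \<Rightarrow> segment \<Rightarrow> bool" where
  "typed_segment t s \<longleftrightarrow> unit_vec (snd s - fst s) \<and> seg_type s = t"

definition follows :: "(point \<Rightarrow> int) \<Rightarrow> (int \<Rightarrow> segment) \<Rightarrow> bool" where
  "follows \<sigma> D \<longleftrightarrow> (\<forall>i. D (i + 1) = nxt \<sigma> (D i))"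

definition field_covering :: "(point \<Rightarrow> int) \<Rightarrow> bool \<Rightarrow> curve set" where
  "field_covering \<sigma> t = {curve_class D | D. follows \<sigma> D \<and> typed_segment t (D 0)}"

lemma nxt_prv: "signs \<sigma> \<Longrightarrow> nxt \<sigma> (prv \<sigma> s) = s"
  and prv_nxt: "signs \<sigma> \<Longrightarrow> prv \<sigma> (nxt \<sigma> s) = s"
  by (simp_all add: nxt_def prv_def turn_turn signsD del: insert_iff)

lemma typed_nxt:
  assumes "signs \<sigma>" "typed_segment t s"
  shows "typed_segment t (nxt \<sigma> s)"
proof -
  obtain X d where s: "s = (X, X + d)" by (metis add.commute diff_add_cancel prod.collapse)
  have "unit_vec d" using assms(2) by (simp add: s typed_segment_def)
  moreover have "\<sigma> X = 1 \<or> \<sigma> X = -1" "\<sigma> (X + d) = 1 \<or> \<sigma> (X + d) = -1" using signsD[OF assms(1), of X] signsD[OF assms(1), of "X + d"] by simp_all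
  ultimately show ?thesis using assms(2) unfolding unit_vec_def insert_iff empty_iff s
    by (elim disjE FalseE; auto simp: typed_segment_def nxt_def unit_vec_def turn_def seg_type_def)
qed

lemma typed_prv:
  assumes "signs \<sigma>" "typed_segment t s"
  shows "typed_segment t (prv \<sigma> s)"
proof -
  obtain X d where s: "s = (X, X + d)" by (metis add.commute diff_add_cancel prod.collapse)
  have "unit_vec d" using assms(2) by (simp add: s typed_segment_def)
  moreover have "\<sigma> X = 1 \<or> \<sigma> X = -1" "\<sigma> (X + d) = 1 \<or> \<sigma> (X + d) = -1" using signsD[OF assms(1), of X] signsD[OF assms(1), of "X + d"] by simp_all
  ultimately show ?thesis using assms(2) unfolding unit_vec_def insert_iff empty_iff s
    by (elim disjE FalseE; auto simp: typed_segment_def prv_def unit_vec_def turn_def seg_type_def)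
qed

lemma curve_class_refl: "D \<in> curve_class D"
  unfolding curve_class_def by (auto intro: exI[of _ 0])

lemma curve_class_eq:
  assumes "\<And>k. D' (j + k) = D (i + k)"
  shows "curve_class D' = curve_class D"
proof -
  have e: "D' k = D (k + (i - j))" "D k = D' (k + (j - i))" for k
    using assms[of "k - j"] assms[of "k - i"] by (simp_all add: algebra_simps)
  have "E \<in> curve_class D" if E: "E \<in> curve_class D'" for E
  proof -
    obtain k where "\<forall>l. E l = D' (l + k)" using E unfolding curve_class_def by blast
    then have "\<forall>l. E l = D (l + (k + (i - j)))" by (simp add: e(1) add.assoc)
    then show ?thesis unfolding curve_class_def by blast
  qed
  moreover have "E \<in> curve_class D'" if E: "E \<in> curve_class D" for E
  proof -
    obtain k where "\<forall>l. E l = D (l + k)" using E unfolding curve_class_def by blast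
    then have "\<forall>l. E l = D' (l + (k + (j - i)))" by (simp add: e(2) add.assoc)
    then show ?thesis unfolding curve_class_def by blast
  qed
  ultimately show ?thesis by blast
qed

lemma curve_class_member:
  assumes "D' \<in> curve_class D" shows "curve_class D' = curve_class D"
proof -
  obtain k where "\<forall>i. D' i = D (i + k)" using assms by (auto simp: curve_class_def)
  then show ?thesis by (intro curve_class_eq[of D' 0 D k]) (simp add: add.commute)
qed

lemma follows_unique:
  assumes \<sigma>: "signs \<sigma>" and "follows \<sigma> D" "follows \<sigma> D'" "D' j = D i"
  shows "D' (j + k) = D (i + k)"
proof (induction k rule: int_induct[where k = 0])
  case (step1 k)
  then show ?case using assms(2,3) unfolding follows_def by (metis add.assoc)
next
  case (step2 k)
  have "nxt \<sigma> (D' (j + (k - 1))) = D' (j + k)" "nxt \<sigma> (D (i + (k - 1))) = D (i + k)"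
    using assms(2,3) unfolding follows_def by (metis add.assoc diff_add_cancel)+
  then show ?case using prv_nxt[OF \<sigma>, of "D' (j + (k - 1))"] prv_nxt[OF \<sigma>, of "D (i + (k - 1))"] step2(2) by simp
qed (use assms in simp)

lemma follows_class:
  assumes "signs \<sigma>" "follows \<sigma> D" "follows \<sigma> D'" "D' j = D i"
  shows "curve_class D' = curve_class D"
  using follows_unique[OF assms] by (rule curve_class_eq)

lemma follows_exists:
  assumes \<sigma>: "signs \<sigma>"
  shows "\<exists>D. follows \<sigma> D \<and> D 0 = s"
proof -
  define D where "D i = (if 0 \<le> i then (nxt \<sigma> ^^ nat i) s else (prv \<sigma> ^^ nat (- i)) s)" for i
  have "D (i + 1) = nxt \<sigma> (D i)" for i
  proof (cases "0 \<le> i")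
    case True
    then show ?thesis by (simp add: D_def nat_add_distrib)
  next
    case False
    then have *: "nat (- i) = Suc (nat (- (i + 1)))" by simp
    have "D i = prv \<sigma> (D (i + 1))"
    proof (cases "i = -1")
      case False
      then show ?thesis using \<open>\<not> 0 \<le> i\<close> by (simp add: D_def *)
    qed (simp add: D_def)
    then show ?thesis using nxt_prv[OF \<sigma>, of "D (i + 1)"] by simp
  qed
  then show ?thesis by (intro exI[of _ D]) (simp add: follows_def D_def)
qed

lemma follows_typed:
  assumes \<sigma>: "signs \<sigma>" and f: "follows \<sigma> D" and t: "typed_segment t (D j)"
  shows "typed_segment t (D i)"
proof -
  have "typed_segment t (D (j + k))" for k
  proof (induction k rule: int_induct[where k = 0])
    case (step1 k)
    have "D (j + (k + 1)) = nxt \<sigma> (D (j + k))" using f unfolding follows_def by (metis add.assoc)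
    then show ?case using typed_nxt[OF \<sigma> step1(2)] by simp
  next
    case (step2 k)
    have "D (j + k) = nxt \<sigma> (D (j + (k - 1)))" using f unfolding follows_def by (metis add.assoc diff_add_cancel)
    then have "D (j + (k - 1)) = prv \<sigma> (D (j + k))" using prv_nxt[OF \<sigma>, of "D (j + (k - 1))"] by simp
    then show ?case using typed_prv[OF \<sigma> step2(2)] by simp
  qed (use t in simp)
  from this[of "i - j"] show ?thesis by simp
qed

lemma follows_path:
  assumes \<sigma>: "signs \<sigma>" and f: "follows \<sigma> D" and t: "typed_segment t (D j)"
  shows "lattice_path (\<lambda>i. snd (D i)) (\<lambda>i. \<sigma> (snd (D i)))" and "turns D i = \<sigma> (snd (D i))"
    and "fst (D (i + 1)) = snd (D i)" and "perpendicular (D i) (D (i + 1))"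
proof -
  have n: "D (i + 1) = nxt \<sigma> (D i)" for i using f by (simp add: follows_def)
  have u: "unit_vec (snd (D i) - fst (D i))" for i using follows_typed[OF assms] by (simp add: typed_segment_def)
  show fs: "fst (D (i + 1)) = snd (D i)" for i by (simp add: n nxt_def)
  have st: "snd (D (i + 1)) - fst (D (i + 1)) = turn (\<sigma> (snd (D i))) (snd (D i) - fst (D i))" for i
    by (simp add: n nxt_def)
  have f': "fst (D i) = snd (D (i - 1))" for i using fs[of "i - 1"] by simp
  have "snd (D (i + 1)) - snd (D i) = turn (\<sigma> (snd (D i))) (snd (D i) - snd (D (i - 1)))" for i
    using st[of i] by (simp add: f')
  moreover have "unit_vec (snd (D (i + 1)) - snd (D i))" for i using u[of "i + 1"] by (simp add: f')
  ultimately show "lattice_path (\<lambda>i. snd (D i)) (\<lambda>i. \<sigma> (snd (D i)))" unfolding lattice_path_def using \<sigma>[unfolded signs_def] by blast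
  show "turns D i = \<sigma> (snd (D i))"
    using unit_vec_perpendicular(2)[OF u[of i] u[of "i + 1"] st] by (simp add: turns_def direction_def)
  show "perpendicular (D i) (D (i + 1))"
    using unit_vec_perpendicular(1)[OF u[of i] u[of "i + 1"]] st[of i] \<sigma>[unfolded signs_def, rule_format, of "snd (D i)"]
    unfolding perpendicular_def direction_def by auto
qed

text \<open>Reversing a segment changes the parity of its initial point but not whether it is
  horizontal, so its type changes.\<close>

lemma typed_support_unique:
  assumes "typed_segment t s" "typed_segment t s'" "support s = support s'"
  shows "s = s'"
proof -
  obtain X d where s: "s = (X, X + d)" by (metis add.commute diff_add_cancel prod.collapse)
  have d: "unit_vec d" using assms(1) by (simp add: s typed_segment_def)
  have "s' = s \<or> s' = (X + d, X)"
    using assms(3) by (cases s') (auto simp: support_def s doubleton_eq_iff)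
  moreover have "s' \<noteq> (X + d, X)"
  proof
    assume "s' = (X + d, X)"
    then show False using assms(1,2) d unfolding unit_vec_def insert_iff empty_iff s
      by (elim disjE FalseE; auto simp: typed_segment_def seg_type_def)
  qed
  ultimately show ?thesis by blast
qed

lemma lattice_edges_iff: "e \<in> lattice_edges \<longleftrightarrow> (\<exists>s. unit_vec (snd s - fst s) \<and> support s = e)"
proof
  assume "e \<in> lattice_edges"
  then obtain x y where "e = {(x, y), (x + 1, y)} \<or> e = {(x, y), (x, y + 1)}" by (auto simp: lattice_edges_def)
  then have "support ((x, y), (x + 1, y)) = e \<or> support ((x, y), (x, y + 1)) = e" by (auto simp: support_def)
  moreover have "unit_vec (snd ((x, y), (x + 1, y)) - fst ((x, y), (x + 1, y)))" "unit_vec (snd ((x, y), (x, y + 1)) - fst ((x, y), (x, y + 1)))"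
    by (auto simp: unit_vec_def)
  ultimately show "\<exists>s. unit_vec (snd s - fst s) \<and> support s = e" by blast
next
  assume "\<exists>s. unit_vec (snd s - fst s) \<and> support s = e"
  then obtain a b c d where "unit_vec (c - a, d - b)" "e = {(a, b), (c, d)}" by (auto simp: support_def)
  then consider "e = {(a, b), (a + 1, b)}" | "e = {(c, b), (c + 1, b)}" | "e = {(a, b), (a, b + 1)}" | "e = {(a, d), (a, d + 1)}"
    by (auto simp: unit_vec_def algebra_simps doubleton_eq_iff)
  then show "e \<in> lattice_edges" unfolding lattice_edges_def by cases blast+
qed

lemma typed_segment_exists:
  assumes "unit_vec (snd s - fst s)"
  shows "typed_segment t s \<or> typed_segment t (snd s, fst s)"
proof -
  obtain X d where s: "s = (X, X + d)" by (metis add.commute diff_add_cancel prod.collapse)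
  have "unit_vec d" using assms by (simp add: s)
  then show ?thesis unfolding unit_vec_def insert_iff empty_iff s
    by (elim disjE FalseE; auto simp: typed_segment_def unit_vec_def seg_type_def)
qed

lemma lattice_edge_typed:
  assumes "e \<in> lattice_edges" shows "\<exists>s. typed_segment t s \<and> support s = e"
proof -
  obtain s where "unit_vec (snd s - fst s)" "support s = e" using assms lattice_edges_iff by blast
  then show ?thesis using typed_segment_exists[of s t] unfolding support_def by (metis fst_conv snd_conv insert_commute)
qed

lemma field_covering_member:
  assumes \<sigma>: "signs \<sigma>" and "\<gamma> \<in> field_covering \<sigma> t" "D \<in> \<gamma>"
  shows "follows \<sigma> D" "typed_segment t (D i)" "\<gamma> = curve_class D"
proof -
  obtain E where E: "follows \<sigma> E" "typed_segment t (E 0)" "\<gamma> = curve_class E"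
    using assms(2) by (auto simp: field_covering_def)
  obtain k where k: "\<forall>i. D i = E (i + k)" using assms(3) E(3) by (auto simp: curve_class_def)
  show "follows \<sigma> D" unfolding follows_def using E(1) k unfolding follows_def by (metis add.assoc add.commute)
  show "typed_segment t (D i)" using follows_typed[OF \<sigma> E(1,2)] k by simp
  show "\<gamma> = curve_class D" using curve_class_member assms(3) E(3) by metis
qed

lemma field_covering_follows:
  assumes \<sigma>: "signs \<sigma>" and "typed_segment t s"
  obtains D where "curve_class D \<in> field_covering \<sigma> t" "D 0 = s" "follows \<sigma> D"
proof -
  obtain D where D: "follows \<sigma> D" "D 0 = s" using follows_exists[OF \<sigma>, of s] by blast
  then have "curve_class D \<in> field_covering \<sigma> t" using assms(2) unfolding field_covering_def by blast
  then show thesis using that D by blast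
qed

text \<open>A repeated edge would be a repeated segment because of its type, and the turning rule
  would make the sequence of turns periodic, which no folding sequence is.\<close>

lemma follows_complete_folding_curve:
  assumes F: "sign_field \<sigma> c" and f: "follows \<sigma> D" and t: "typed_segment t (D j)"
  shows "complete_folding_curve D"
proof -
  have \<sigma>: "signs \<sigma>" using F by (rule field_signs)
  note P = follows_path[OF \<sigma> f t]
  have fs: "fold_seq (\<lambda>i. \<sigma> (snd (D i)))" using field_path_fold_seq[OF F P(1)] .
  have ty: "typed_segment t (D i)" for i by (rule follows_typed[OF \<sigma> f t])
  have "inj (\<lambda>i. support (D i))"
  proof
    fix i k assume "support (D i) = support (D k)"
    then have "D k = D i" using typed_support_unique ty by metis
    then have "D (k + l) = D (i + l)" for l using follows_unique[OF \<sigma> f f] by blast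
    then have "D (l + (k - i)) = D l" for l by (metis add.commute add_diff_eq diff_add_cancel)
    then have "\<sigma> (snd (D (l + (k - i)))) = \<sigma> (snd (D l))" for l by simp
    from fold_seq_aperiodic[OF fs this] show "i = k" by simp
  qed
  moreover have "turns D = (\<lambda>i. \<sigma> (snd (D i)))" using P(2) by blast
  ultimately show ?thesis
    unfolding complete_folding_curve_def complete_curve_def complete_folding_seq_iff is_segment_iff
    using fs P(3,4) ty by (simp add: typed_segment_def)
qed

lemma folding_covering_field_covering:
  assumes F: "sign_field \<sigma> c"
  shows "folding_covering (field_covering \<sigma> t)"
  unfolding folding_covering_def
proof (intro conjI ballI)
  fix \<gamma> assume "\<gamma> \<in> field_covering \<sigma> t"
  then show "\<exists>C. complete_folding_curve C \<and> \<gamma> = curve_class C"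
    using follows_complete_folding_curve[OF F] unfolding field_covering_def by blast
next
  have \<sigma>: "signs \<sigma>" using F by (rule field_signs)
  fix e assume "e \<in> lattice_edges"
  then obtain s where s: "typed_segment t s" "support s = e" using lattice_edge_typed by blast
  obtain D where D: "curve_class D \<in> field_covering \<sigma> t" "D 0 = s" "follows \<sigma> D"
    using field_covering_follows[OF \<sigma> s(1)] .
  show "\<exists>!p. p \<in> (SIGMA \<gamma>:field_covering \<sigma> t. curve_segments \<gamma>) \<and> support (snd p) = e"
  proof (rule ex1I[of _ "(curve_class D, s)"])
    show "(curve_class D, s) \<in> (SIGMA \<gamma>:field_covering \<sigma> t. curve_segments \<gamma>) \<and> support (snd (curve_class D, s)) = e"
      using D s curve_class_refl unfolding curve_segments_def by force
    fix p assume p: "p \<in> (SIGMA \<gamma>:field_covering \<sigma> t. curve_segments \<gamma>) \<and> support (snd p) = e"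
    then obtain E i where E: "fst p \<in> field_covering \<sigma> t" "E \<in> fst p" "snd p = E i"
      unfolding curve_segments_def by auto
    note M = field_covering_member[OF \<sigma> E(1,2)]
    have "snd p = s" using typed_support_unique[OF _ s(1)] M(2)[of i] p E(3) s(2) by metis
    moreover from this have "curve_class E = curve_class D" using follows_class[OF \<sigma> D(3) M(1), of i 0] E(3) D(2) by simp
    ultimately show "p = (curve_class D, s)" using M(3) by (metis prod.collapse)
  qed
qed

text \<open>A decoration depends only on the signs at the two endpoints of its segment. The local
  isomorphism property thus reduces to even translations that preserve the sign on a finite set of
  points.\<close>

lemma decorated_field_covering:
  assumes \<sigma>: "signs \<sigma>"
  shows "decorated_segments (field_covering \<sigma> t) =
    {(support (prv \<sigma> s), s, support (nxt \<sigma> s)) | s. typed_segment t s}"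
proof (intro set_eqI iffI)
  fix d assume "d \<in> decorated_segments (field_covering \<sigma> t)"
  then obtain \<gamma> D i where D: "\<gamma> \<in> field_covering \<sigma> t" "D \<in> \<gamma>" "d = (support (D (i - 1)), D i, support (D (i + 1)))"
    unfolding decorated_segments_def by blast
  note M = field_covering_member[OF \<sigma> D(1,2)]
  have "D (i + 1) = nxt \<sigma> (D i)" "D (i - 1 + 1) = nxt \<sigma> (D (i - 1))" using M(1) unfolding follows_def by blast+
  then have "D (i + 1) = nxt \<sigma> (D i)" "D (i - 1) = prv \<sigma> (D i)" using prv_nxt[OF \<sigma>, of "D (i - 1)"] by auto
  then show "d \<in> {(support (prv \<sigma> s), s, support (nxt \<sigma> s)) | s. typed_segment t s}" using D(3) M(2)[of i] unfolding mem_Collect_eq by (intro exI[of _ "D i"]) simp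
next
  fix d assume "d \<in> {(support (prv \<sigma> s), s, support (nxt \<sigma> s)) | s. typed_segment t s}"
  then obtain s where s: "typed_segment t s" "d = (support (prv \<sigma> s), s, support (nxt \<sigma> s))" by blast
  obtain D where D: "curve_class D \<in> field_covering \<sigma> t" "D 0 = s" "follows \<sigma> D"
    using field_covering_follows[OF \<sigma> s(1)] .
  have "D (0 + 1) = nxt \<sigma> (D 0)" "D (0 - 1 + 1) = nxt \<sigma> (D (0 - 1))" using D(3) unfolding follows_def by blast+
  then have "D (0 + 1) = nxt \<sigma> s" "D (0 - 1) = prv \<sigma> s" using prv_nxt[OF \<sigma>, of "D (0 - 1)"] D(2) by auto
  then have "d = (support (D (0 - 1)), D 0, support (D (0 + 1)))" using s(2) D(2) by simp
  then show "d \<in> decorated_segments (field_covering \<sigma> t)" unfolding decorated_segments_def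
    using D(1) curve_class_refl by blast
qed

lemma covering_segments_field_covering:
  assumes \<sigma>: "signs \<sigma>"
  shows "covering_segments (field_covering \<sigma> t) = {s. typed_segment t s}"
proof (intro set_eqI iffI)
  fix s assume "s \<in> covering_segments (field_covering \<sigma> t)"
  then show "s \<in> {s. typed_segment t s}"
    unfolding covering_segments_def curve_segments_def using field_covering_member(2)[OF \<sigma>] by blast
next
  fix s assume "s \<in> {s. typed_segment t s}"
  then have "typed_segment t s" by simp
  then obtain D where D: "curve_class D \<in> field_covering \<sigma> t" "D 0 = s" "follows \<sigma> D"
    using field_covering_follows[OF \<sigma>] by blast
  then show "s \<in> covering_segments (field_covering \<sigma> t)"
    unfolding covering_segments_def curve_segments_def using curve_class_refl by blast
qed

lemma connections_field_covering:
  assumes \<sigma>: "signs \<sigma>"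
  shows "connections (field_covering \<sigma> t) = {(s, nxt \<sigma> s) | s. typed_segment t s}"
proof (intro set_eqI iffI)
  fix p assume "p \<in> connections (field_covering \<sigma> t)"
  then obtain \<gamma> D i where D: "\<gamma> \<in> field_covering \<sigma> t" "D \<in> \<gamma>" "p = (D i, D (i + 1))"
    unfolding connections_def by blast
  note M = field_covering_member[OF \<sigma> D(1,2)]
  have "D (i + 1) = nxt \<sigma> (D i)" using M(1) unfolding follows_def by blast
  then show "p \<in> {(s, nxt \<sigma> s) | s. typed_segment t s}" using D(3) M(2)[of i] unfolding mem_Collect_eq by (intro exI[of _ "D i"]) simp
next
  fix p assume "p \<in> {(s, nxt \<sigma> s) | s. typed_segment t s}"
  then obtain s where s: "typed_segment t s" "p = (s, nxt \<sigma> s)" by blast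
  obtain D where D: "curve_class D \<in> field_covering \<sigma> t" "D 0 = s" "follows \<sigma> D"
    using field_covering_follows[OF \<sigma> s(1)] .
  have "D (0 + 1) = nxt \<sigma> (D 0)" using D(3) unfolding follows_def by blast
  then have "p = (D 0, D (0 + 1))" using s(2) D(2) by simp
  then show "p \<in> connections (field_covering \<sigma> t)" unfolding connections_def
    using D(1) curve_class_refl by blast
qed

section \<open>Local isomorphism property\<close>

lemma shell_nonempty: "\<exists>w. w \<in> shell n"
proof (induction n)
  case 0
  show ?case using unit_vec_shell[of "(1, 0)"] by (auto simp: unit_vec_def)
next
  case (Suc n)
  then show ?case using shell_add_turn[of _ n 1] by blast
qed

definition limit_points :: "(nat \<Rightarrow> point) \<Rightarrow> point set" where
  "limit_points c = {x. \<forall>n. x - c n \<in> Lambda n}"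

lemma limit_points_unique:
  assumes "x \<in> limit_points c" "y \<in> limit_points c" shows "x = y"
proof -
  have "x - y \<in> Lambda n" for n
    using Lambda_diff[of "x - c n" n "y - c n"] assms by (simp add: limit_points_def)
  then show ?thesis using Lambda_Inter[of "x - y"] by simp
qed

text \<open>The level \<open>n\<close> of \<open>x\<close> is below \<open>N\<close>, so
  \<open>Lambda (Suc N)\<close> is contained in \<open>Lambda (Suc (Suc n))\<close>, where the flip
  rule gives no flip.\<close>

lemma field_invariant:
  assumes F: "sign_field \<sigma> c" and x: "x - c N \<notin> Lambda N" and u: "u \<in> Lambda (Suc N)"
  shows "\<sigma> (x + u) = \<sigma> x"
proof -
  obtain n where n: "n < N" "x - c n \<in> Lambda n" "x - c (Suc n) \<notin> Lambda (Suc n)" using level_exists[of x c N] x by blast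
  have "u \<in> Lambda (Suc n)" "u \<in> Lambda (Suc (Suc n))"
    using u n(1) Lambda_mono[of "Suc n" "Suc N"] Lambda_mono[of "Suc (Suc n)" "Suc N"] by auto
  then show ?thesis using field_flip[OF F n(2,3)] by simp
qed

lemma finite_level_bound:
  assumes F: "sign_field \<sigma> c" and V: "finite V"
  shows "\<exists>N. \<forall>x\<in>V. x \<notin> limit_points c \<longrightarrow> x - c N \<notin> Lambda N"
  using V
proof (induction V)
  case empty
  then show ?case by blast
next
  case (insert x V)
  then obtain N where N: "\<forall>x\<in>V. x \<notin> limit_points c \<longrightarrow> x - c N \<notin> Lambda N" by blast
  obtain M where M: "x \<notin> limit_points c \<longrightarrow> x - c M \<notin> Lambda M" unfolding limit_points_def by blast
  have mono: "z - c (max M N) \<notin> Lambda (max M N)" if "z - c k \<notin> Lambda k" "k \<le> max M N" for z k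
    using that nested_Lambda[of c k "max M N" z, OF field_nested[OF F]] by blast
  show ?case using N M mono[of _ M] mono[of _ N] by (intro exI[of _ "max M N"]) auto
qed

text \<open>The limit point has no level. It is moved to a point of high exact level
  \<open>m\<close> with the same sign, which exists because both signs occur at each level; the
  other points of \<open>V\<close> have smaller levels and keep their signs. \<open>v\<close> lies
  in \<open>Lambda 1\<close> so that segment types survive.\<close>

lemma field_translation:
  assumes F: "sign_field \<sigma> c" and V: "finite V"
  shows "\<exists>v N. v \<in> Lambda 1 \<and> 0 < N \<and> (\<forall>u\<in>Lambda N. \<forall>x\<in>V. \<sigma> (x + (v + u)) = \<sigma> x)"
proof -
  obtain N where N: "\<And>x. x \<in> V \<Longrightarrow> x \<notin> limit_points c \<Longrightarrow> x - c N \<notin> Lambda N"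
    using finite_level_bound[OF F V] by blast
  show ?thesis
  proof (cases "\<exists>P. P \<in> limit_points c")
    case False
    then have "\<sigma> (x + (0 + u)) = \<sigma> x" if "u \<in> Lambda (Suc N)" "x \<in> V" for u x
    proof -
      have "x \<notin> limit_points c" using False by blast
      from field_invariant[OF F N[OF that(2) this] that(1)] show ?thesis by simp
    qed
    then show ?thesis using Lambda_zero by blast
  next
    case True
    then obtain P where P: "P \<in> limit_points c" by blast
    define m where "m = Suc N"
    obtain w w' where w: "w \<in> shell m" "w' \<in> shell (Suc m)" using shell_nonempty by blast
    have wl: "w \<in> Lambda m" "w \<notin> Lambda (Suc m)" "w' \<in> Lambda (Suc m)" "w' \<notin> Lambda (Suc (Suc m))" "w' \<in> Lambda m"
      using w Lambda_Suc_subset by (auto simp: shell_def)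
    have lev: "P + v - c m \<in> Lambda m \<and> P + v - c (Suc m) \<notin> Lambda (Suc m)" if v: "v \<in> Lambda m" "v \<notin> Lambda (Suc m)" for v
    proof -
      have pl: "P - c m \<in> Lambda m" "P - c (Suc m) \<in> Lambda (Suc m)" using P by (auto simp: limit_points_def)
      have e: "(P - c m) + v = P + v - c m" "(P + v - c (Suc m)) - (P - c (Suc m)) = v" by simp_all
      show ?thesis using Lambda_add[OF pl(1) v(1), unfolded e] Lambda_diff[OF _ pl(2), of "P + v - c (Suc m)", unfolded e] v(2) by blast
    qed
    have w2: "w + w' \<in> Lambda m" "w + w' \<notin> Lambda (Suc m)"
      using wl Lambda_add[of w m w'] Lambda_diff[of "w + w'" "Suc m" w'] by auto
    \<comment> \<open>\<open>w'\<close> has exact level \<open>Suc m\<close> and therefore flips the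
      sign at \<open>P + w\<close>; hence \<open>w\<close> or \<open>w + w'\<close> can serve as
      \<open>v\<close>.\<close>
    have "\<sigma> (P + w + w') = - \<sigma> (P + w)"
      using field_flip[OF F, of "P + w" m w'] lev[OF wl(1,2)] wl by simp
    then have "\<sigma> (P + w) = \<sigma> P \<or> \<sigma> (P + (w + w')) = \<sigma> P"
      using field_sign[OF F, of P] field_sign[OF F, of "P + w"] by (auto simp: add.assoc)
    then obtain v where v: "v \<in> Lambda m" "v \<notin> Lambda (Suc m)" "\<sigma> (P + v) = \<sigma> P" using wl w2 by blast
    have "\<sigma> (x + (v + u)) = \<sigma> x" if u: "u \<in> Lambda (Suc (Suc m))" and x: "x \<in> V" for u x
    proof (cases "x = P")
      case True
      have "u \<in> Lambda (Suc m)" using u Lambda_Suc_subset by blast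
      then have "\<sigma> (P + v + u) = \<sigma> (P + v)" using field_flip[OF F, of "P + v" m u] lev[OF v(1,2)] u by simp
      then show ?thesis using True v(3) by (simp add: add.assoc)
    next
      case False
      then have "x \<notin> limit_points c" using P limit_points_unique by blast
      moreover have "u \<in> Lambda m" using u Lambda_Suc_subset by blast
      ultimately show ?thesis using field_invariant[OF F N[OF x]] Lambda_add[OF v(1)] unfolding m_def by blast
    qed
    moreover have "v \<in> Lambda 1" using v(1) Lambda_mono[of 1 m] by (auto simp: m_def)
    ultimately show ?thesis by blast
  qed
qed

lemma real_point_add: "real_point (x + y) = real_point x + real_point y"
  by (simp add: real_point_def)

text \<open>\<open>Lambda N\<close> contains \<open>2 ^ N\<close> times the integer lattice, to
  which every point of the plane can be rounded.\<close>

lemma Lambda_dense: "\<exists>R. \<forall>p. \<exists>u\<in>Lambda N. dist p (real_point u) \<le> R"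
proof -
  define q :: real where "q = 2 ^ N"
  have q: "0 < q" by (simp add: q_def)
  have "\<exists>u\<in>Lambda N. dist p (real_point u) \<le> 2 * q" for p
  proof -
    define k l where "k = \<lfloor>fst p / q\<rfloor>" and "l = \<lfloor>snd p / q\<rfloor>"
    define u :: point where "u = (k * 2 ^ N, l * 2 ^ N)"
    have "u \<in> Lambda (2 * N)" by (auto simp: Lambda_def Let_def u_def)
    then have uN: "u \<in> Lambda N" using Lambda_mono[of N "2 * N"] by auto
    have close: "\<bar>x - of_int \<lfloor>x / q\<rfloor> * q\<bar> \<le> q" for x :: real
    proof -
      have "of_int \<lfloor>x / q\<rfloor> * q \<le> x" "x < (of_int \<lfloor>x / q\<rfloor> + 1) * q"
        using q floor_divide_lower[of q x] floor_divide_upper[of q x] by auto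
      then show ?thesis by (simp add: algebra_simps)
    qed
    have "dist p (real_point u) \<le> dist (fst p) (fst (real_point u)) + dist (snd p) (snd (real_point u))"
      unfolding dist_prod_def by (rule sqrt_sum_squares_le_sum) auto
    also have "\<dots> \<le> q + q" using close[of "fst p"] close[of "snd p"]
      by (intro add_mono) (simp_all add: real_point_def u_def k_def l_def dist_real_def q_def)
    finally show ?thesis using uN by auto
  qed
  then show ?thesis by blast
qed

lemma translate_decorated:
  assumes "\<sigma> (v + fst s) = \<sigma> (fst s)" "\<sigma> (v + snd s) = \<sigma> (snd s)"
  shows "translate v (support (prv \<sigma> s), s, support (nxt \<sigma> s)) =
    (support (prv \<sigma> (v + fst s, v + snd s)), (v + fst s, v + snd s), support (nxt \<sigma> (v + fst s, v + snd s)))"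
  using assms by (cases s) (simp add: support_def nxt_def prv_def algebra_simps)

lemma typed_translate:
  assumes "v \<in> Lambda 1" shows "typed_segment t (v + fst s, v + snd s) \<longleftrightarrow> typed_segment t s"
proof -
  have "even (fst v + snd v)" using assms by (simp add: Lambda_1)
  then have "even (fst (v + fst s) + snd (v + fst s)) \<longleftrightarrow> even (fst (fst s) + snd (fst s))" by auto
  then show ?thesis by (auto simp: typed_segment_def seg_type_def)
qed

lemma region_subset_cball:
  assumes "real_point ` (e \<union> support s \<union> f) \<subseteq> cball p r"
  shows "region (e, s, f) \<subseteq> cball p r"
  using assms unfolding region.simps image_Un by (intro Un_least hull_minimal convex_cball) blast+

lemma field_covering_local_isomorphism:
  assumes F: "sign_field \<sigma> c"
  shows "local_isomorphism_property (field_covering \<sigma> t)"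
  unfolding local_isomorphism_property_def
proof (intro allI impI)
  note \<sigma> = field_signs[OF F]
  fix G assume G: "finite G \<and> G \<subseteq> decorated_segments (field_covering \<sigma> t)"
  define S where "S = (\<lambda>d. fst (snd d)) ` G"
  have Gs: "\<exists>s\<in>S. d = (support (prv \<sigma> s), s, support (nxt \<sigma> s)) \<and> typed_segment t s" if d: "d \<in> G" for d
  proof -
    obtain s where s: "d = (support (prv \<sigma> s), s, support (nxt \<sigma> s))" "typed_segment t s"
      using d G decorated_field_covering[OF \<sigma>, of t] by blast
    moreover have "s \<in> S" unfolding S_def using d s(1) by force
    ultimately show ?thesis by blast
  qed
  have finS: "finite S" using G by (simp add: S_def)
  define V where "V = fst ` S \<union> snd ` S"
  have finV: "finite V" using finS by (simp add: V_def)
  obtain v N where v: "v \<in> Lambda 1" "0 < N" "\<And>u x. u \<in> Lambda N \<Longrightarrow> x \<in> V \<Longrightarrow> \<sigma> (x + (v + u)) = \<sigma> x"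
    using field_translation[OF F finV] by blast
  obtain R where R: "\<And>p. \<exists>u\<in>Lambda N. dist p (real_point u) \<le> R" using Lambda_dense by blast
  define W where "W = (\<Union>s\<in>S. support (prv \<sigma> s) \<union> support s \<union> support (nxt \<sigma> s))"
  have "finite W" using finS by (simp add: W_def support_def)
  then obtain B where B: "\<And>x. x \<in> W \<Longrightarrow> norm (real_point x) \<le> B"
    using finite_imp_bounded[of "real_point ` W"] unfolding bounded_iff by auto
  \<comment> \<open>\<open>R\<close> bounds the distance from the centre to the chosen lattice
    point, \<open>norm (real_point v)\<close> the correction by \<open>v\<close>, and
    \<open>B\<close> the extent of the pattern with its decorations.\<close>
  define r where "r = max 1 (R + norm (real_point v) + B)"
  show "\<exists>r>0. \<forall>p. \<exists>v. translate v ` G \<subseteq> decorated_segments (field_covering \<sigma> t) \<and> (\<forall>d\<in>translate v ` G. region d \<subseteq> cball p r)"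
  proof (intro exI[of _ r] conjI allI)
    show "0 < r" by (simp add: r_def)
    fix p
    obtain u where u: "u \<in> Lambda N" "dist p (real_point u) \<le> R" using R by blast
    define z where "z = v + u"
    have "u \<in> Lambda 1" using u(1) Lambda_mono[of 1 N] v(2) by auto
    then have z1: "z \<in> Lambda 1" unfolding z_def using v(1) Lambda_add by blast
    have dz: "dist p (real_point (z + x)) \<le> r" if "x \<in> W" for x
    proof -
      have "dist p (real_point (z + x)) \<le> dist p (real_point u) + norm (real_point v + real_point x)"
        using dist_triangle[of p "real_point (z + x)" "real_point u"]
        by (simp add: z_def real_point_add dist_norm norm_minus_commute algebra_simps)
      also have "\<dots> \<le> R + (norm (real_point v) + B)"
        using u(2) B[OF that] norm_triangle_ineq[of "real_point v" "real_point x"] by linarith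
      finally show ?thesis by (simp add: r_def)
    qed
    have tr: "translate z d \<in> decorated_segments (field_covering \<sigma> t) \<and> region (translate z d) \<subseteq> cball p r" if d: "d \<in> G" for d
    proof -
      obtain s where s: "s \<in> S" "d = (support (prv \<sigma> s), s, support (nxt \<sigma> s))" "typed_segment t s" using Gs[OF d] by blast
      have inv: "\<sigma> (z + x) = \<sigma> x" if "x \<in> V" for x using v(3)[OF u(1) that] by (simp add: z_def add.commute)
      have eq: "\<sigma> (z + fst s) = \<sigma> (fst s)" "\<sigma> (z + snd s) = \<sigma> (snd s)" using inv s(1) by (auto simp: V_def)
      have "translate z d \<in> decorated_segments (field_covering \<sigma> t)"
        unfolding decorated_field_covering[OF \<sigma>] s(2) translate_decorated[OF eq] mem_Collect_eq
        using typed_translate[OF z1, of t s] s(3) by blast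
      moreover have "region (translate z d) \<subseteq> cball p r"
      proof -
        have ts: "translate z d = ((+) z ` support (prv \<sigma> s), (z + fst s, z + snd s), (+) z ` support (nxt \<sigma> s))"
          unfolding s(2) by (metis prod.collapse translate.simps)
        have "support (z + fst s, z + snd s) = (+) z ` support s" by (simp add: support_def)
        then have "(+) z ` support (prv \<sigma> s) \<union> support (z + fst s, z + snd s) \<union> (+) z ` support (nxt \<sigma> s) \<subseteq> (+) z ` W"
          using s(1) unfolding W_def by blast
        moreover have "real_point ` (+) z ` W \<subseteq> cball p r" using dz by (simp add: image_subset_iff)
        ultimately show ?thesis unfolding ts by (intro region_subset_cball) blast
      qed
      ultimately show ?thesis by blast
    qed
    then show "\<exists>v. translate v ` G \<subseteq> decorated_segments (field_covering \<sigma> t) \<and> (\<forall>d\<in>translate v ` G. region d \<subseteq> cball p r)"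
      by blast
  qed
qed

section \<open>Coverings that contain a given curve\<close>

lemma block_covers_disc:
  assumes "\<And>k. block y k"
  shows "\<exists>p. \<forall>A B. unit_vec (B - A) \<and> real_point A \<in> cball p r \<and> real_point B \<in> cball p r \<longrightarrow> covers y A B"
proof -
  \<comment> \<open>Half the side exceeds the radius, so the lattice points of the disc lie inside
    the block and are lower left corners of full squares.\<close>
  define k where "k = 2 * \<lceil>\<bar>r\<bar>\<rceil> + 4"
  obtain X Z where XZ: "\<And>p q. 0 \<le> p \<Longrightarrow> p < k \<Longrightarrow> 0 \<le> q \<Longrightarrow> q < k \<Longrightarrow> square y (X + p) (Z + q)"
    using assms[of k] unfolding block_def by blast
  define p where "p = (real_of_int X + k / 2, real_of_int Z + k / 2)"
  have bd: "X < fst A \<and> fst A < X + k \<and> Z < snd A \<and> snd A < Z + k" if A: "real_point A \<in> cball p r" for A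
  proof -
    have "dist (fst p) (fst (real_point A)) \<le> r" "dist (snd p) (snd (real_point A)) \<le> r"
      using A dist_fst_le[of p "real_point A"] dist_snd_le[of p "real_point A"] by (simp_all add: order_trans)
    then have "\<bar>real_of_int X + k / 2 - fst A\<bar> \<le> \<bar>r\<bar>" "\<bar>real_of_int Z + k / 2 - snd A\<bar> \<le> \<bar>r\<bar>"
      by (simp_all add: p_def real_point_def dist_real_def)
    moreover have "\<bar>r\<bar> < k / 2" unfolding k_def by (simp; linarith)
    ultimately have "real_of_int X < fst A" "real_of_int (fst A) < X + k" "real_of_int Z < snd A" "real_of_int (snd A) < Z + k"
      by linarith+
    then show ?thesis by linarith
  qed
  have "covers y A B" if d: "unit_vec (B - A)" and A: "real_point A \<in> cball p r" and B: "real_point B \<in> cball p r" for A B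
  proof -
    obtain m n where mn: "A = (m, n)" by fastforce
    note bA = bd[OF A] and bB = bd[OF B]
    have sA: "square y (fst A) (snd A)" using XZ[of "fst A - X" "snd A - Z"] bA by simp
    have sB: "square y (fst B) (snd B)" using XZ[of "fst B - X" "snd B - Z"] bB by simp
    have "B = (m + 1, n) \<or> B = (m - 1, n) \<or> B = (m, n + 1) \<or> B = (m, n - 1)"
      using d unfolding unit_vec_def mn by (cases B) auto
    then show ?thesis using sA sB unfolding square_def mn by (elim disjE) (simp_all add: covers_commute)
  qed
  then show ?thesis by blast
qed

lemma fold_seq_shift:
  assumes "fold_seq a" shows "fold_seq (\<lambda>i. a (i + k))"
  unfolding fold_seq_def
proof (intro conjI allI)
  show "a (i + k) \<in> {1, -1}" for i using assms unfolding fold_seq_def by blast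
  fix n
  obtain e where e: "folds a n e" using assms unfolding fold_seq_def by blast
  have "folds (\<lambda>i. a (i + k)) n (e - k)" unfolding folds_def
  proof (intro allI impI)
    fix m i assume "m < n" "2 ^ m dvd i - (e - k) \<and> \<not> 2 ^ Suc m dvd i - (e - k)"
    moreover have "i - (e - k) = i + k - e" by simp
    ultimately have "a (i + k + 2 ^ Suc m) = - a (i + k)" using e unfolding folds_def by metis
    moreover have "i + k + 2 ^ Suc m = i + 2 ^ Suc m + k" by simp
    ultimately show "a (i + 2 ^ Suc m + k) = - a (i + k)" by (simp only:)
  qed
  then show "\<exists>e. folds (\<lambda>i. a (i + k)) n e" by blast
qed

lemma complete_folding_curve_shift:
  assumes "complete_folding_curve C" "\<And>i. D i = C (i + k)"
  shows "complete_folding_curve D"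
proof -
  have t: "turns D = (\<lambda>i. turns C (i + k))"
    by (simp add: fun_eq_iff turns_def assms(2) add.assoc add.commute[of 1])
  have "inj (\<lambda>i. support (D i))"
  proof
    fix i j assume "support (D i) = support (D j)"
    then have "i + k = j + k" using assms unfolding complete_folding_curve_def complete_curve_def inj_def by metis
    then show "i = j" by simp
  qed
  moreover have "D (i + 1) = C (i + k + 1)" for i by (simp add: assms(2) algebra_simps)
  ultimately show ?thesis
    using assms(1) fold_seq_shift[of "turns C" k] unfolding complete_folding_curve_def complete_curve_def complete_folding_seq_iff t
    by (simp add: assms(2))
qed

lemma folding_covering_edge:
  assumes "folding_covering \<C>" "e \<in> lattice_edges"
  shows "\<exists>!p. p \<in> (SIGMA \<gamma>:\<C>. curve_segments \<gamma>) \<and> support (snd p) = e"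
  using assms(1) unfolding folding_covering_def by (rule conjunct2[THEN bspec]) (rule assms(2))

lemma folding_covering_member:
  assumes "folding_covering \<C>" "\<gamma> \<in> \<C>" "D \<in> \<gamma>"
  shows "complete_folding_curve D" "\<gamma> = curve_class D"
proof -
  have "\<forall>\<gamma>\<in>\<C>. \<exists>C. complete_folding_curve C \<and> \<gamma> = curve_class C"
    using assms(1) unfolding folding_covering_def by (rule conjunct1)
  then obtain C where C: "complete_folding_curve C" "\<gamma> = curve_class C" using assms(2) by blast
  show "\<gamma> = curve_class D" using curve_class_member[of D C] C(2) assms(3) by simp
  obtain k where "\<forall>i. D i = C (i + k)" using assms(3) C(2) unfolding curve_class_def by blast
  then show "complete_folding_curve D" using complete_folding_curve_shift[OF C(1)] by blast
qed

lemma complete_folding_curve_unit: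
  assumes "complete_folding_curve D" shows "unit_vec (snd (D i) - fst (D i))"
  using assms unfolding complete_folding_curve_def complete_curve_def is_segment_iff by blast

lemma complete_folding_curve_inj:
  assumes "complete_folding_curve D" "support (D i) = support (D j)" shows "i = j"
  using assms unfolding complete_folding_curve_def complete_curve_def inj_def by blast

lemma complete_folding_curve_next:
  assumes "complete_folding_curve D"
  shows "D (i + 1) = (snd (D i), snd (D i) + turn (turns D i) (snd (D i) - fst (D i)))"
proof -
  note P = complete_folding_curve_path[OF assms]
  have 1: "D (i + 1) = (snd (D i), snd (D (i + 1)))" using P(3)[of "i + 1"] by simp
  have 2: "fst (D i) = snd (D (i - 1))" using P(3)[of i] by (metis fst_conv)
  have "snd (D (i + 1)) - snd (D i) = turn (turns D i) (snd (D i) - snd (D (i - 1)))"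
    using P(1) unfolding lattice_path_def by blast
  then have "snd (D (i + 1)) = snd (D i) + turn (turns D i) (snd (D i) - fst (D i))"
    unfolding 2 by (simp add: algebra_simps)
  then show ?thesis using 1 by simp
qed

lemma complete_folding_curve_sign: "complete_folding_curve D \<Longrightarrow> turns D i \<in> {1, -1}"
  using complete_folding_curve_path(2) unfolding fold_seq_def by blast

text \<open>Uniqueness in the covering identifies the curve and the oriented segment; as supports do
  not repeat along a curve, the parametrizations then agree up to a shift.\<close>

lemma covering_same:
  assumes F: "folding_covering \<C>" and D: "\<gamma> \<in> \<C>" "D \<in> \<gamma>" and D': "\<gamma>' \<in> \<C>" "D' \<in> \<gamma>'"
    and s: "support (D i) = support (D' j)"
  shows "\<gamma> = \<gamma>'" "D (i + l) = D' (j + l)"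
proof -
  note C = folding_covering_member[OF F D] and C' = folding_covering_member[OF F D']
  have "support (D i) \<in> lattice_edges" using complete_folding_curve_unit[OF C(1)] lattice_edges_iff by blast
  from folding_covering_edge[OF F this]
  have "\<exists>!p. p \<in> (SIGMA \<gamma>:\<C>. curve_segments \<gamma>) \<and> support (snd p) = support (D i)" .
  moreover have "(\<gamma>, D i) \<in> (SIGMA \<gamma>:\<C>. curve_segments \<gamma>)" "(\<gamma>', D' j) \<in> (SIGMA \<gamma>:\<C>. curve_segments \<gamma>)"
    using D D' unfolding curve_segments_def by blast+
  ultimately have e: "(\<gamma>, D i) = (\<gamma>', D' j)" using s by (metis snd_conv)
  then show g: "\<gamma> = \<gamma>'" by simp
  have "D' \<in> curve_class D" using g C(2) D'(2) by simp
  then obtain k where k: "\<forall>l. D' l = D (l + k)" unfolding curve_class_def by blast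
  have "support (D i) = support (D (j + k))" using e k by simp
  then have "i = j + k" using complete_folding_curve_inj[OF C(1)] by blast
  then show "D (i + l) = D' (j + l)" using k by (simp add: algebra_simps)
qed

lemma real_point_support_region: "x \<in> support s \<Longrightarrow> real_point x \<in> region (e, s, f)"
  by (simp add: hull_inc)

text \<open>The radius is known before the centre is chosen, so the disc can be placed inside a
  block covered by \<open>C\<close>. Every segment of the translated pattern is then a segment of
  \<open>C\<close>, and its neighbours agree by \<open>covering_same\<close>.\<close>

lemma pattern_in_curve:
  assumes F: "folding_covering \<C>" and LI: "local_isomorphism_property \<C>"
    and C: "curve_class C \<in> \<C>" and G: "finite G" "G \<subseteq> decorated_segments \<C>"
  shows "\<exists>v. \<forall>d\<in>G. \<exists>i. translate v d = (support (C (i - 1)), C i, support (C (i + 1)))"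
proof -
  have cC: "complete_folding_curve C" using folding_covering_member(1)[OF F C curve_class_refl] .
  note P = complete_folding_curve_path[OF cC]
  obtain r where r: "\<forall>p. \<exists>v. translate v ` G \<subseteq> decorated_segments \<C> \<and> (\<forall>d\<in>translate v ` G. region d \<subseteq> cball p r)"
    using LI[unfolded local_isomorphism_property_def, rule_format, OF conjI[OF G]] by blast
  obtain p where p: "\<And>A B. unit_vec (B - A) \<Longrightarrow> real_point A \<in> cball p r \<Longrightarrow> real_point B \<in> cball p r \<Longrightarrow> covers (\<lambda>i. snd (C i)) A B"
    using block_covers_disc[of "\<lambda>i. snd (C i)" r] path_covers_block[OF P(1,2)] by blast
  obtain v where "translate v ` G \<subseteq> decorated_segments \<C> \<and> (\<forall>d\<in>translate v ` G. region d \<subseteq> cball p r)"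
    using r[rule_format, of p] by (rule exE)
  then have v: "translate v ` G \<subseteq> decorated_segments \<C>" "\<And>d. d \<in> G \<Longrightarrow> region (translate v d) \<subseteq> cball p r"
    by simp_all
  have "\<exists>i. translate v d = (support (C (i - 1)), C i, support (C (i + 1)))" if d: "d \<in> G" for d
  proof -
    have "translate v d \<in> decorated_segments \<C>" using v(1) d by blast
    then obtain \<gamma> D j where D: "\<gamma> \<in> \<C>" "D \<in> \<gamma>" "translate v d = (support (D (j - 1)), D j, support (D (j + 1)))"
      unfolding decorated_segments_def by blast
    have cD: "complete_folding_curve D" using folding_covering_member(1)[OF F D(1,2)] .
    have "real_point x \<in> cball p r" if "x \<in> support (D j)" for x
      using real_point_support_region[OF that] v(2)[OF d] unfolding D(3) by blast
    then have "covers (\<lambda>i. snd (C i)) (fst (D j)) (snd (D j))"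
      using complete_folding_curve_unit[OF cD] by (intro p) (auto simp: support_def)
    then obtain i where i: "{snd (C i), snd (C (i + 1))} = {fst (D j), snd (D j)}" unfolding covers_def by blast
    have "C (i + 1) = (snd (C i), snd (C (i + 1)))" using P(3)[of "i + 1"] by simp
    then have "support (C (i + 1)) = support (D j)" using i unfolding support_def by (metis fst_conv snd_conv)
    from covering_same(2)[OF F C curve_class_refl D(1,2) this] have "C (i + 1 + l) = D (j + l)" for l .
    from this[of "-1"] this[of 0] this[of 1] have "translate v d = (support (C (i + 1 - 1)), C (i + 1), support (C (i + 1 + 1)))"
      unfolding D(3) by simp
    then show ?thesis by blast
  qed
  then show ?thesis by blast
qed

section \<open>Orientation and signs forced by the given curve\<close>

lemma translate_eq: "translate v (e, s, f) = ((+) v ` e, (v + fst s, v + snd s), (+) v ` f)"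
  by (cases s) simp

lemma decorated_member: "\<gamma> \<in> \<C> \<Longrightarrow> D \<in> \<gamma> \<Longrightarrow> (support (D (i - 1)), D i, support (D (i + 1))) \<in> decorated_segments \<C>"
  unfolding decorated_segments_def by blast

lemma typed_translate_even:
  assumes "typed_segment t s" "typed_segment t (v + fst s, v + snd s)"
  shows "v \<in> Lambda 1"
proof -
  have "even (fst (v + fst s) + snd (v + fst s)) \<longleftrightarrow> even (fst (fst s) + snd (fst s))"
    using assms by (auto simp: typed_segment_def seg_type_def)
  then show ?thesis by (auto simp: Lambda_1)
qed

lemma curve_typed:
  assumes "complete_folding_curve C"
  shows "typed_segment (seg_type (C 0)) (C i)"
proof -
  note P = complete_folding_curve_path[OF assms]
  have "seg_type (C i) = seg_type (snd (C 0), snd (C 1))" for i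
    using path_seg_type[OF P(1), of "i - 1"] P(3)[of i] by simp
  then show ?thesis unfolding typed_segment_def using complete_folding_curve_unit[OF assms] by metis
qed

text \<open>\<open>C 0\<close> serves as an anchor: it lands on \<open>C\<close>, whose segments
  have a single type, so the translation is even and preserves types. The type of \<open>D i\<close>
  is then that of its image on \<open>C\<close>.\<close>

lemma covering_typed:
  assumes F: "folding_covering \<C>" and LI: "local_isomorphism_property \<C>"
    and C: "curve_class C \<in> \<C>" and D: "\<gamma> \<in> \<C>" "D \<in> \<gamma>"
  shows "typed_segment (seg_type (C 0)) (D i)"
proof -
  have cC: "complete_folding_curve C" using folding_covering_member(1)[OF F C curve_class_refl] .
  define G where "G = {(support (D (i - 1)), D i, support (D (i + 1))), (support (C (0 - 1)), C 0, support (C (0 + 1)))}"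
  have "G \<subseteq> decorated_segments \<C>" "finite G"
    unfolding G_def using decorated_member[OF D] decorated_member[OF C curve_class_refl] by blast+
  then obtain v where v: "\<forall>d\<in>G. \<exists>i. translate v d = (support (C (i - 1)), C i, support (C (i + 1)))"
    using pattern_in_curve[OF F LI C] by blast
  obtain j where "translate v (support (D (i - 1)), D i, support (D (i + 1))) = (support (C (j - 1)), C j, support (C (j + 1)))"
    using v unfolding G_def by blast
  then have j: "(v + fst (D i), v + snd (D i)) = C j" unfolding translate_eq by simp
  obtain k where "translate v (support (C (0 - 1)), C 0, support (C (0 + 1))) = (support (C (k - 1)), C k, support (C (k + 1)))"
    using v unfolding G_def by blast
  then have k: "(v + fst (C 0), v + snd (C 0)) = C k" unfolding translate_eq by simp
  have "v \<in> Lambda 1" using typed_translate_even[of _ "C 0" v] curve_typed[OF cC, of 0] curve_typed[OF cC, of k] unfolding k by blast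
  from typed_translate[OF this, of _ "D i"] show ?thesis using curve_typed[OF cC, of j] unfolding j by blast
qed

text \<open>Segments of equal type that end at the same vertex arrive in equal or opposite
  directions. With opposite directions and opposite turns they would leave along the same edge,
  against uniqueness in the covering. So the turn depends only on the vertex.\<close>

lemma covering_eq_field_covering:
  assumes F: "folding_covering \<C>" and T: "\<And>\<gamma> D i. \<gamma> \<in> \<C> \<Longrightarrow> D \<in> \<gamma> \<Longrightarrow> typed_segment t (D i)"
  shows "\<exists>\<rho>. signs \<rho> \<and> \<C> = field_covering \<rho> t \<and> (\<forall>\<gamma>\<in>\<C>. \<forall>D\<in>\<gamma>. \<forall>i. turns D i = \<rho> (snd (D i)))"
proof -
  have eq: "turns D i = turns D' j"
    if D: "\<gamma> \<in> \<C>" "D \<in> \<gamma>" and D': "\<gamma>' \<in> \<C>" "D' \<in> \<gamma>'" and x: "snd (D i) = snd (D' j)" for \<gamma> \<gamma>' D D' i j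
  proof (rule ccontr)
    assume ne: "turns D i \<noteq> turns D' j"
    note C = folding_covering_member(1)[OF F D] and C' = folding_covering_member(1)[OF F D']
    define d d' where "d = snd (D i) - fst (D i)" and "d' = snd (D' j) - fst (D' j)"
    have u: "unit_vec d" "unit_vec d'" using complete_folding_curve_unit C C' by (auto simp: d_def d'_def)
    have s': "turns D' j = - turns D i"
      using ne complete_folding_curve_sign[OF C, of i] complete_folding_curve_sign[OF C', of j] by auto
    have f: "fst (D i) = snd (D i) - d" "fst (D' j) = snd (D i) - d'" by (simp_all add: d_def d'_def x)
    have "seg_type (D i) = seg_type (D' j)" using T[OF D] T[OF D'] by (simp add: typed_segment_def)
    then have "snd d = 0 \<longleftrightarrow> snd d' = 0"
      using u unfolding seg_type_def f x[symmetric] unit_vec_def insert_iff empty_iff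
      by (elim disjE FalseE) auto
    then have "d' = d \<or> d' = - d"
      using u unfolding unit_vec_def insert_iff empty_iff by (elim disjE FalseE) simp_all
    then show False
    proof
      assume "d' = d"
      then have "D i = D' j" using f x by (metis prod.collapse)
      then have "D (i + l) = D' (j + l)" for l using covering_same(2)[OF F D D'] by metis
      then have "turns D i = turns D' j" unfolding turns_def by (metis add.right_neutral)
      then show False using ne by blast
    next
      assume d': "d' = - d"
      have "D (i + 1) = D' (j + 1)"
        unfolding complete_folding_curve_next[OF C, of i] complete_folding_curve_next[OF C', of j]
          d_def[symmetric] d'_def[symmetric]
        unfolding d' s' x by (simp add: turn_uminus turn_uminus_sign)
      from covering_same(2)[OF F D D' arg_cong[OF this, of support], of "-1"] have "D i = D' j" by simp
      then have "d = d'" by (simp add: d_def d'_def)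
      then show False using d' u(1) by (auto simp: unit_vec_def)
    qed
  qed
  have "\<forall>x. \<exists>s. s \<in> {1, -1} \<and> (\<forall>\<gamma>\<in>\<C>. \<forall>D\<in>\<gamma>. \<forall>i. snd (D i) = x \<longrightarrow> turns D i = s)"
  proof
    fix x
    show "\<exists>s. s \<in> {1, -1} \<and> (\<forall>\<gamma>\<in>\<C>. \<forall>D\<in>\<gamma>. \<forall>i. snd (D i) = x \<longrightarrow> turns D i = s)"
    proof (cases "\<exists>\<gamma>\<in>\<C>. \<exists>D\<in>\<gamma>. \<exists>i. snd (D i) = x")
      case True
      then obtain \<gamma> D i where D: "\<gamma> \<in> \<C>" "D \<in> \<gamma>" "snd (D i) = x" by blast
      have "turns D i \<in> {1, -1}" using complete_folding_curve_sign[OF folding_covering_member(1)[OF F D(1,2)]] .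
      moreover have "turns D' j = turns D i" if "\<gamma>' \<in> \<C>" "D' \<in> \<gamma>'" "snd (D' j) = x" for \<gamma>' D' j
        using eq[OF that(1,2) D(1,2)] that(3) D(3) by simp
      ultimately show ?thesis by blast
    qed blast
  qed
  from choice[OF this] obtain \<rho> where
    "\<forall>x. \<rho> x \<in> {1, -1} \<and> (\<forall>\<gamma>\<in>\<C>. \<forall>D\<in>\<gamma>. \<forall>i. snd (D i) = x \<longrightarrow> turns D i = \<rho> x)" by blast
  then have \<rho>: "signs \<rho>" "\<And>\<gamma> D i. \<gamma> \<in> \<C> \<Longrightarrow> D \<in> \<gamma> \<Longrightarrow> turns D i = \<rho> (snd (D i))" unfolding signs_def by blast+
  have fol: "follows \<rho> D" if "\<gamma> \<in> \<C>" "D \<in> \<gamma>" for \<gamma> D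
    unfolding follows_def nxt_def
    using complete_folding_curve_next[OF folding_covering_member(1)[OF F that]] \<rho>(2)[OF that] by simp
  have "\<C> = field_covering \<rho> t"
  proof (intro set_eqI iffI)
    fix \<gamma> assume g: "\<gamma> \<in> \<C>"
    then have "\<exists>D. \<gamma> = curve_class D" using F unfolding folding_covering_def by meson
    then obtain D where D: "\<gamma> = curve_class D" by blast
    then have "D \<in> \<gamma>" using curve_class_refl by blast
    then show "\<gamma> \<in> field_covering \<rho> t" unfolding field_covering_def using D fol[OF g] T[OF g] by blast
  next
    fix \<gamma> assume "\<gamma> \<in> field_covering \<rho> t"
    then obtain E where E: "follows \<rho> E" "typed_segment t (E 0)" "\<gamma> = curve_class E"
      unfolding field_covering_def by blast
    have "support (E 0) \<in> lattice_edges" using E(2) lattice_edges_iff unfolding typed_segment_def by blast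
    then obtain q where q: "q \<in> (SIGMA \<gamma>:\<C>. curve_segments \<gamma>)" "support (snd q) = support (E 0)"
      using folding_covering_edge[OF F] by blast
    then obtain D i where D: "fst q \<in> \<C>" "D \<in> fst q" "snd q = D i" unfolding curve_segments_def by auto
    have "D i = E 0" using typed_support_unique[OF T[OF D(1,2)] E(2)] q(2) D(3) by simp
    then have "curve_class E = curve_class D" using follows_class[OF \<rho>(1) fol[OF D(1,2)] E(1), of 0 i] by simp
    then show "\<gamma> \<in> \<C>" using E(3) folding_covering_member(2)[OF F D(1,2)] D(1) by simp
  qed
  then show ?thesis using \<rho> by blast
qed

lemma translated_turn:
  assumes C: "complete_folding_curve C" and D: "complete_folding_curve D"
    and e: "(v + fst (D i), v + snd (D i)) = C j" "(+) v ` support (D (i + 1)) = support (C (j + 1))"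
  shows "turns C j = turns D i"
proof -
  define d where "d = snd (D i) - fst (D i)"
  have u: "unit_vec d" unfolding d_def by (rule complete_folding_curve_unit[OF D])
  have Cj: "snd (C j) = v + snd (D i)" "snd (C j) - fst (C j) = d" unfolding e(1)[symmetric] d_def by simp_all
  have "{v + snd (D i), v + (snd (D i) + turn (turns D i) d)} = {v + snd (D i), v + snd (D i) + turn (turns C j) d}"
    using e(2) unfolding support_def complete_folding_curve_next[OF C, of j] complete_folding_curve_next[OF D, of i]
      d_def[symmetric] Cj(2) unfolding Cj(1) by simp
  then have "v + (snd (D i) + turn (turns D i) d) = v + snd (D i) + turn (turns C j) d" unfolding doubleton_eq_iff by metis
  then have "turn (turns D i) d = turn (turns C j) d" by (simp add: add.assoc)
  then show ?thesis using u unfolding unit_vec_def insert_iff empty_iff turn_def by (elim disjE FalseE) simp_all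
qed

lemma typed_segment_ending: "\<exists>s. typed_segment t s \<and> snd s = x"
proof -
  have "typed_segment t (x - (1, 0), x) \<or> typed_segment t (x - (0, 1), x)"
    by (auto simp: typed_segment_def seg_type_def unit_vec_def)
  then show ?thesis by (metis snd_conv)
qed

lemma covering_sign_determined:
  assumes F: "folding_covering \<C>" and LI: "local_isomorphism_property \<C>" and C: "curve_class C \<in> \<C>"
    and \<rho>: "signs \<rho>" "\<C> = field_covering \<rho> t" "\<And>\<gamma> D i. \<gamma> \<in> \<C> \<Longrightarrow> D \<in> \<gamma> \<Longrightarrow> turns D i = \<rho> (snd (D i))"
    and \<sigma>: "sign_field \<sigma> c" "\<And>i. turns C i = \<sigma> (snd (C i))"
    and x: "x \<notin> limit_points c"
  shows "\<rho> x = \<sigma> x"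
proof -
  have cC: "complete_folding_curve C" using folding_covering_member(1)[OF F C curve_class_refl] .
  note P = complete_folding_curve_path[OF cC]
  obtain N where N: "x - c N \<notin> Lambda N" using x unfolding limit_points_def by blast
  obtain s where s: "typed_segment t s" "snd s = x" using typed_segment_ending by blast
  obtain D where D: "curve_class D \<in> \<C>" "D 0 = s" using field_covering_follows[OF \<rho>(1) s(1)] \<rho>(2) by metis
  have cD: "complete_folding_curve D" using folding_covering_member(1)[OF F D(1) curve_class_refl] .
  \<comment> \<open>The piece of \<open>C\<close> covers the window that
    \<open>fold_seq_period\<close> requires for level \<open>Suc N\<close>.\<close>
  define M :: int where "M = 2 ^ (Suc N + 3) + 1"
  define dec where "dec E i = (support (E (i - 1)), E i, support (E (i + 1)))" for E :: "int \<Rightarrow> segment" and i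
  define G where "G = insert (dec D 0) (dec C ` {0..M})"
  have "G \<subseteq> decorated_segments \<C>" "finite G"
    unfolding G_def dec_def using decorated_member[OF D(1) curve_class_refl, of 0] decorated_member[OF C curve_class_refl] by auto
  then obtain v where v: "\<forall>d\<in>G. \<exists>i. translate v d = dec C i"
    using pattern_in_curve[OF F LI C] unfolding dec_def by blast
  obtain j where "translate v (dec D 0) = dec C j" using v unfolding G_def by blast
  then have j: "(v + fst (D 0), v + snd (D 0)) = C j" "(+) v ` support (D (0 + 1)) = support (C (j + 1))"
    unfolding dec_def translate_eq by simp_all
  have "\<forall>i\<in>{0..M}. \<exists>k. translate v (dec C i) = dec C k" using v unfolding G_def by blast
  then obtain f where "\<forall>i\<in>{0..M}. translate v (dec C i) = dec C (f i)" by metis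
  then have f: "(v + fst (C i), v + snd (C i)) = C (f i)" "(+) v ` support (C (i + 1)) = support (C (f i + 1))"
    if "0 \<le> i" "i \<le> M" for i using that unfolding dec_def translate_eq by auto
  \<comment> \<open>The decoration determines the image of the next support, so consecutive segments
    have consecutive images and \<open>f\<close> is the shift by \<open>f 0\<close>.\<close>
  have fS: "f (i + 1) = f i + 1" if "0 \<le> i" "i < M" for i
  proof -
    have "C (f (i + 1)) = (v + fst (C (i + 1)), v + snd (C (i + 1)))" using f(1)[of "i + 1"] that by simp
    then have "support (C (f (i + 1))) = (+) v ` support (C (i + 1))" by (simp add: support_def)
    also have "\<dots> = support (C (f i + 1))" using f(2)[of i] that by simp
    finally show ?thesis using complete_folding_curve_inj[OF cC] by blast
  qed
  define k where "k = f 0"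
  have fk: "f (int i) = int i + k" if "int i \<le> M" for i
    using that
  proof (induction i)
    case (Suc i)
    then show ?case using fS[of "int i"] by (simp add: add.commute)
  qed (simp add: k_def)
  have fk': "f i = i + k" if "0 \<le> i" "i \<le> M" for i using fk[of "nat i"] that by simp
  have "turns C (i + k) = turns C i" if "0 \<le> i" "i \<le> 0 + 2 ^ (Suc N + 3)" for i
    using translated_turn[OF cC cC f(1)[of i] f(2)[of i]] fk'[of i] that by (simp add: M_def)
  then have dk: "2 ^ Suc N dvd k" by (rule fold_seq_period[OF P(2)])
  obtain e where e: "folds (turns C) (Suc N) e" using P(2) unfolding fold_seq_def by blast
  \<comment> \<open>An index of the window in the class of \<open>e\<close>: from there a shift by a
    multiple of \<open>2 ^ Suc N\<close> moves the vertex by an element of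
    \<open>Lambda (Suc N)\<close>, and this element is \<open>v\<close>.\<close>
  define i where "i = e mod 2 ^ Suc N"
  have i: "0 \<le> i" "i < 2 ^ Suc N" "2 ^ Suc N dvd i - e"
    unfolding i_def by (simp, simp, simp add: mod_eq_dvd_iff[symmetric])
  have "(2::int) ^ Suc N \<le> 2 ^ (Suc N + 3)" by (intro power_increasing) auto
  then have iM: "i \<le> M" using i(2) unfolding M_def by linarith
  obtain q where q: "k = q * 2 ^ Suc N" using dk by (metis dvd_def mult.commute)
  have "snd (C (i + k)) = v + snd (C i)" using f(1)[OF i(1) iM] fk'[OF i(1) iM] by (metis snd_conv)
  then have "v = snd (C (i + k)) - snd (C i)" by simp
  then have "v \<in> Lambda (Suc N)" using path_jump_multiple[OF P(1) e i(3), of q] unfolding q by simp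
  then have "\<sigma> (x + v) = \<sigma> x" by (rule field_invariant[OF \<sigma>(1) N])
  moreover have "turns C j = turns D 0" by (rule translated_turn[OF cC cD j])
  moreover have "snd (C j) = v + x" using j(1) D(2) s(2) by (metis snd_conv)
  moreover have "turns D 0 = \<rho> x" using \<rho>(3)[OF D(1) curve_class_refl, of 0] D(2) s(2) by simp
  ultimately show ?thesis using \<sigma>(2)[of j] by (simp add: add.commute)
qed

section \<open>The limit point and the number of coverings\<close>

lemma E_curve_eq:
  assumes C: "complete_folding_curve C" and e: "folds (turns C) (Suc n) e"
  shows "E_curve n C = {x. x - snd (C e) \<in> Lambda n}"
proof -
  note P = complete_folding_curve_path[OF C]
  have E: "E_seq n (turns C) = {i. 2 ^ n dvd i - e}"
    by (rule E_seq_folds[OF complete_folding_curve_sign[OF C] e])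
  have L: "snd (C i) - snd (C e) \<in> Lambda n" if "2 ^ n dvd i - e" for i
    using path_Lambda_iff[OF P(1) folds_mono[OF e, of n], of e i] that by simp
  show ?thesis
  proof (intro set_eqI iffI)
    fix x assume "x \<in> E_curve n C"
    then obtain i v where x: "x = snd (C i) + v" "2 ^ n dvd i - e" "v \<in> Lambda n" unfolding E_curve_def E by blast
    have "(snd (C i) - snd (C e)) + v = x - snd (C e)" by (simp add: x(1))
    then show "x \<in> {x. x - snd (C e) \<in> Lambda n}" using Lambda_add[OF L[OF x(2)] x(3)] by (simp only: mem_Collect_eq)
  next
    fix x assume "x \<in> {x. x - snd (C e) \<in> Lambda n}"
    then have "x - snd (C e) \<in> Lambda n" "e \<in> E_seq n (turns C)" "x = snd (C e) + (x - snd (C e))" unfolding E by simp_all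
    then show "x \<in> E_curve n C" unfolding E_curve_def by blast
  qed
qed

text \<open>A limit point has no level and is not reached from a point of level \<open>n\<close> by
  a translation in \<open>Lambda (Suc n)\<close>, so the flip rule never involves it.\<close>

lemma field_upd_limit_point:
  assumes F: "sign_field \<sigma> c" and P: "P \<in> limit_points c" and s: "s \<in> {1, -1}"
  shows "sign_field (\<sigma>(P := s)) c"
  unfolding sign_field_def
proof (intro conjI allI impI)
  show "(\<sigma>(P := s)) x \<in> {1, -1}" for x using field_sign[OF F, of x] s by simp
  show "c (Suc n) - c n \<in> Lambda n" for n by (rule field_nested[OF F])
  fix n x u
  assume A: "x - c n \<in> Lambda n \<and> x - c (Suc n) \<notin> Lambda (Suc n) \<and> u \<in> Lambda (Suc n)"
  have Pn: "P - c (Suc n) \<in> Lambda (Suc n)" using P unfolding limit_points_def by blast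
  have "x \<noteq> P" using A Pn by blast
  moreover have "x + u \<noteq> P"
  proof
    assume "x + u = P"
    then have "x - c (Suc n) = (P - c (Suc n)) - u" by (simp add: algebra_simps)
    then show False using Lambda_diff[OF Pn] A by metis
  qed
  ultimately show "(\<sigma>(P := s)) (x + u) = (if u \<in> Lambda (Suc (Suc n)) then (\<sigma>(P := s)) x else - (\<sigma>(P := s)) x)"
    using field_flip[OF F, of x n u] A by simp
qed

text \<open>Each of the four unit vectors spans an edge at \<open>P\<close> with exactly one
  orientation of type \<open>t\<close>.\<close>

lemma card_typed_segments_at: "card {s. typed_segment t s \<and> P \<in> support s} = 4"
proof -
  define U :: "point set" where "U = {(1, 0), (-1, 0), (0, 1), (0, -1)}"
  define g where "g d = (if typed_segment t (P, P + d) then (P, P + d) else (P + d, P))" for d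
  have U: "d \<in> U \<longleftrightarrow> unit_vec d" for d by (simp add: U_def unit_vec_def)
  have nz: "d \<noteq> 0" if "unit_vec d" for d using that by (auto simp: unit_vec_def zero_prod_def)
  have sup: "support (g d) = {P, P + d}" for d by (auto simp: g_def support_def)
  have "inj_on g U"
  proof
    fix d d' assume "d \<in> U" "d' \<in> U" "g d = g d'"
    then have "{P, P + d} = {P, P + d'}" using sup by metis
    then show "d = d'" unfolding doubleton_eq_iff by auto
  qed
  moreover have "{s. typed_segment t s \<and> P \<in> support s} = g ` U"
  proof (intro set_eqI iffI)
    fix s assume "s \<in> {s. typed_segment t s \<and> P \<in> support s}"
    then have s: "typed_segment t s" "P = fst s \<or> P = snd s" by (auto simp: support_def)
    have gt: "typed_segment t (g d)" if "unit_vec d" for d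
      using typed_segment_exists[of "(P, P + d)" t] that by (auto simp: g_def)
    define d where "d = (if P = fst s then snd s - P else fst s - P)"
    have "unit_vec (- z)" if "unit_vec z" for z using that by (auto simp: unit_vec_def)
    from this[of "snd s - fst s"] have d: "unit_vec d" using s by (auto simp: d_def typed_segment_def)
    have "support s = {P, P + d}" using s(2) by (auto simp: support_def d_def)
    then have "s = g d" using typed_support_unique[OF s(1) gt[OF d]] sup by simp
    then show "s \<in> g ` U" using d U by blast
  next
    fix s assume "s \<in> g ` U"
    then obtain d where d: "unit_vec d" "s = g d" using U by blast
    have "typed_segment t (g d)" using typed_segment_exists[of "(P, P + d)" t] d(1) by (auto simp: g_def)
    then show "s \<in> {s. typed_segment t s \<and> P \<in> support s}" using sup[of d] d(2) by simp
  qed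
  moreover have "card U = 4" by (simp add: U_def)
  ultimately show ?thesis by (simp add: card_image)
qed

lemma field_coverings_differ:
  assumes \<sigma>: "signs \<sigma>" and \<rho>: "signs \<rho>" and eq: "\<And>x. x \<noteq> P \<Longrightarrow> \<rho> x = \<sigma> x" and ne: "\<rho> P \<noteq> \<sigma> P"
  shows "differ_only_at P (field_covering \<sigma> t) (field_covering \<rho> t)"
  unfolding differ_only_at_def covering_segments_field_covering[OF \<sigma>] covering_segments_field_covering[OF \<rho>]
    connections_field_covering[OF \<sigma>] connections_field_covering[OF \<rho>]
proof (intro conjI)
  show "card {s \<in> {s. typed_segment t s}. P \<in> support s} = 4" using card_typed_segments_at[of t P] by simp
  have n: "nxt \<rho> s = nxt \<sigma> s" if "snd s \<noteq> P" for s using eq[OF that] by (simp add: nxt_def)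
  show "{(s, r). (s, r) \<in> {(s, nxt \<sigma> s) | s. typed_segment t s} \<and> snd s \<noteq> P} =
    {(s, r). (s, r) \<in> {(s, nxt \<rho> s) | s. typed_segment t s} \<and> snd s \<noteq> P}" using n by auto
  obtain s where s: "typed_segment t s" "snd s = P" using typed_segment_ending by blast
  have u: "unit_vec (snd s - fst s)" using s(1) by (simp add: typed_segment_def)
  have "turn (\<sigma> P) (snd s - fst s) \<noteq> turn (\<rho> P) (snd s - fst s)"
    using u ne unfolding unit_vec_def insert_iff empty_iff turn_def by (elim disjE FalseE) simp_all
  then have "nxt \<sigma> s \<noteq> nxt \<rho> s" using s(2) by (simp add: nxt_def)
  then have "(s, nxt \<sigma> s) \<notin> {(s, r). (s, r) \<in> {(s, nxt \<rho> s) | s. typed_segment t s} \<and> snd s = P}" by blast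
  moreover have "(s, nxt \<sigma> s) \<in> {(s, r). (s, r) \<in> {(s, nxt \<sigma> s) | s. typed_segment t s} \<and> snd s = P}" using s by blast
  ultimately show "{(s, r). (s, r) \<in> {(s, nxt \<sigma> s) | s. typed_segment t s} \<and> snd s = P} \<noteq>
    {(s, r). (s, r) \<in> {(s, nxt \<rho> s) | s. typed_segment t s} \<and> snd s = P}" by metis
qed simp

theorem theorem3p10:
  fixes C :: "int \<Rightarrow> segment"
  assumes "complete_folding_curve C"
  shows "if E_inf C = {} \<or> (\<exists>P i. E_inf C = {P} \<and> P \<in> support (C i))
         then \<exists>!\<C>. \<C> \<in> LI_coverings_containing C
         else \<exists>P. E_inf C = {P} \<and>
           (\<exists>\<C>\<^sub>1 \<C>\<^sub>2. \<C>\<^sub>1 \<noteq> \<C>\<^sub>2 \<and> LI_coverings_containing C = {\<C>\<^sub>1, \<C>\<^sub>2} \<and>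
              differ_only_at P \<C>\<^sub>1 \<C>\<^sub>2)"
proof -
  note P = complete_folding_curve_path[OF assms]
  define t where "t = seg_type (C 0)"
  obtain \<sigma> c where \<sigma>: "sign_field \<sigma> c" "\<And>i. turns C i = \<sigma> (snd (C i))"
    and c: "\<And>n. \<exists>e. c n = snd (C e) \<and> folds (turns C) (Suc n) e"
    using canonical_field[OF P(1,2)] by blast
  have "E_curve n C = {x. x - c n \<in> Lambda n}" for n using c[of n] E_curve_eq[OF assms] by metis
  then have Einf: "E_inf C = limit_points c" unfolding E_inf_def limit_points_def by blast
  have visit: "(\<exists>i. Q \<in> support (C i)) \<longleftrightarrow> (\<exists>i. Q = snd (C i))" for Q
  proof -
    have "fst (C i) = snd (C (i - 1))" for i using P(3)[of i] by (metis fst_conv)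
    then show ?thesis unfolding support_def by auto
  qed
  have LI: "field_covering \<rho> t \<in> LI_coverings_containing C"
    if \<rho>: "sign_field \<rho> c" "\<And>i. \<rho> (snd (C i)) = \<sigma> (snd (C i))" for \<rho>
  proof -
    have "follows \<rho> C" unfolding follows_def nxt_def
      using complete_folding_curve_next[OF assms] \<sigma>(2) \<rho>(2) by simp
    then have "curve_class C \<in> field_covering \<rho> t"
      unfolding field_covering_def using curve_typed[OF assms, of 0] unfolding t_def by blast
    then show ?thesis unfolding LI_coverings_containing_def
      using folding_covering_field_covering[OF \<rho>(1)] field_covering_local_isomorphism[OF \<rho>(1)] by blast
  qed
  have only: "\<exists>\<rho>. signs \<rho> \<and> \<C> = field_covering \<rho> t \<and> (\<forall>x. x \<notin> limit_points c \<longrightarrow> \<rho> x = \<sigma> x) \<and>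
      (\<forall>i. \<rho> (snd (C i)) = \<sigma> (snd (C i)))"
    if "\<C> \<in> LI_coverings_containing C" for \<C>
  proof -
    have F: "folding_covering \<C>" "local_isomorphism_property \<C>" "curve_class C \<in> \<C>"
      using that unfolding LI_coverings_containing_def by blast+
    obtain \<rho> where "signs \<rho> \<and> \<C> = field_covering \<rho> t \<and> (\<forall>\<gamma>\<in>\<C>. \<forall>D\<in>\<gamma>. \<forall>i. turns D i = \<rho> (snd (D i)))"
      using covering_eq_field_covering[of \<C> t, OF F(1)] covering_typed[OF F] unfolding t_def by blast
    then have \<rho>: "signs \<rho>" "\<C> = field_covering \<rho> t" "\<And>\<gamma> D i. \<gamma> \<in> \<C> \<Longrightarrow> D \<in> \<gamma> \<Longrightarrow> turns D i = \<rho> (snd (D i))"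
      by blast+
    have "\<rho> x = \<sigma> x" if "x \<notin> limit_points c" for x
      by (rule covering_sign_determined[OF F \<rho> \<sigma> that])
    moreover have "\<rho> (snd (C i)) = \<sigma> (snd (C i))" for i using \<rho>(3)[OF F(3) curve_class_refl] \<sigma>(2) by simp
    ultimately show ?thesis using \<rho>(1,2) by blast
  qed
  show ?thesis
  proof (cases "E_inf C = {} \<or> (\<exists>P i. E_inf C = {P} \<and> P \<in> support (C i))")
    case True
    have "\<C> = field_covering \<sigma> t" if L: "\<C> \<in> LI_coverings_containing C" for \<C>
    proof -
      obtain \<rho> where \<rho>: "\<C> = field_covering \<rho> t" "\<And>x. x \<notin> limit_points c \<Longrightarrow> \<rho> x = \<sigma> x"
        "\<And>i. \<rho> (snd (C i)) = \<sigma> (snd (C i))" using only[OF L] by blast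
      have "\<rho> x = \<sigma> x" for x
      proof (cases "x \<in> limit_points c")
        case x: True
        \<comment> \<open>A limit point can only exist here if \<open>C\<close> passes through it,
          and then the turn of \<open>C\<close> fixes the remaining sign.\<close>
        then have "\<exists>i. x \<in> support (C i)" using True unfolding Einf by auto
        then show ?thesis using \<rho>(3) visit by metis
      qed (rule \<rho>(2))
      then have "\<rho> = \<sigma>" by blast
      then show ?thesis using \<rho>(1) by simp
    qed
    then have "\<exists>!\<C>. \<C> \<in> LI_coverings_containing C" using LI[OF \<sigma>(1)] by blast
    then show ?thesis using True by simp
  next
    case False
    then obtain Q where "Q \<in> limit_points c" unfolding Einf by blast
    then have Q: "limit_points c = {Q}" using limit_points_unique by blast
    have nv: "snd (C i) \<noteq> Q" for i using False visit unfolding Einf Q by blast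
    \<comment> \<open>\<open>C\<close> avoids \<open>Q\<close>, so it obeys the turning rule for
      either sign at \<open>Q\<close>.\<close>
    define \<rho> where "\<rho> = \<sigma>(Q := - \<sigma> Q)"
    have s: "\<sigma> Q \<in> {1, -1}" by (rule field_sign[OF \<sigma>(1)])
    have f\<rho>: "sign_field \<rho> c" unfolding \<rho>_def using s by (intro field_upd_limit_point[OF \<sigma>(1)]) (auto simp: Q)
    have dif: "differ_only_at Q (field_covering \<sigma> t) (field_covering \<rho> t)"
      using s by (intro field_coverings_differ field_signs[OF \<sigma>(1)] field_signs[OF f\<rho>]) (auto simp: \<rho>_def)
    have "field_covering \<rho> t \<in> LI_coverings_containing C" by (rule LI[OF f\<rho>]) (simp add: \<rho>_def nv)
    moreover have "field_covering \<sigma> t \<in> LI_coverings_containing C" by (rule LI[OF \<sigma>(1)]) simp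
    moreover have "\<C> = field_covering \<sigma> t \<or> \<C> = field_covering \<rho> t" if L: "\<C> \<in> LI_coverings_containing C" for \<C>
    proof -
      obtain \<rho>' where \<rho>': "signs \<rho>'" "\<C> = field_covering \<rho>' t" "\<And>x. x \<noteq> Q \<Longrightarrow> \<rho>' x = \<sigma> x"
        using only[OF L] unfolding Q by blast
      have "\<rho>' Q = \<sigma> Q \<or> \<rho>' Q = - \<sigma> Q" using signsD[OF \<rho>'(1), of Q] s by auto
      then have "\<rho>' = \<sigma> \<or> \<rho>' = \<rho>"
      proof
        assume "\<rho>' Q = \<sigma> Q"
        then have "\<rho>' x = \<sigma> x" for x using \<rho>'(3) by (cases "x = Q") simp_all
        then show ?thesis by blast
      next
        assume "\<rho>' Q = - \<sigma> Q"
        then have "\<rho>' x = \<rho> x" for x using \<rho>'(3) unfolding \<rho>_def by (cases "x = Q") simp_all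
        then show ?thesis by blast
      qed
      then show ?thesis using \<rho>'(2) by blast
    qed
    ultimately have "LI_coverings_containing C = {field_covering \<sigma> t, field_covering \<rho> t}" by blast
    moreover have "field_covering \<sigma> t \<noteq> field_covering \<rho> t" using dif unfolding differ_only_at_def by metis
    ultimately have "\<exists>P. E_inf C = {P} \<and> (\<exists>\<C>\<^sub>1 \<C>\<^sub>2. \<C>\<^sub>1 \<noteq> \<C>\<^sub>2 \<and> LI_coverings_containing C = {\<C>\<^sub>1, \<C>\<^sub>2} \<and>
       differ_only_at P \<C>\<^sub>1 \<C>\<^sub>2)" using dif Q unfolding Einf by blast
    then show ?thesis using False by (simp only: if_False)
  qed
qed

end
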